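(* Let $u\in \mathcal{C}^0(\overline{\Omega})$ be a weak solution to $$ \begin{cases} (-\Delta)^s u=f(x,u) & \text{in } \Omega,\\ u>0 & \text{in } \Omega,\\ u=0 & \text{in } \mathbb{R}^N\setminus\Omega, \end{cases} $$ and let $\Omega$ be convex with respect to the $x_1$-direction and symmetric with respect to $T_0=\{x\in\mathbb{R}^N : x_1=0\}$. For $x=(x_1,x')$ and $\lambda\in\mathbb{R}$ set $x_\lambda=(2\lambda-x_1,x')$, and assume that $$f(x,t)\leq f(x_\lambda,t)\quad\text{if } \lambda<0,\ x\in\Omega\cap\{x_1<\lambda\},\ t\in[0,\infty),$$ and $$f(x,t)=f(x_0,t)\quad\text{if } x\in\Omega\cap\{x_1<0\},\ t\in[0,\infty),$$ where $x_0=(-x_1,x')$. Assume also that either (a) or (b) holds, where: (a) $f$ is a Carathéodory function which is locally Lipschitz continuous in the second variable, namely for any $M>0$ there is $L_f(M)$ with $|f(x,t_1)-f(x,t_2)|\le L_f(M)|t_1-t_2|$ for $x\in\Omega$, $t_1,t_2\in[0,M]$; moreover $f(x,t)$ is nondecreasing with respect to $t$ for any $x\in\Omega$; (b) $f$ is a Carathéodory function which is locally Lipschitz continuous in the second variable (in the sense written out in (a)), and $f$ is Hölder continuous with respect to $x$ away from the origin, namely for any $M>0$ and $r>0$, for some $\gamma\in(0,1)$, it holds that $|f(x_1,t)-f(x_2,t)|\le C(M,r)|x_1-x_2|^\gamma$ for $x_1,x_2\in\Omega\setminus B_r(0)$ and $t\in[0,M]$. Then $u$ is symmetric with respect to the $x_1$-variable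 (that is, $u(x_1,x')=u(-x_1,x')$) and strictly increasing with respect to the $x_1$-direction for $x_1<0$. Moreover, if $\Omega$ is a ball, then $u$ is radial and strictly radially decreasing.
   Context: Throughout, $0<s<1$, $N>2s$, $\Omega\subset\mathbb{R}^N$ is a bounded smooth domain with $0\in\Omega$, and $f:\Omega\times[0,\infty)\to\mathbb{R}$. Fractional Laplacian: $(-\Delta)^s u(x)=c_{N,s}\,\mathrm{P.V.}\int_{\mathbb{R}^N}\frac{u(x)-u(y)}{|x-y|^{N+2s}}\,dy$ with $c_{N,s}=\left(\int_{\mathbb{R}^N}\frac{1-\cos(\xi_1)}{|\xi|^{N+2s}}\,d\xi\right)^{-1}$. $H^s_0(\Omega)=\{u\in H^s(\mathbb{R}^N): u=0 \text{ in } \mathbb{R}^N\setminus\Omega\}$. Weak solution: $u\in H^s_0(\Omega)$ (with $u>0$ in $\Omega$) is a weak solution of the problem if $f(x,u)\in L^1(\Omega)$ and, for all $\varphi\in H^s_0(\Omega)\cap L^\infty(\Omega)$, $$\frac{c_{N,s}}{2}\int_Q\frac{(u(x)-u(y))(\varphi(x)-\varphi(y))}{|x-y|^{N+2s}}\,dx\,dy=\int_\Omega f(x,u)\varphi\,dx,$$ where $Q=\mathbb{R}^{2N}\setminus(\Omega^c\times\Omega^c)$.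
   Formalization: For the ball clause, f is additionally assumed to satisfy the reflection inequality and symmetry in every direction through the ball's centre, not only in x_1; without this the clause is false for N≥2 (e.g. f(x,t)=2+x_2 on the unit ball). *)

theory Defs
  imports "HOL-Analysis.Analysis"
begin

section \<open>Domains\<close>

primrec Ck_fun :: "nat \<Rightarrow> ('a::euclidean_space \<Rightarrow> real) \<Rightarrow> bool" where
  "Ck_fun 0 g \<longleftrightarrow> continuous_on UNIV g"
| "Ck_fun (Suc n) g \<longleftrightarrow>
     g differentiable_on UNIV \<and> (\<forall>b\<in>Basis. Ck_fun n (\<lambda>x. frechet_derivative g (at x) b))"

definition smooth_fun :: "('a::euclidean_space \<Rightarrow> real) \<Rightarrow> bool" where
  "smooth_fun g \<longleftrightarrow> (\<forall>n. Ck_fun n g)"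

text \<open>Near every boundary point the set is, after a rotation of the axes that makes the unit
  vector \<open>\<nu>\<close> the last coordinate direction, the region strictly above the graph of a smooth
  function. Here \<open>x - (x \<bullet> \<nu>) *\<^sub>R \<nu>\<close> collects the remaining \<open>N - 1\<close> coordinates of \<open>x\<close>, so only
  the restriction of \<open>g\<close> to the hyperplane orthogonal to \<open>\<nu>\<close> is relevant.\<close>

definition smooth_boundary :: "'a::euclidean_space set \<Rightarrow> bool" where
  "smooth_boundary \<Omega> \<longleftrightarrow>
     (\<forall>p\<in>frontier \<Omega>. \<exists>r>0. \<exists>\<nu> g. norm \<nu> = 1 \<and> smooth_fun g \<and>
        \<Omega> \<inter> ball p r = {x \<in> ball p r. x \<bullet> \<nu> > g (x - (x \<bullet> \<nu>) *\<^sub>R \<nu>)})"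

definition bounded_smooth_domain :: "'a::euclidean_space set \<Rightarrow> bool" where
  "bounded_smooth_domain \<Omega> \<longleftrightarrow>
     open \<Omega> \<and> connected \<Omega> \<and> \<Omega> \<noteq> {} \<and> bounded \<Omega> \<and> smooth_boundary \<Omega>"

definition convex_in_coordinate :: "'n::finite \<Rightarrow> (real^'n) set \<Rightarrow> bool" where
  "convex_in_coordinate k \<Omega> \<longleftrightarrow>
     (\<forall>x\<in>\<Omega>. \<forall>y\<in>\<Omega>. (\<forall>j. j \<noteq> k \<longrightarrow> x $ j = y $ j) \<longrightarrow> closed_segment x y \<subseteq> \<Omega>)"

text \<open>For a unit vector \<open>e\<close>, the reflection in the hyperplane \<open>{x. x \<bullet> e = \<mu>}\<close>.\<close>

definition reflect :: "'a::euclidean_space \<Rightarrow> real \<Rightarrow> 'a \<Rightarrow> 'a" where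
  "reflect e \<mu> x = x + (2 * (\<mu> - x \<bullet> e)) *\<^sub>R e"

lemma reflect_axis:
  fixes x :: "real^'n::finite"
  shows "reflect (axis k 1) \<mu> x = (\<chi> j. if j = k then 2 * \<mu> - x $ k else x $ j)"
proof -
  have "x \<bullet> axis k 1 = x $ k"
    by (simp add: inner_axis)
  then show ?thesis
    by (simp add: reflect_def vec_eq_iff axis_def)
qed

section \<open>Fractional Sobolev spaces and weak solutions\<close>

text \<open>The coordinate \<open>k\<close> plays the role of the first one; the value does not depend on it.\<close>

definition frac_const :: "'n::finite \<Rightarrow> real \<Rightarrow> real" where
  "frac_const k s =
     inverse (LINT \<xi>|lebesgue. (1 - cos ((\<xi> :: real^'n) $ k)) / norm \<xi> powr (real CARD('n) + 2 * s))"

definition Hs :: "real \<Rightarrow> (real^'n::finite \<Rightarrow> real) set" where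
  "Hs s = {u. u \<in> borel_measurable lebesgue \<and>
     integrable lebesgue (\<lambda>x. (u x)\<^sup>2) \<and>
     integrable lebesgue (\<lambda>(x, y). (u x - u y)\<^sup>2 / norm (x - y) powr (real CARD('n) + 2 * s))}"

text \<open>Elements are functions rather than equivalence classes. Vanishing outside \<open>\<Omega>\<close> is required
  pointwise; every class that vanishes almost everywhere outside \<open>\<Omega>\<close> has such a representative.\<close>

definition Hs0 :: "real \<Rightarrow> (real^'n::finite) set \<Rightarrow> (real^'n \<Rightarrow> real) set" where
  "Hs0 s \<Omega> = {u \<in> Hs s. \<forall>x. x \<notin> \<Omega> \<longrightarrow> u x = 0}"

definition ess_bounded :: "('a::euclidean_space \<Rightarrow> real) \<Rightarrow> bool" where
  "ess_bounded \<phi> \<longleftrightarrow> \<phi> \<in> borel_measurable lebesgue \<and> (\<exists>C. AE x in lebesgue. \<bar>\<phi> x\<bar> \<le> C)"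

text \<open>A nonlinearity on \<open>\<Omega> \<times> [0,\<infinity>)\<close> is represented by a total function, of which only the values at
  \<open>x \<in> \<Omega>\<close> and \<open>t \<ge> 0\<close> are used.\<close>

definition weak_solution ::
  "'n::finite \<Rightarrow> real \<Rightarrow> (real^'n) set \<Rightarrow> (real^'n \<Rightarrow> real \<Rightarrow> real) \<Rightarrow> (real^'n \<Rightarrow> real) \<Rightarrow> bool" where
  "weak_solution k s \<Omega> f u \<longleftrightarrow>
     u \<in> Hs0 s \<Omega> \<and> (\<forall>x\<in>\<Omega>. u x > 0) \<and>
     set_integrable lebesgue \<Omega> (\<lambda>x. f x (u x)) \<and>
     (\<forall>\<phi> \<in> Hs0 s \<Omega> \<inter> Collect ess_bounded.
        frac_const k s / 2 *
          (LINT z : - ((- \<Omega>) \<times> (- \<Omega>)) | lebesgue.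
             (u (fst z) - u (snd z)) * (\<phi> (fst z) - \<phi> (snd z))
               / norm (fst z - snd z) powr (real CARD('n) + 2 * s))
        = (LINT x : \<Omega> | lebesgue. f x (u x) * \<phi> x))"

section \<open>Assumptions on the nonlinearity\<close>

definition Caratheodory :: "'a::euclidean_space set \<Rightarrow> ('a \<Rightarrow> real \<Rightarrow> real) \<Rightarrow> bool" where
  "Caratheodory \<Omega> f \<longleftrightarrow>
     (\<forall>t\<ge>0. set_borel_measurable lebesgue \<Omega> (\<lambda>x. f x t)) \<and>
     (AE x in lebesgue. x \<in> \<Omega> \<longrightarrow> continuous_on {0..} (f x))"

definition loc_Lipschitz_snd :: "'a set \<Rightarrow> ('a \<Rightarrow> real \<Rightarrow> real) \<Rightarrow> bool" where
  "loc_Lipschitz_snd \<Omega> f \<longleftrightarrow>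
     (\<forall>M>0. \<exists>L. \<forall>x\<in>\<Omega>. \<forall>t1\<in>{0..M}. \<forall>t2\<in>{0..M}. \<bar>f x t1 - f x t2\<bar> \<le> L * \<bar>t1 - t2\<bar>)"

definition nondecreasing_snd :: "'a set \<Rightarrow> ('a \<Rightarrow> real \<Rightarrow> real) \<Rightarrow> bool" where
  "nondecreasing_snd \<Omega> f \<longleftrightarrow> (\<forall>x\<in>\<Omega>. mono_on {0..} (f x))"

definition Hoelder_away_from_origin ::
  "'a::euclidean_space set \<Rightarrow> ('a \<Rightarrow> real \<Rightarrow> real) \<Rightarrow> bool" where
  "Hoelder_away_from_origin \<Omega> f \<longleftrightarrow>
     (\<forall>M>0. \<forall>r>0. \<exists>\<gamma>. 0 < \<gamma> \<and> \<gamma> < 1 \<and>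
        (\<exists>C. \<forall>x \<in> \<Omega> - ball 0 r. \<forall>y \<in> \<Omega> - ball 0 r. \<forall>t\<in>{0..M}.
           \<bar>f x t - f y t\<bar> \<le> C * norm (x - y) powr \<gamma>))"

text \<open>Monotonicity of \<open>f\<close> under reflection in the hyperplanes \<open>{x. x \<bullet> e = \<mu>}\<close>, \<open>\<mu> < m\<close>, and symmetry
  with respect to the limiting hyperplane \<open>{x. x \<bullet> e = m}\<close>. With \<open>e = axis k 1\<close> and \<open>m = 0\<close> these are
  the inequality for \<open>x\<^sub>\<mu> = (2 \<mu> - x\<^sub>1, x')\<close>, \<open>\<mu> < 0\<close>, and the identity for \<open>x\<^sub>0 = (- x\<^sub>1, x')\<close>.
  For a ball with centre \<open>c\<close> the assumption is needed in every direction \<open>e\<close>, with \<open>m = c \<bullet> e\<close>: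
  the inequality in the single direction \<open>x\<^sub>1\<close> puts no restriction on how \<open>f\<close> depends on \<open>x'\<close>, so it
  does not imply radial symmetry when \<open>N \<ge> 2\<close> (take \<open>f(x,t) = 2 + x\<^sub>2\<close> on the unit ball).\<close>

definition reflection_monotone ::
  "'a::euclidean_space set \<Rightarrow> ('a \<Rightarrow> real \<Rightarrow> real) \<Rightarrow> 'a \<Rightarrow> real \<Rightarrow> bool" where
  "reflection_monotone \<Omega> f e m \<longleftrightarrow>
     (\<forall>\<mu><m. \<forall>x\<in>\<Omega>. x \<bullet> e < \<mu> \<longrightarrow> (\<forall>t\<ge>0. f x t \<le> f (reflect e \<mu> x) t)) \<and>
     (\<forall>x\<in>\<Omega>. x \<bullet> e < m \<longrightarrow> (\<forall>t\<ge>0. f x t = f (reflect e m x) t))"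

end

theory Submission
  imports Defs
begin

text \<open>
  The theorem is proved by moving planes, entirely at the level of the weak formulation. For a unit
  vector \<open>e\<close> and a level \<open>\<mu>\<close> let \<open>R\<close> be the reflection in \<open>{x. x \<bullet> e = \<mu>}\<close> and \<open>w = u \<circ> R - u\<close>. This
  function is antisymmetric, \<open>w \<circ> R = - w\<close>, and the claim is that \<open>w \<ge> 0\<close> on the half-space
  \<open>x \<bullet> e < \<mu>\<close> for all \<open>\<mu>\<close> up to the level \<open>m\<close> of the symmetry plane, with strict inequality in the cap
  \<open>D = {x \<in> \<Omega>. x \<bullet> e < \<mu>}\<close> when \<open>\<mu> < m\<close>. The monotonicity of \<open>f\<close> under reflections and its Lipschitz
  continuity in the second variable make \<open>w\<close> a weak supersolution,
  \<open>(- \<Delta>)\<^sup>s w \<ge> - L \<bar>w\<bar>\<close> in \<open>D\<close>. Besides this only two maximum principles for antisymmetric functions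
  are needed.

  Both rest on one pointwise inequality for the integrand of the energy form, lemma
  \<open>reflect_sum_interaction_le\<close>. Reflections preserve Lebesgue measure, so an integral over pairs
  \<open>(x, y)\<close> only depends on the sum of the integrand over the four pairs obtained by reflecting \<open>x\<close>
  or \<open>y\<close>, and it suffices to estimate this sum for \<open>x\<close> and \<open>y\<close> in the half-space. There
  \<open>norm (x - y) \<le> norm (x - R y)\<close>, so the kernel \<open>K = 1 / norm z powr (N + 2 s)\<close> is larger between
  \<open>x\<close> and \<open>y\<close> than between \<open>x\<close> and the mirror image of \<open>y\<close>, and the nonlocal interaction with the
  values of the other sign beyond the plane is dominated by the interaction inside the half-space.

  \<^item> Small volume (\<open>small_volume_maximum_principle\<close>): testing with the negative part \<open>\<phi>\<close> of \<open>w\<close> on the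
    half-space gives \<open>energy \<phi> \<phi> \<le> L \<integral> \<phi>\<^sup>2\<close>. If \<open>{w < 0}\<close> has small measure, then most of a small ball
    around each of its points lies outside, and the interaction with these points, where \<open>\<phi> = 0\<close>,
    already makes the energy exceed \<open>L \<integral> \<phi>\<^sup>2\<close> unless \<open>\<phi> = 0\<close>. This replaces a Sobolev inequality.

  \<^item> Strong maximum principle (\<open>antisymmetric_strong_maximum_principle\<close>): if \<open>w \<ge> 0\<close> on the half-space
    and \<open>w z > 0\<close> somewhere, then \<open>w > 0\<close> in \<open>D\<close>. One compares \<open>w\<close> near \<open>c \<in> D\<close> with \<open>\<epsilon>\<close> times a
    paraboloid cut off at \<open>0\<close>. Testing with the positive part of the difference, the positive values
    of \<open>w\<close> near \<open>z\<close> contribute a gain independent of \<open>\<epsilon>\<close>, while all losses are of order \<open>\<epsilon>\<close>. The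
    barrier is semiconvex at the points where it is tested, which is all that
    \<open>energy_le_of_second_difference\<close> asks for; in this way no principal value occurs.

  The set of levels at which \<open>w \<ge> 0\<close> contains all levels below \<open>\<Omega>\<close>, is closed under limits from
  below by continuity, and extends to the right of each of its levels \<open>\<mu> < m\<close>: by the strict
  inequality the bad sets at levels \<open>\<nu> \<down> \<mu>\<close> shrink to a subset of the hyperplane, so their measure
  tends to \<open>0\<close> and the small volume principle applies. Hence \<open>u \<le> u \<circ> R\<close> for the symmetry plane. Since
  \<open>u \<circ> R\<close> solves the same problem, equality holds, and strict monotonicity is the strict inequality
  between \<open>x\<close> and its mirror image. In a ball this applies in every direction \<open>e\<close>, and invariance under
  all reflections through the centre means radial symmetry.
\<close>

section \<open>The fractional kernel\<close>

text \<open>The value at the origin is \<open>0\<close>, because of division by zero. Monotonicity in the norm therefore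
  needs \<open>z \<noteq> 0\<close>, and the diagonal \<open>x = y\<close> is treated separately wherever kernels are compared.\<close>

definition frac_kernel :: "real \<Rightarrow> real^'n::finite \<Rightarrow> real" where
  "frac_kernel s z = 1 / norm z powr (real CARD('n) + 2 * s)"

lemma frac_kernel_measurable [measurable]:
  "frac_kernel s \<in> borel_measurable (borel :: (real^'n::finite) measure)"
  unfolding frac_kernel_def[abs_def] by measurable

lemma frac_kernel_nonneg [simp]: "0 \<le> frac_kernel s z"
  by (simp add: frac_kernel_def)

lemma frac_kernel_0 [simp]: "frac_kernel s 0 = 0"
  by (simp add: frac_kernel_def)

lemma frac_kernel_minus [simp]: "frac_kernel s (- z) = frac_kernel s z"
  by (simp add: frac_kernel_def)

lemma frac_kernel_commute: "frac_kernel s (x - y) = frac_kernel s (y - x)"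
  by (simp add: frac_kernel_def norm_minus_commute)

lemma frac_kernel_antimono:
  fixes z z' :: "real^'n::finite"
  assumes "0 < s" "z \<noteq> 0" "norm z \<le> norm z'"
  shows "frac_kernel s z' \<le> frac_kernel s z"
  unfolding frac_kernel_def using assms
  by (intro divide_left_mono powr_mono2 mult_pos_pos) auto

lemma frac_kernel_strict_antimono:
  fixes z z' :: "real^'n::finite"
  assumes "0 < s" "z \<noteq> 0" "norm z < norm z'"
  shows "frac_kernel s z' < frac_kernel s z"
  unfolding frac_kernel_def using assms
  by (intro divide_strict_left_mono powr_less_mono2 mult_pos_pos) (auto simp: add_pos_nonneg)

lemma ennreal_term_le_suminf: "f j \<le> (\<Sum>i. f i)" for f :: "nat \<Rightarrow> ennreal"
  using sum_le_suminf[of f "{j}"] by simp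

text \<open>Dyadic shells take the place of polar coordinates: \<open>r\<close> lies in \<open>[2 ^ j, 2 ^ (j + 1))\<close> for some
  \<open>j\<close>, and the integral of each summand over space is a multiple of the volume of a ball.\<close>

lemma powr_tail_le_dyadic_sum:
  fixes r a :: real
  assumes "1 \<le> r" "0 < a"
  shows "ennreal (1 / r powr a) \<le> (\<Sum>j. ennreal (2 powr (- real j * a)) * indicator {..<2 ^ Suc j} r)"
proof -
  define j where "j = nat \<lfloor>log 2 r\<rfloor>"
  have "0 \<le> log 2 r" using assms by simp
  then have j: "real j \<le> log 2 r" "log 2 r < real j + 1"
    unfolding j_def by linarith+
  have lo: "2 powr real j \<le> r"
    using j(1) assms(1) by (simp add: le_log_iff)
  have hi: "r < 2 ^ Suc j"
  proof -
    have "r < 2 powr (real j + 1)"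
      using j(2) assms(1) by (simp add: log_less_iff)
    also have "\<dots> = 2 ^ Suc j"
      by (simp add: powr_add powr_realpow)
    finally show ?thesis .
  qed
  have "(2 powr real j) powr a \<le> r powr a"
    using lo assms by (intro powr_mono2) auto
  then have "1 / r powr a \<le> 1 / (2 powr real j) powr a"
    using assms by (intro divide_left_mono) auto
  also have "\<dots> = 2 powr (- real j * a)"
    by (simp add: powr_powr powr_minus divide_inverse)
  finally have "ennreal (1 / r powr a) \<le> ennreal (2 powr (- real j * a)) * indicator {..<2 ^ Suc j} r"
    using hi by (simp add: ennreal_leI)
  also have "\<dots> \<le> (\<Sum>i. ennreal (2 powr (- real i * a)) * indicator {..<2 ^ Suc i} r)"
    by (rule ennreal_term_le_suminf[where f = "\<lambda>i. ennreal (2 powr (- real i * a)) * indicator {..<2 ^ Suc i} r"])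
  finally show ?thesis .
qed

text \<open>The counterpart near the origin. The exponent \<open>2 - N - 2 s\<close> to which it is applied is negative
  except possibly in dimension one, and the factor \<open>max 1 (2 powr - b)\<close> serves both signs.\<close>

lemma powr_near_zero_le_dyadic_sum:
  fixes r b :: real
  assumes "0 < r" "r < 1"
  shows "ennreal (r powr b) \<le> (\<Sum>j. ennreal (max 1 (2 powr - b) * 2 powr (- real j * b)) * indicator {..<2 / 2 ^ Suc j} r)"
proof -
  define j where "j = nat (\<lceil>- log 2 r\<rceil> - 1)"
  have "0 < - log 2 r" using assms by simp
  then have "0 < \<lceil>- log 2 r\<rceil>" by linarith
  then have j: "real j < - log 2 r" "- log 2 r \<le> real j + 1"
    unfolding j_def by linarith+
  have lo: "2 powr (- real j - 1) \<le> r"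
    using j(2) assms(1) by (simp add: le_log_iff[symmetric] powr_le_iff)
  have hi': "r < 2 powr (- real j)"
    using j(1) assms(1) by (simp add: less_powr_iff)
  moreover have "2 powr (- real j) = 2 / 2 ^ Suc j"
    by (simp add: powr_minus_divide powr_realpow)
  ultimately have hi: "r < 2 / 2 ^ Suc j"
    by simp
  have "r powr b \<le> max 1 (2 powr - b) * 2 powr (- real j * b)"
  proof (cases "b \<ge> 0")
    case True
    have "r powr b \<le> (2 powr (- real j)) powr b"
      using hi' assms True by (intro powr_mono2) auto
    also have "\<dots> = 1 * 2 powr (- real j * b)" by (simp add: powr_powr)
    also have "\<dots> \<le> max 1 (2 powr - b) * 2 powr (- real j * b)"
      by (intro mult_right_mono) auto
    finally show ?thesis .
  next
    case False
    have "r powr b \<le> (2 powr (- real j - 1)) powr b"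
      using lo assms False by (intro powr_mono2') auto
    also have "\<dots> = 2 powr (- b + - real j * b)"
      by (subst powr_powr, rule arg_cong[where f = "(powr) 2"]) (simp add: algebra_simps)
    also have "\<dots> = 2 powr - b * 2 powr (- real j * b)"
      by (rule powr_add)
    also have "\<dots> \<le> max 1 (2 powr - b) * 2 powr (- real j * b)"
      by (intro mult_right_mono) auto
    finally show ?thesis .
  qed
  then have "ennreal (r powr b) \<le> ennreal (max 1 (2 powr - b) * 2 powr (- real j * b)) * indicator {..<2 / 2 ^ Suc j} r"
    using hi by (simp add: ennreal_leI)
  also have "\<dots> \<le> (\<Sum>i. ennreal (max 1 (2 powr - b) * 2 powr (- real i * b)) * indicator {..<2 / 2 ^ Suc i} r)"
    by (rule ennreal_term_le_suminf[where f = "\<lambda>i. ennreal (max 1 (2 powr - b) * 2 powr (- real i * b)) * indicator {..<2 / 2 ^ Suc i} r"])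
  finally show ?thesis .
qed

text \<open>Weights times volumes form a geometric series.\<close>

lemma nn_integral_dyadic_balls_finite:
  fixes \<rho> :: "nat \<Rightarrow> real" and w :: "nat \<Rightarrow> real"
  assumes nonneg: "\<And>j. 0 \<le> \<rho> j" "\<And>j. 0 \<le> w j" and g: "\<And>j. w j * \<rho> j ^ CARD('n) = C * q ^ j"
    and q: "0 \<le> q" "q < 1" "0 \<le> C"
  shows "(\<integral>\<^sup>+ z. (\<Sum>j. ennreal (w j) * indicator {..<\<rho> j} (norm z)) \<partial>(lborel :: (real^'n::finite) measure)) < \<infinity>"
proof -
  have "(\<integral>\<^sup>+ z. (\<Sum>j. ennreal (w j) * indicator {..<\<rho> j} (norm z)) \<partial>(lborel :: (real^'n) measure))
      = (\<Sum>j. \<integral>\<^sup>+ z. ennreal (w j) * indicator {..<\<rho> j} (norm z) \<partial>(lborel :: (real^'n) measure))"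
    by (rule nn_integral_suminf) measurable
  also have "\<dots> = (\<Sum>j. ennreal (unit_ball_vol (real CARD('n)) * C * q ^ j))"
  proof (rule suminf_cong)
    fix j
    have "(\<integral>\<^sup>+ z. ennreal (w j) * indicator {..<\<rho> j} (norm z) \<partial>(lborel :: (real^'n) measure))
        = (\<integral>\<^sup>+ z. ennreal (w j) * indicator (ball 0 (\<rho> j)) z \<partial>(lborel :: (real^'n) measure))"
      by (intro nn_integral_cong) (auto simp: indicator_def)
    also have "\<dots> = ennreal (w j) * emeasure lborel (ball (0::real^'n) (\<rho> j))"
      by (simp add: nn_integral_cmult_indicator)
    also have "\<dots> = ennreal (w j * (unit_ball_vol (real CARD('n)) * \<rho> j ^ CARD('n)))"
      using nonneg by (simp add: emeasure_ball ennreal_mult)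
    also have "w j * (unit_ball_vol (real CARD('n)) * \<rho> j ^ CARD('n)) = unit_ball_vol (real CARD('n)) * C * q ^ j"
      using g[of j] by (simp add: algebra_simps)
    finally show "(\<integral>\<^sup>+ z. ennreal (w j) * indicator {..<\<rho> j} (norm z) \<partial>(lborel :: (real^'n) measure))
        = ennreal (unit_ball_vol (real CARD('n)) * C * q ^ j)" .
  qed
  also have "\<dots> < \<infinity>"
    using q by (subst suminf_ennreal2) (auto intro!: summable_mult summable_geometric mult_nonneg_nonneg)
  finally show ?thesis .
qed

text \<open>At infinity the integrand is \<open>norm z powr (- N - 2 s)\<close>, integrable because \<open>s > 0\<close>; near the
  origin it is \<open>norm z powr (2 - N - 2 s)\<close>, integrable because \<open>s < 1\<close>.\<close>

lemma frac_kernel_truncated_integrable: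
  assumes s: "0 < s" "s < 1"
  shows "integrable lborel (\<lambda>z :: real^'n::finite. min 1 ((norm z)\<^sup>2) * frac_kernel s z)"
proof (rule integrableI_nonneg)
  let ?N = "real CARD('n)"
  let ?C = "2 ^ CARD('n) :: real"
  let ?a = "?N + 2 * s" and ?b = "2 - ?N - 2 * s"
  let ?A = "\<lambda>z :: real^'n. \<Sum>j. ennreal (2 powr (- real j * ?a)) * indicator {..<2 ^ Suc j} (norm z)"
  let ?B = "\<lambda>z :: real^'n. \<Sum>j. ennreal (max 1 (2 powr - ?b) * 2 powr (- real j * ?b)) * indicator {..<2 / 2 ^ Suc j} (norm z)"
  have le: "ennreal (min 1 ((norm z)\<^sup>2) * frac_kernel s z) \<le> ?A z + ?B z" for z :: "real^'n"
  proof -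
    consider "z = 0" | "1 \<le> norm z" | "0 < norm z" "norm z < 1" by force
    then show ?thesis
    proof cases
      case 1 then show ?thesis by simp
    next
      case 2
      have "min 1 ((norm z)\<^sup>2) * frac_kernel s z = 1 / norm z powr ?a"
        using 2 by (simp add: frac_kernel_def min_def)
      then have "ennreal (min 1 ((norm z)\<^sup>2) * frac_kernel s z) \<le> ?A z"
        using powr_tail_le_dyadic_sum[of "norm z" ?a] 2 s by (simp add: add_pos_nonneg)
      then show ?thesis by (simp add: add_increasing2)
    next
      case 3
      have "min 1 ((norm z)\<^sup>2) * frac_kernel s z \<le> (norm z)\<^sup>2 * frac_kernel s z"
        by (intro mult_right_mono) auto
      also have "\<dots> = norm z powr ?b"
        using 3 by (simp add: frac_kernel_def powr_diff powr_add)
      finally have "ennreal (min 1 ((norm z)\<^sup>2) * frac_kernel s z) \<le> ?B z"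
        using powr_near_zero_le_dyadic_sum[of "norm z" ?b] 3 by (meson ennreal_leI order_trans)
      then show ?thesis by (simp add: add_increasing)
    qed
  qed
  have A: "(\<integral>\<^sup>+ z. ?A z \<partial>lborel) < \<infinity>"
  proof (rule nn_integral_dyadic_balls_finite[where q = "2 powr (-2 * s)" and C = ?C])
    fix j :: nat
    have "2 powr (- real j * ?a) * (2 ^ Suc j) ^ CARD('n) = 2 powr (- real j * ?a) * 2 powr (real (Suc j) * ?N)"
      by (simp add: powr_realpow[symmetric] powr_power powr_powr algebra_simps del: power_Suc)
    also have "\<dots> = 2 powr (?N + real j * (-2 * s))"
      by (subst powr_add[symmetric], rule arg_cong[where f = "(powr) 2"]) (simp add: algebra_simps)
    also have "\<dots> = 2 ^ CARD('n) * (2 powr (-2 * s)) ^ j"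
      by (subst powr_add) (simp add: powr_realpow powr_power)
    finally show "2 powr (- real j * ?a) * (2 ^ Suc j) ^ CARD('n) = 2 ^ CARD('n) * (2 powr (-2 * s)) ^ j" .
    show "2 powr (- 2 * s) < 1" using s powr_less_mono[of "-2 * s" 0 2] by simp
  qed auto
  have B: "(\<integral>\<^sup>+ z. ?B z \<partial>lborel) < \<infinity>"
  proof (rule nn_integral_dyadic_balls_finite[where q = "2 powr (-(2-2 * s))" and C = "max 1 (2 powr - ?b)"])
    fix j :: nat
    have "(2 / 2 ^ Suc j) = (2::real) powr (- real j)"
      by (simp add: powr_minus_divide powr_realpow)
    then have "(2 / 2 ^ Suc j) ^ CARD('n) = (2::real) powr (- real j * ?N)"
      by (simp add: powr_power mult.commute)
    then have "2 powr (- real j * ?b) * (2 / 2 ^ Suc j) ^ CARD('n) = 2 powr (real j * (-(2-2 * s)))"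
      by (simp only:, subst powr_add[symmetric], intro arg_cong[where f = "(powr) 2"]) (simp add: algebra_simps)
    also have "\<dots> = (2 powr (-(2-2 * s))) ^ j"
      by (simp add: powr_power)
    finally show "max 1 (2 powr - ?b) * 2 powr (- real j * ?b) * (2 / 2 ^ Suc j) ^ CARD('n) = max 1 (2 powr - ?b) * (2 powr (-(2-2 * s))) ^ j"
      by simp
    show "2 powr (-(2-2 * s)) < 1" using s powr_less_mono[of "-(2-2 * s)" 0 2] by simp
  qed auto
  have "(\<integral>\<^sup>+ z. ennreal (min 1 ((norm z)\<^sup>2) * frac_kernel s (z :: real^'n)) \<partial>lborel) \<le> (\<integral>\<^sup>+ z. ?A z + ?B z \<partial>lborel)"
    by (intro nn_integral_mono le)
  also have "\<dots> = (\<integral>\<^sup>+ z. ?A z \<partial>lborel) + (\<integral>\<^sup>+ z. ?B z \<partial>lborel)"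
    by (rule nn_integral_add) measurable
  also have "\<dots> < \<infinity>" using A B by simp
  finally show "(\<integral>\<^sup>+ z. ennreal (min 1 ((norm z)\<^sup>2) * frac_kernel s (z :: real^'n)) \<partial>lborel) < \<infinity>" .
qed auto

lemma one_minus_cos_le: "1 - cos t \<le> 2 * min 1 (t\<^sup>2)" for t :: real
proof -
  have "1 - cos t = 2 * (sin (t/2))\<^sup>2"
    using cos_double_sin[of "t/2"] by simp
  moreover have "(sin (t/2))\<^sup>2 \<le> (t/2)\<^sup>2"
    using abs_sin_x_le_abs_x[of "t/2"] by (simp add: abs_le_square_iff[symmetric])
  moreover have "(sin (t/2))\<^sup>2 \<le> 1"
    by (simp add: abs_square_le_1)
  moreover have "(t/2)\<^sup>2 \<le> t\<^sup>2"
    by (simp add: power_divide)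
  ultimately show ?thesis by (auto simp: min_def)
qed

text \<open>The weak equation has content only if this constant does not vanish. A divergent integral would
  have the value \<open>0\<close>, so convergence has to be shown as well as positivity.\<close>

lemma frac_const_pos:
  fixes k :: "'n::finite"
  assumes s: "0 < s" "s < 1"
  shows "0 < frac_const k s"
proof -
  let ?g = "\<lambda>\<xi> :: real^'n. (1 - cos (\<xi> $ k)) * frac_kernel s \<xi>"
  have meas [measurable]: "?g \<in> borel_measurable borel" by measurable
  have int: "integrable lborel ?g"
  proof (rule Bochner_Integration.integrable_bound)
    show "integrable lborel (\<lambda>z :: real^'n. 2 * (min 1 ((norm z)\<^sup>2) * frac_kernel s z))"
      using frac_kernel_truncated_integrable[OF s] by simp
    have "1 - cos (z $ k) \<le> 2 * min 1 ((norm z)\<^sup>2)" for z :: "real^'n"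
    proof -
      have "(z $ k)\<^sup>2 \<le> (norm z)\<^sup>2"
        using component_le_norm_cart[of z k] by (simp add: abs_le_square_iff[symmetric])
      then show ?thesis using one_minus_cos_le[of "z $ k"] by auto
    qed
    then show "AE x in lborel. norm (?g x) \<le> norm (2 * (min 1 ((norm x)\<^sup>2) * frac_kernel s x))"
      by (auto intro!: AE_I2 mult_right_mono simp: abs_mult abs_of_nonneg mult.assoc[symmetric])
  qed auto
  have nn: "0 \<le> ?g \<xi>" for \<xi> by simp
  have "integral\<^sup>L lborel ?g \<noteq> 0"
  proof
    assume "integral\<^sup>L lborel ?g = 0"
    then have "AE x in lborel. ?g x = 0"
      using integral_nonneg_eq_0_iff_AE[OF int] nn by simp
    then have "AE x in lborel. x \<notin> box (0::real^'n) 1"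
    proof (rule AE_mp, intro AE_I2 impI notI)
      fix x :: "real^'n" assume 0: "?g x = 0" and x: "x \<in> box 0 1"
      have xk: "0 < x $ k" "x $ k < 1" using x by (auto simp: mem_box_cart)
      then have "x \<noteq> 0" by auto
      then have "frac_kernel s x \<noteq> 0" by (simp add: frac_kernel_def)
      moreover have "cos (x $ k) < cos 0"
        using xk pi_gt3 by (intro cos_monotone_0_pi) auto
      ultimately show False using 0 by simp
    qed
    then have "emeasure lborel (box (0::real^'n) 1) = 0"
      by (subst (asm) AE_iff_measurable[where N = "box 0 1"]) auto
    moreover have "open (box (0::real^'n) 1)" "box (0::real^'n) 1 \<noteq> {}"
      by (auto simp: box_ne_empty Basis_vec_def inner_axis)
    ultimately show False
      using open_not_negligible[of "box (0::real^'n) 1"]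
      by (simp add: negligible_iff_emeasure0)
  qed
  moreover have "0 \<le> integral\<^sup>L lborel ?g" using nn by (intro Bochner_Integration.integral_nonneg) auto
  ultimately have "0 < integral\<^sup>L lborel ?g" by linarith
  moreover have "integral\<^sup>L lebesgue ?g = integral\<^sup>L lborel ?g"
    by (rule integral_completion) simp
  ultimately show ?thesis
    by (simp add: frac_const_def frac_kernel_def)
qed

section \<open>Reflections and Lebesgue measure\<close>

lemma reflect_inner:
  assumes "norm e = 1"
  shows "reflect e \<mu> x \<bullet> e = 2 * \<mu> - x \<bullet> e"
proof -
  have "e \<bullet> e = 1" using assms by (simp add: dot_square_norm)
  then show ?thesis by (simp add: reflect_def inner_add_left)
qed

lemma reflect_reflect [simp]:
  assumes "norm e = 1"
  shows "reflect e \<mu> (reflect e \<mu> x) = x"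
proof -
  have "2 * (\<mu> - reflect e \<mu> x \<bullet> e) = - (2 * (\<mu> - x \<bullet> e))"
    by (simp add: reflect_inner[OF assms])
  then have "reflect e \<mu> (reflect e \<mu> x) = reflect e \<mu> x - (2 * (\<mu> - x \<bullet> e)) *\<^sub>R e"
    unfolding reflect_def[of e \<mu> "reflect e \<mu> x"] by (simp only: scaleR_minus_left) simp
  then show ?thesis by (simp add: reflect_def)
qed

lemma reflect_on_hyperplane [simp]: "x \<bullet> e = \<mu> \<Longrightarrow> reflect e \<mu> x = x"
  by (simp add: reflect_def)

text \<open>The source of every sign in the comparison of kernels: for two points on the same side of the
  mirror the last summand is nonnegative, so reflecting one of them increases the distance.\<close>

lemma norm_minus_reflect_sq:
  assumes "norm e = 1"
  shows "(norm (x - reflect e \<mu> y))\<^sup>2 = (norm (x - y))\<^sup>2 + 4 * (\<mu> - x \<bullet> e) * (\<mu> - y \<bullet> e)"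
proof -
  define t where "t = 2 * (\<mu> - y \<bullet> e)"
  have e: "e \<bullet> e = 1" using assms by (simp add: dot_square_norm)
  have "(norm ((x - y) - t *\<^sub>R e))\<^sup>2 = (norm (x - y))\<^sup>2 - 2 * t * ((x - y) \<bullet> e) + t * t"
    by (simp only: power2_norm_eq_inner)
       (simp add: inner_diff_left inner_diff_right e inner_commute algebra_simps)
  moreover have "(x - y) - t *\<^sub>R e = x - reflect e \<mu> y"
    by (simp add: t_def reflect_def)
  moreover have "t * t - 2 * t * ((x - y) \<bullet> e) = 4 * (\<mu> - x \<bullet> e) * (\<mu> - y \<bullet> e)"
    by (simp add: t_def inner_diff_left algebra_simps)
  ultimately show ?thesis by simp
qed

lemma norm_reflect_diff:
  assumes "norm e = 1"
  shows "norm (reflect e \<mu> x - reflect e \<mu> y) = norm (x - y)"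
proof -
  have "(norm (reflect e \<mu> x - reflect e \<mu> y))\<^sup>2 = (norm (x - y))\<^sup>2"
    using norm_minus_reflect_sq[OF assms, of "reflect e \<mu> x" \<mu> y]
          norm_minus_reflect_sq[OF assms, of y \<mu> x]
    by (simp add: reflect_inner[OF assms] norm_minus_commute algebra_simps)
  then show ?thesis by simp
qed

lemma norm_minus_reflect_commute:
  assumes "norm e = 1"
  shows "norm (reflect e \<mu> x - y) = norm (x - reflect e \<mu> y)"
  using norm_reflect_diff[OF assms, of \<mu> x "reflect e \<mu> y"] assms by simp

lemma continuous_on_reflect [continuous_intros]:
  "continuous_on S g \<Longrightarrow> continuous_on S h \<Longrightarrow> continuous_on S (\<lambda>x. reflect e (h x) (g x))"
  unfolding reflect_def by (intro continuous_intros)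

lemma measurable_reflect [measurable]: "reflect e \<mu> \<in> borel_measurable borel"
  by (intro borel_measurable_continuous_onI continuous_intros)

lemma nn_integral_lborel_translate:
  fixes f :: "'a::euclidean_space \<Rightarrow> ennreal"
  assumes "f \<in> borel_measurable borel"
  shows "(\<integral>\<^sup>+ x. f (a + x) \<partial>lborel) = (\<integral>\<^sup>+ x. f x \<partial>lborel)"
proof -
  have "(\<integral>\<^sup>+ x. f x \<partial>lborel) = (\<integral>\<^sup>+ x. f x \<partial>distr lborel borel ((+) a))"
    by (simp only: lborel_distr_plus)
  then show ?thesis
    using assms by (subst (asm) nn_integral_distr) auto
qed

text \<open>Only the invariance under translations and the volume of balls are used. Write the left-hand side
  as an average over translations \<open>y\<close> in the unit ball; since \<open>reflect e \<mu>\<close> turns a shift of its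
  argument by \<open>reflect e 0 y\<close> into a shift of its value by \<open>y\<close>, exchanging the integrals leaves
  \<open>f y\<close> times the volume of the unit ball around \<open>reflect e \<mu> y\<close>.\<close>

lemma nn_integral_reflect:
  fixes e :: "'a::euclidean_space"
  assumes e: "norm e = 1" and f [measurable]: "f \<in> borel_measurable borel"
  shows "(\<integral>\<^sup>+ x. f (reflect e \<mu> x) \<partial>lborel) = (\<integral>\<^sup>+ x. f x \<partial>lborel)"
proof -
  let ?R = "reflect e \<mu>"
  define B where "B = ball (0 :: 'a) 1"
  have [measurable]: "B \<in> sets borel" by (simp add: B_def)
  define V where "V = ennreal (unit_ball_vol (real DIM('a)))"
  have ball: "emeasure lborel (ball (c :: 'a) 1) = V" for c
    by (simp add: V_def emeasure_ball)
  have V: "V \<noteq> 0" "V \<noteq> top"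
    using unit_ball_vol_pos[of "real DIM('a)"] by (auto simp: V_def simp del: unit_ball_vol_pos)
  have shift: "?R (reflect e 0 y + x) = ?R x + y" for x y
  proof -
    have "?R (reflect e 0 y + x) = ?R x + reflect e 0 (reflect e 0 y)"
      by (simp add: reflect_def[of e \<mu>] reflect_def[of e 0 "reflect e 0 y"] inner_add_left algebra_simps)
    then show ?thesis using e by simp
  qed
  have "norm (?R x - y) = norm (?R y - x)" for x y
    by (metis norm_minus_commute norm_minus_reflect_commute[OF e])
  then have ind: "indicator B (y - ?R x) = (indicator (ball (?R y) 1) x :: ennreal)" for x y
    by (simp add: B_def indicator_def dist_norm norm_minus_commute[of y])
  have "V * (\<integral>\<^sup>+ x. f (?R x) \<partial>lborel) = (\<integral>\<^sup>+ y. indicator B y * (\<integral>\<^sup>+ x. f (?R x) \<partial>lborel) \<partial>lborel)"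
    using ball[of 0, folded B_def] by (subst nn_integral_multc) auto
  also have "\<dots> = (\<integral>\<^sup>+ y. indicator B y * (\<integral>\<^sup>+ x. f (?R x + y) \<partial>lborel) \<partial>lborel)"
    using nn_integral_lborel_translate[of "\<lambda>x. f (?R x)" "reflect e 0 y" for y]
    by (simp add: shift)
  also have "\<dots> = (\<integral>\<^sup>+ y. \<integral>\<^sup>+ x. indicator B y * f (?R x + y) \<partial>lborel \<partial>lborel)"
    by (simp add: nn_integral_cmult)
  also have "\<dots> = (\<integral>\<^sup>+ x. \<integral>\<^sup>+ y. indicator B y * f (?R x + y) \<partial>lborel \<partial>lborel)"
    by (rule lborel_pair.Fubini') measurable
  also have "\<dots> = (\<integral>\<^sup>+ x. \<integral>\<^sup>+ y. indicator B (y - ?R x) * f y \<partial>lborel \<partial>lborel)"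
    using nn_integral_lborel_translate[of "\<lambda>y. indicator B (y - ?R x) * f y" "?R x" for x]
    by simp
  also have "\<dots> = (\<integral>\<^sup>+ y. \<integral>\<^sup>+ x. indicator B (y - ?R x) * f y \<partial>lborel \<partial>lborel)"
    by (rule lborel_pair.Fubini') measurable
  also have "\<dots> = (\<integral>\<^sup>+ y. \<integral>\<^sup>+ x. f y * indicator (ball (?R y) 1) x \<partial>lborel \<partial>lborel)"
    by (simp add: ind mult.commute)
  also have "\<dots> = V * (\<integral>\<^sup>+ y. f y \<partial>lborel)"
    by (simp add: nn_integral_cmult_indicator ball nn_integral_multc) (simp add: nn_integral_cmult mult.commute)
  finally show ?thesis
    using V by (simp add: ennreal_mult_cancel_left)
qed

lemma lborel_distr_reflect:
  fixes e :: "'a::euclidean_space"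
  assumes e: "norm e = 1"
  shows "distr lborel borel (reflect e \<mu>) = lborel"
proof (rule measure_eqI)
  fix A assume "A \<in> sets (distr lborel borel (reflect e \<mu>))"
  then have [measurable]: "A \<in> sets borel" by simp
  have "emeasure (distr lborel borel (reflect e \<mu>)) A = (\<integral>\<^sup>+ x. indicator A x \<partial>distr lborel borel (reflect e \<mu>))"
    by simp
  also have "\<dots> = (\<integral>\<^sup>+ x. indicator A (reflect e \<mu> x) \<partial>lborel)"
    by (rule nn_integral_distr) measurable
  also have "\<dots> = emeasure lborel A"
    using nn_integral_reflect[OF e, of "indicator A" \<mu>] by simp
  finally show "emeasure (distr lborel borel (reflect e \<mu>)) A = emeasure lborel A" .
qed simp

lemma lborel_distr_map_prod:
  fixes S :: "'a::euclidean_space \<Rightarrow> 'a" and T :: "'b::euclidean_space \<Rightarrow> 'b"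
  assumes [measurable]: "S \<in> borel_measurable borel" "T \<in> borel_measurable borel"
    and "distr lborel borel S = lborel" "distr lborel borel T = lborel"
  shows "distr lborel borel (\<lambda>(x, y). (S x, T y)) = lborel"
proof -
  have "distr lborel borel S \<Otimes>\<^sub>M distr lborel borel T
      = distr (lborel \<Otimes>\<^sub>M lborel) (borel \<Otimes>\<^sub>M borel) (\<lambda>(x, y). (S x, T y))"
    using assms by (intro pair_measure_distr) (auto simp: lborel.sigma_finite_measure_axioms)
  then show ?thesis
    using assms by (simp add: lborel_prod borel_prod)
qed

lemma lborel_distr_shear:
  "distr lborel borel (\<lambda>(x :: 'a::euclidean_space, z). (x, x + z)) = lborel"
proof (rule measure_eqI)
  fix A :: "('a \<times> 'a) set" assume "A \<in> sets (distr lborel borel (\<lambda>(x, z). (x, x + z)))"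
  then have [measurable]: "A \<in> sets borel" by simp
  have m1: "(\<lambda>(x, z). (x, x + z)) \<in> borel_measurable (borel :: ('a \<times> 'a) measure)"
    by (intro borel_measurable_continuous_onI) (auto intro!: continuous_intros simp: case_prod_beta)
  have m2: "(\<lambda>z. indicator A (case z of (x, z) \<Rightarrow> (x, x + z)) :: ennreal) \<in> borel_measurable (lborel \<Otimes>\<^sub>M lborel)"
    using measurable_compose[OF m1 borel_measurable_indicator[OF \<open>A \<in> sets borel\<close>]] by (simp add: lborel_prod)
  have m3: "(indicator A :: _ \<Rightarrow> ennreal) \<in> borel_measurable (lborel \<Otimes>\<^sub>M lborel)"
    by (simp add: lborel_prod)
  have "emeasure (distr lborel borel (\<lambda>(x, z). (x, x + z))) A = (\<integral>\<^sup>+ p. indicator A p \<partial>distr lborel borel (\<lambda>(x, z). (x, x + z)))"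
    by simp
  also have "\<dots> = (\<integral>\<^sup>+ p. indicator A (case p of (x, z) \<Rightarrow> (x, x + z)) \<partial>(lborel \<Otimes>\<^sub>M lborel))"
    using m1 by (subst nn_integral_distr) (auto simp: lborel_prod)
  also have "\<dots> = (\<integral>\<^sup>+ x. \<integral>\<^sup>+ z. indicator A (x, x + z) \<partial>lborel \<partial>lborel)"
    using lborel.nn_integral_fst[OF m2] by simp
  also have "\<dots> = (\<integral>\<^sup>+ x. \<integral>\<^sup>+ z. indicator A (x, z) \<partial>lborel \<partial>lborel)"
  proof (rule nn_integral_cong)
    fix x :: 'a
    show "(\<integral>\<^sup>+ z. indicator A (x, x + z) \<partial>lborel) = (\<integral>\<^sup>+ z. indicator A (x, z) \<partial>lborel :: ennreal)"
      using m3 by (intro nn_integral_lborel_translate[of "\<lambda>z. indicator A (x, z)"]) (simp add: lborel_prod)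
  qed
  also have "\<dots> = emeasure lborel A"
    using lborel.nn_integral_fst[OF m3] by (simp add: lborel_prod)
  finally show "emeasure (distr lborel borel (\<lambda>(x :: 'a, z). (x, x + z))) A = emeasure lborel A" .
qed simp

lemma integral_lborel_invariant:
  fixes g :: "'a::euclidean_space \<Rightarrow> real"
  assumes T: "T \<in> borel_measurable borel" "distr lborel borel T = lborel" and g: "g \<in> borel_measurable borel"
  shows "(\<integral>x. g (T x) \<partial>lborel) = integral\<^sup>L lborel g"
    and "integrable lborel (\<lambda>x. g (T x)) \<longleftrightarrow> integrable lborel g"
  using integral_distr[of T lborel borel g] integrable_distr_eq[of T lborel borel g] T g by auto

lemma lebesgue_reflect:
  fixes e :: "'a::euclidean_space" and g :: "'a \<Rightarrow> real"
  assumes e: "norm e = 1" and g: "integrable lebesgue g"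
  shows "integrable lebesgue (\<lambda>x. g (reflect e \<mu> x))"
    and "(\<integral>x. g (reflect e \<mu> x) \<partial>lebesgue) = integral\<^sup>L lebesgue g"
proof -
  have R: "reflect e \<mu> \<in> lebesgue \<rightarrow>\<^sub>M lborel"
    by (simp add: measurable_completion)
  have "distr lebesgue lborel (reflect e \<mu>) = distr lborel borel (reflect e \<mu>)"
    by (simp add: distr_completion cong: distr_cong)
  then have d: "distr lebesgue lborel (reflect e \<mu>) = lborel"
    using lborel_distr_reflect[OF e] by simp
  have RL: "reflect e \<mu> \<in> lebesgue \<rightarrow>\<^sub>M lebesgue"
    by (rule completion.measurable_completion2[OF R]) (simp add: d)
  have D: "distr lebesgue lebesgue (reflect e \<mu>) = lebesgue"
    using completion.completion_distr_eq[OF R] by (simp add: d)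
  show "integrable lebesgue (\<lambda>x. g (reflect e \<mu> x))"
    using integrable_distr[OF RL, of g] g by (simp add: D)
  show "(\<integral>x. g (reflect e \<mu> x) \<partial>lebesgue) = integral\<^sup>L lebesgue g"
    using integral_distr[OF RL, of g] g by (simp add: D)
qed

text \<open>The sum over the four images of a pair under reflecting either entry. It is invariant under these
  reflections, and its integral is four times that of \<open>F\<close>; so integrals of two functions can be
  compared by comparing these sums on pairs from one half-space.\<close>

definition reflect_sum :: "('a \<Rightarrow> 'a) \<Rightarrow> ('a \<times> 'a \<Rightarrow> real) \<Rightarrow> 'a \<Rightarrow> 'a \<Rightarrow> real" where
  "reflect_sum R F x y = F (x, y) + F (R x, y) + F (x, R y) + F (R x, R y)"

lemma reflect_sum_le_everywhere:
  fixes e :: "'a::euclidean_space"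
  assumes e: "norm e = 1"
    and le: "\<And>x y. x \<bullet> e \<le> \<mu> \<Longrightarrow> y \<bullet> e \<le> \<mu> \<Longrightarrow>
      reflect_sum (reflect e \<mu>) F x y \<le> reflect_sum (reflect e \<mu>) G x y"
  shows "reflect_sum (reflect e \<mu>) F x y \<le> reflect_sum (reflect e \<mu>) G x y"
proof -
  \<comment> \<open>replace each point by its mirror image if it lies beyond the hyperplane\<close>
  define x' where "x' = (if x \<bullet> e \<le> \<mu> then x else reflect e \<mu> x)"
  define y' where "y' = (if y \<bullet> e \<le> \<mu> then y else reflect e \<mu> y)"
  have "x' \<bullet> e \<le> \<mu>" "y' \<bullet> e \<le> \<mu>" by (auto simp: x'_def y'_def reflect_inner[OF e])
  then have "reflect_sum (reflect e \<mu>) F x' y' \<le> reflect_sum (reflect e \<mu>) G x' y'" by (rule le)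
  then show ?thesis
    using e by (auto simp: x'_def y'_def reflect_sum_def split: if_splits)
qed

lemma reflect_sum_integral:
  fixes e :: "'a::euclidean_space" and F :: "'a \<times> 'a \<Rightarrow> real"
  assumes e: "norm e = 1" and F: "integrable lborel F"
  shows "integrable lborel (\<lambda>(x, y). reflect_sum (reflect e \<mu>) F x y)"
    and "(\<integral>(x, y). reflect_sum (reflect e \<mu>) F x y \<partial>lborel) = 4 * integral\<^sup>L lborel F"
proof -
  let ?R = "reflect e \<mu>"
  have Fm [measurable]: "F \<in> borel_measurable borel" using F by auto
  have id: "distr lborel borel (\<lambda>x. x) = (lborel :: ('a) measure)"
    by (rule distr_id2) simp
  have inv: "distr lborel borel (\<lambda>(x, y). (?R x, y)) = (lborel :: ('a \<times> 'a) measure)"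
     "distr lborel borel (\<lambda>(x, y). (x, ?R y)) = (lborel :: ('a \<times> 'a) measure)"
     "distr lborel borel (\<lambda>(x, y). (?R x, ?R y)) = (lborel :: ('a \<times> 'a) measure)"
    using lborel_distr_map_prod[of ?R "\<lambda>x. x"] lborel_distr_map_prod[of "\<lambda>x. x" ?R]
      lborel_distr_map_prod[of ?R ?R] id lborel_distr_reflect[OF e] by auto
  have m: "(\<lambda>(x, y). (?R x, y)) \<in> borel_measurable borel" 
     "(\<lambda>(x, y). (x, ?R y)) \<in> borel_measurable borel"
     "(\<lambda>(x, y). (?R x, ?R y)) \<in> borel_measurable borel"
    unfolding case_prod_beta by (intro borel_measurable_continuous_onI continuous_intros)+
  note I = integral_lborel_invariant[OF m(1) inv(1) Fm] integral_lborel_invariant[OF m(2) inv(2) Fm]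
     integral_lborel_invariant[OF m(3) inv(3) Fm]
  have eq: "(\<lambda>(x, y). reflect_sum ?R F x y)
      = (\<lambda>p. F p + F (case p of (x, y) \<Rightarrow> (?R x, y)) + F (case p of (x, y) \<Rightarrow> (x, ?R y))
           + F (case p of (x, y) \<Rightarrow> (?R x, ?R y)))"
    by (auto simp: reflect_sum_def fun_eq_iff)
  show "integrable lborel (\<lambda>(x, y). reflect_sum ?R F x y)"
    unfolding eq using F I by (intro Bochner_Integration.integrable_add) auto
  show "(\<integral>(x, y). reflect_sum ?R F x y \<partial>lborel) = 4 * integral\<^sup>L lborel F"
    unfolding eq using F I by simp
qed

lemma integral_mono_reflect_sum:
  fixes e :: "'a::euclidean_space" and F G :: "'a \<times> 'a \<Rightarrow> real"
  assumes e: "norm e = 1" and F: "integrable lborel F" and G: "integrable lborel G"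
    and le: "\<And>x y. x \<bullet> e \<le> \<mu> \<Longrightarrow> y \<bullet> e \<le> \<mu> \<Longrightarrow>
      reflect_sum (reflect e \<mu>) F x y \<le> reflect_sum (reflect e \<mu>) G x y"
  shows "integral\<^sup>L lborel F \<le> integral\<^sup>L lborel G"
proof -
  have "(\<integral>(x, y). reflect_sum (reflect e \<mu>) F x y \<partial>lborel) \<le> (\<integral>(x, y). reflect_sum (reflect e \<mu>) G x y \<partial>lborel)"
    using reflect_sum_integral(1)[OF e F] reflect_sum_integral(1)[OF e G] reflect_sum_le_everywhere[of e \<mu> F G, OF e le]
    by (intro integral_mono) auto
  then show ?thesis
    using reflect_sum_integral(2)[OF e F] reflect_sum_integral(2)[OF e G] by simp
qed

lemma integrable_bound_reflect_sum:
  fixes e :: "'a::euclidean_space" and F G :: "'a \<times> 'a \<Rightarrow> real"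
  assumes e: "norm e = 1" and F: "F \<in> borel_measurable borel" "\<And>p. 0 \<le> F p" and G: "integrable lborel G"
    and le: "\<And>x y. x \<bullet> e \<le> \<mu> \<Longrightarrow> y \<bullet> e \<le> \<mu> \<Longrightarrow>
      reflect_sum (reflect e \<mu>) F x y \<le> reflect_sum (reflect e \<mu>) G x y"
  shows "integrable lborel F"
proof (rule Bochner_Integration.integrable_bound[OF reflect_sum_integral(1)[OF e G, of \<mu>]])
  have "norm (F (x, y)) \<le> norm (reflect_sum (reflect e \<mu>) G x y)" for x y
  proof -
    have "F (x, y) \<le> reflect_sum (reflect e \<mu>) F x y"
      using F(2) by (simp add: reflect_sum_def)
    also have "\<dots> \<le> reflect_sum (reflect e \<mu>) G x y"
      by (rule reflect_sum_le_everywhere[OF e le])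
    finally show ?thesis using F(2)[of "(x, y)"] by simp
  qed
  then show "AE p in lborel. norm (F p) \<le> norm (case p of (x, y) \<Rightarrow> reflect_sum (reflect e \<mu>) G x y)"
    by auto
qed (use F in auto)

section \<open>The energy form\<close>

text \<open>The factor \<open>c / 2\<close> of the bilinear form is left out here; being positive, it only rescales the
  Lipschitz constant later on.\<close>

definition interaction :: "real \<Rightarrow> (real^'n::finite \<Rightarrow> real) \<Rightarrow> (real^'n \<Rightarrow> real) \<Rightarrow> (real^'n) \<times> (real^'n) \<Rightarrow> real" where
  "interaction s f g = (\<lambda>(x, y). (f x - f y) * (g x - g y) * frac_kernel s (x - y))"

definition energy :: "real \<Rightarrow> (real^'n::finite \<Rightarrow> real) \<Rightarrow> (real^'n \<Rightarrow> real) \<Rightarrow> real" where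
  "energy s f g = integral\<^sup>L lborel (interaction s f g)"

definition finite_energy :: "real \<Rightarrow> (real^'n::finite \<Rightarrow> real) \<Rightarrow> bool" where
  "finite_energy s f \<longleftrightarrow> f \<in> borel_measurable borel \<and> integrable lborel (interaction s f f)"

lemma finite_energy_measurable: "finite_energy s f \<Longrightarrow> f \<in> borel_measurable borel"
  by (simp add: finite_energy_def)

lemma interaction_measurable:
  assumes [measurable]: "f \<in> borel_measurable borel" "g \<in> borel_measurable borel"
  shows "interaction s f g \<in> borel_measurable borel"
  unfolding interaction_def borel_prod[symmetric] by measurable

lemma interaction_self_nonneg: "0 \<le> interaction s f f p"
  by (simp add: interaction_def case_prod_beta)

lemma Hs_iff_finite_energy:
  fixes f :: "real^'n::finite \<Rightarrow> real"
  assumes [measurable]: "f \<in> borel_measurable borel"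
  shows "f \<in> Hs s \<longleftrightarrow> integrable lborel (\<lambda>x. (f x)\<^sup>2) \<and> finite_energy s f"
proof -
  have "(\<lambda>(x, y). (f x - f y)\<^sup>2 / norm (x - y) powr (real CARD('n) + 2 * s)) = interaction s f f"
    by (auto simp: interaction_def fun_eq_iff frac_kernel_def power2_eq_square)
  then show ?thesis
    using interaction_measurable[of f f s]
    by (simp add: Hs_def finite_energy_def integrable_completion measurable_completion)
qed

lemma integrable_interaction:
  assumes f: "finite_energy s f" and g: "finite_energy s g"
  shows "integrable lborel (interaction s f g)"
proof (rule Bochner_Integration.integrable_bound)
  show "integrable lborel (\<lambda>p. interaction s f f p + interaction s g g p)"
    using f g by (auto simp: finite_energy_def)
  show "interaction s f g \<in> borel_measurable lborel"
    using interaction_measurable[of f g s] f g by (simp add: finite_energy_def)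
  have "\<bar>a * b\<bar> \<le> a * a + b * b" for a b :: real
  proof -
    have "2 * \<bar>a * b\<bar> \<le> a * a + b * b"
      using sum_squares_bound[of "\<bar>a\<bar>" "\<bar>b\<bar>"] by (simp add: power2_eq_square abs_mult mult.assoc)
    then show ?thesis using abs_ge_zero[of "a * b"] by linarith
  qed
  then have "\<bar>a * b * k\<bar> \<le> a * a * k + b * b * k" if "0 \<le> k" for a b k :: real
    using mult_right_mono[OF _ that] that by (simp add: abs_mult distrib_right[symmetric])
  then show "AE p in lborel. norm (interaction s f g p) \<le> norm (interaction s f f p + interaction s g g p)"
    by (auto simp: interaction_def)
qed

lemma finite_energy_cmult: "finite_energy s f \<Longrightarrow> finite_energy s (\<lambda>x. c * f x)"
proof -
  assume f: "finite_energy s f"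
  have "interaction s (\<lambda>x. c * f x) (\<lambda>x. c * f x) = (\<lambda>p. (c * c) * interaction s f f p)"
    by (auto simp: interaction_def fun_eq_iff algebra_simps)
  then show ?thesis using f by (auto simp: finite_energy_def)
qed

lemma energy_cmult_left: "energy s (\<lambda>x. c * f x) g = c * energy s f g"
proof -
  have "interaction s (\<lambda>x. c * f x) g = (\<lambda>p. c * interaction s f g p)"
    by (auto simp: interaction_def fun_eq_iff algebra_simps)
  then show ?thesis by (simp add: energy_def)
qed

lemma finite_energy_diff:
  assumes f: "finite_energy s f" and g: "finite_energy s g"
  shows "finite_energy s (\<lambda>x. f x - g x)"
proof -
  have "interaction s (\<lambda>x. f x - g x) (\<lambda>x. f x - g x)
      = (\<lambda>p. interaction s f f p - 2 * interaction s f g p + interaction s g g p)"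
    by (auto simp: interaction_def fun_eq_iff algebra_simps)
  then show ?thesis
    using f g integrable_interaction[OF f g] by (auto simp: finite_energy_def)
qed

lemma energy_diff_left:
  assumes f: "finite_energy s f" and g: "finite_energy s g" and h: "finite_energy s h"
  shows "energy s (\<lambda>x. f x - g x) h = energy s f h - energy s g h"
proof -
  have "interaction s (\<lambda>x. f x - g x) h = (\<lambda>p. interaction s f h p - interaction s g h p)"
    by (auto simp: interaction_def fun_eq_iff algebra_simps)
  then show ?thesis
    using integrable_interaction[OF f h] integrable_interaction[OF g h] by (simp add: energy_def)
qed

lemma
  assumes e: "norm e = 1" and f: "f \<in> borel_measurable borel" and g: "g \<in> borel_measurable borel"
  shows energy_reflect: "energy s (\<lambda>x. f (reflect e \<mu> x)) (\<lambda>x. g (reflect e \<mu> x)) = energy s f g"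
    and finite_energy_reflect: "finite_energy s f \<Longrightarrow> finite_energy s (\<lambda>x. f (reflect e \<mu> x))"
proof -
  let ?R = "reflect e \<mu>"
  let ?T = "\<lambda>(x, y). (?R x, ?R y)"
  have T: "?T \<in> borel_measurable borel"
    unfolding case_prod_beta by (intro borel_measurable_continuous_onI continuous_intros)
  have inv: "distr lborel borel ?T = lborel"
    by (rule lborel_distr_map_prod) (auto simp: lborel_distr_reflect[OF e])
  have eq: "interaction s (\<lambda>x. f (?R x)) (\<lambda>x. g (?R x)) = (\<lambda>p. interaction s f g (?T p))" for f g
    by (auto simp: interaction_def fun_eq_iff frac_kernel_def norm_reflect_diff[OF e])
  show "energy s (\<lambda>x. f (?R x)) (\<lambda>x. g (?R x)) = energy s f g"
    unfolding energy_def eq by (rule integral_lborel_invariant(1)[OF T inv interaction_measurable[OF f g]])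
  show "finite_energy s (\<lambda>x. f (?R x))" if "finite_energy s f"
    using that integral_lborel_invariant(2)[OF T inv interaction_measurable[OF f f]]
    unfolding finite_energy_def eq by (auto intro: measurable_compose[OF measurable_reflect])
qed

lemma
  fixes a :: "'a::euclidean_space \<Rightarrow> real" and b :: "'b::euclidean_space \<Rightarrow> real"
  assumes a: "integrable lborel a" and b: "integrable lborel b"
  shows integrable_lborel_product: "integrable lborel (\<lambda>(x, y). a x * b y)"
    and integral_lborel_product: "(\<integral>(x, y). a x * b y \<partial>lborel) = integral\<^sup>L lborel a * integral\<^sup>L lborel b"
proof -
  have [measurable]: "a \<in> borel_measurable borel" "b \<in> borel_measurable borel" using a b by auto
  have int: "integrable (lborel \<Otimes>\<^sub>M lborel) (\<lambda>(x, y). a x * b y)"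
  proof (rule lborel_pair.Fubini_integrable)
    show "(\<lambda>(x, y). a x * b y) \<in> borel_measurable (lborel \<Otimes>\<^sub>M lborel)" by measurable
    show "integrable lborel (\<lambda>x. \<integral>y. norm (case (x, y) of (x, y) \<Rightarrow> a x * b y) \<partial>lborel)"
      using a by (simp add: abs_mult)
    show "AE x in lborel. integrable lborel (\<lambda>y. case (x, y) of (x, y) \<Rightarrow> a x * b y)"
      using b by simp
  qed
  then show "integrable lborel (\<lambda>(x, y). a x * b y)" by (simp add: lborel_prod)
  show "(\<integral>(x, y). a x * b y \<partial>lborel) = integral\<^sup>L lborel a * integral\<^sup>L lborel b"
    using lborel_pair.integral_fst[OF int] by (simp add: lborel_prod)
qed

lemma integrable_lborel_compact_support:
  fixes \<phi> :: "'a::euclidean_space \<Rightarrow> real"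
  assumes [measurable]: "\<phi> \<in> borel_measurable borel" and M: "\<And>x. \<bar>\<phi> x\<bar> \<le> M"
    and D: "bounded D" "\<And>x. x \<notin> D \<Longrightarrow> \<phi> x = 0"
  shows "integrable lborel \<phi>"
proof -
  obtain r where r: "D \<subseteq> ball 0 r" using D(1) bounded_subset_ballD by blast
  have "integrable lborel (\<lambda>x :: 'a. M * indicator (ball 0 r) x :: real)"
    by (intro integrable_mult_right integrable_real_indicator) (use emeasure_bounded_finite[of "ball (0::'a) r"] in auto)
  then show ?thesis
  proof (rule Bochner_Integration.integrable_bound)
    show "AE x in lborel. norm (\<phi> x) \<le> norm (M * indicator (ball 0 r) x)"
    proof (rule AE_I2)
      fix x show "norm (\<phi> x) \<le> norm (M * indicator (ball 0 r) x)"
        using M[of x] D(2)[of x] r by (cases "x \<in> D") (auto simp: indicator_def)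
    qed
  qed simp
qed

lemma shear_measurable: "(\<lambda>(x :: 'a::euclidean_space, z). (x, x + z)) \<in> borel_measurable borel"
  unfolding case_prod_beta by (intro borel_measurable_continuous_onI continuous_intros)

text \<open>In the variables \<open>x\<close> and \<open>z = y - x\<close> the integrand is at most a constant times
  \<open>min 1 ((norm z)\<^sup>2)\<close> times the kernel, and it vanishes unless \<open>x\<close> or \<open>x + z\<close> lies in the ball.\<close>

lemma finite_energy_Lipschitz_compact_support:
  fixes \<eta> :: "real^'n::finite \<Rightarrow> real"
  assumes s: "0 < s" "s < 1" and [measurable]: "\<eta> \<in> borel_measurable borel"
    and lip: "\<And>x y. \<bar>\<eta> x - \<eta> y\<bar> \<le> L * norm (x - y)" and M: "\<And>x. \<bar>\<eta> x\<bar> \<le> M"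
    and supp: "\<And>x. x \<notin> ball c r \<Longrightarrow> \<eta> x = 0"
  shows "finite_energy s \<eta>"
proof -
  define B where "B = ball c r"
  have [measurable]: "B \<in> sets borel" by (simp add: B_def)
  \<comment> \<open>the Lipschitz bound is used for small \<open>z\<close>, the sup bound for large \<open>z\<close>\<close>
  define C where "C = max (L\<^sup>2) (4 * M\<^sup>2)"
  define h where "h = (\<lambda>z :: real^'n. C * (min 1 ((norm z)\<^sup>2) * frac_kernel s z))"
  have h: "integrable lborel h" 
    unfolding h_def by (intro integrable_mult_right frac_kernel_truncated_integrable s)
  have h0: "0 \<le> h z" for z by (auto simp: h_def C_def intro!: mult_nonneg_nonneg max.coboundedI1)
  have [measurable]: "h \<in> borel_measurable borel" using h by auto
  have fin: "emeasure lborel B < \<infinity>" unfolding B_def by (rule emeasure_bounded_finite) simp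
  let ?I = "\<lambda>(x, z). interaction s \<eta> \<eta> (x, x + z)"
  have bound: "ennreal (norm (?I (x, z))) \<le> ennreal (h z) * indicator B x + ennreal (h z) * indicator B (x + z)" for x z
  proof (cases "x \<in> B \<or> x + z \<in> B")
    case False
    then show ?thesis using supp by (simp add: interaction_def B_def)
  next
    case True
    have "(\<eta> x - \<eta> (x + z))\<^sup>2 \<le> (L * norm z)\<^sup>2"
      using power_mono[OF lip[of x "x + z"], of 2] by simp
    then have 1: "(\<eta> x - \<eta> (x + z))\<^sup>2 \<le> C * (norm z)\<^sup>2"
      unfolding C_def by (simp add: power_mult_distrib max_mult_distrib_right)
    have "\<bar>\<eta> x - \<eta> (x + z)\<bar> \<le> 2 * M" using M[of x] M[of "x + z"] by linarith
    then have "(\<eta> x - \<eta> (x + z))\<^sup>2 \<le> (2 * M)\<^sup>2"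
      using power_mono[of "\<bar>\<eta> x - \<eta> (x + z)\<bar>" "2 * M" 2] by simp
    then have 2: "(\<eta> x - \<eta> (x + z))\<^sup>2 \<le> C"
      unfolding C_def by simp
    have "norm (?I (x, z)) = (\<eta> x - \<eta> (x + z))\<^sup>2 * frac_kernel s z"
      by (simp add: interaction_def power2_eq_square abs_mult)
    also have "\<dots> \<le> (C * min 1 ((norm z)\<^sup>2)) * frac_kernel s z"
      using 1 2 by (intro mult_right_mono) (auto simp: min_def)
    finally have "norm (?I (x, z)) \<le> h z" by (simp add: h_def mult.assoc)
    then have "ennreal (norm (?I (x, z))) \<le> ennreal (h z)" by (rule ennreal_leI)
    then show ?thesis using True
      by (auto simp: indicator_def intro: order_trans add_increasing add_increasing2)
  qed
  have "(\<integral>\<^sup>+ p. ennreal (norm (?I p)) \<partial>lborel)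
      \<le> (\<integral>\<^sup>+ p. (case p of (x, z) \<Rightarrow> ennreal (h z) * indicator B x + ennreal (h z) * indicator B (x + z)) \<partial>(lborel \<Otimes>\<^sub>M lborel))"
    unfolding lborel_prod using bound by (intro nn_integral_mono) (auto simp: case_prod_beta)
  also have "\<dots> = (\<integral>\<^sup>+ z. \<integral>\<^sup>+ x. ennreal (h z) * indicator B x + ennreal (h z) * indicator B (x + z) \<partial>lborel \<partial>lborel)"
    by (subst lborel_pair.nn_integral_snd[symmetric]) (auto simp: case_prod_beta)
  also have "\<dots> = (\<integral>\<^sup>+ z. ennreal (h z) * emeasure lborel B + ennreal (h z) * emeasure lborel B \<partial>lborel)"
  proof (rule nn_integral_cong)
    fix z
    have "(\<integral>\<^sup>+ x. indicator B (x + z) \<partial>lborel) = emeasure lborel B"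
      using nn_integral_lborel_translate[of "indicator B" z] by (simp add: add.commute)
    then show "(\<integral>\<^sup>+ x. ennreal (h z) * indicator B x + ennreal (h z) * indicator B (x + z) \<partial>lborel)
      = ennreal (h z) * emeasure lborel B + ennreal (h z) * emeasure lborel B"
      by (simp add: nn_integral_add nn_integral_cmult)
  qed
  also have "\<dots> = (\<integral>\<^sup>+ z. ennreal (h z) \<partial>lborel) * (2 * emeasure lborel B)"
    by (simp add: nn_integral_add nn_integral_multc distrib_left mult_2)
  also have "\<dots> < \<infinity>"
    using fin h h0 by (simp add: nn_integral_eq_integral ennreal_mult_less_top)
  finally have "integrable lborel ?I"
  proof (intro integrableI_bounded)
    have "(\<lambda>p. interaction s \<eta> \<eta> (case p of (x, z) \<Rightarrow> (x, x + z))) \<in> borel_measurable borel"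
      by (rule measurable_compose[OF shear_measurable interaction_measurable]) auto
    then show "?I \<in> borel_measurable lborel" by (simp add: case_prod_beta)
  qed
  then have "integrable lborel (interaction s \<eta> \<eta>)"
    using integral_lborel_invariant(2)[OF shear_measurable lborel_distr_shear interaction_measurable[of \<eta> \<eta> s]]
    by (simp add: case_prod_beta')
  then show ?thesis by (simp add: finite_energy_def)
qed

text \<open>For fixed \<open>z = y - x\<close> the integral of \<open>(\<eta> x - \<eta> (x + z)) * (\<phi> x - \<phi> (x + z))\<close> over \<open>x\<close> splits
  into two convergent integrals; translating the one with \<open>\<phi> (x + z)\<close> by \<open>z\<close> turns it into the
  integral of \<open>(2 * \<eta> x - \<eta> (x + z) - \<eta> (x - z)) * \<phi> x\<close>. A one-sided bound on second differences at
  points where \<open>\<phi> > 0\<close> thus bounds the form. It plays the role of a pointwise estimate for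
  \<open>(- \<Delta>)\<^sup>s \<eta>\<close>.\<close>

lemma energy_le_of_second_difference:
  fixes \<eta> \<phi> :: "real^'n::finite \<Rightarrow> real"
  assumes \<eta>: "finite_energy s \<eta>" and \<phi>: "finite_energy s \<phi>"
    and M: "\<And>x. \<bar>\<eta> x\<bar> \<le> M" and int: "integrable lborel \<phi>" and nn: "\<And>x. 0 \<le> \<phi> x"
    and h: "integrable lborel (\<lambda>z. h z * frac_kernel s z)"
    and diff: "\<And>x z. \<phi> x \<noteq> 0 \<Longrightarrow> 2 * \<eta> x - \<eta> (x + z) - \<eta> (x - z) \<le> h z"
  shows "energy s \<eta> \<phi> \<le> (\<integral>z. h z * frac_kernel s z \<partial>lborel) * integral\<^sup>L lborel \<phi>"
proof -
  have [measurable]: "\<eta> \<in> borel_measurable borel" "\<phi> \<in> borel_measurable borel"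
    using \<eta> \<phi> by (auto simp: finite_energy_def)
  let ?I = "\<lambda>x z. interaction s \<eta> \<phi> (x, x + z)"
  have inv: "integrable lborel (\<lambda>p. interaction s \<eta> \<phi> (case p of (x, z) \<Rightarrow> (x, x + z)))"
    "(\<integral>p. interaction s \<eta> \<phi> (case p of (x, z) \<Rightarrow> (x, x + z)) \<partial>lborel) = energy s \<eta> \<phi>"
    using integral_lborel_invariant[OF shear_measurable lborel_distr_shear interaction_measurable[of \<eta> \<phi> s]]
      integrable_interaction[OF \<eta> \<phi>] by (auto simp: energy_def)
  then have I: "integrable (lborel \<Otimes>\<^sub>M lborel) (\<lambda>(x, z). ?I x z)"
    by (simp add: lborel_prod case_prod_beta')
  have M0: "\<bar>M\<bar> = M" using M[of 0] by linarith
  have prod_int: "integrable lborel (\<lambda>x. \<eta> (x + a) * \<phi> (x + b))" for a b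
  proof -
    have "integrable lborel (\<lambda>x. \<phi> (b + x))"
      using integral_lborel_invariant(2)[of "(+) b" \<phi>] int by (simp add: lborel_distr_plus)
    then have "integrable lborel (\<lambda>x. M * \<phi> (x + b))" by (simp add: add.commute)
    then show ?thesis
      by (rule Bochner_Integration.integrable_bound)
         (use M in \<open>auto simp: abs_mult M0 intro!: AE_I2 mult_right_mono intro: order_trans\<close>)
  qed
  have inner: "(\<integral>x. ?I x z \<partial>lborel) \<le> h z * frac_kernel s z * integral\<^sup>L lborel \<phi>" for z
  proof -
    have p: "integrable lborel (\<lambda>x. (\<eta> x - \<eta> (x + z)) * \<phi> x)"
      "integrable lborel (\<lambda>x. (\<eta> x - \<eta> (x + z)) * \<phi> (x + z))"
      "integrable lborel (\<lambda>x. (2 * \<eta> x - \<eta> (x + z) - \<eta> (x - z)) * \<phi> x)"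
      "integrable lborel (\<lambda>x. (\<eta> (x - z) - \<eta> x) * \<phi> x)"
      using prod_int[of 0 0] prod_int[of z 0] prod_int[of 0 z] prod_int[of z z] prod_int[of "-z" 0]
      by (auto simp: left_diff_distrib mult.assoc intro!: Bochner_Integration.integrable_diff)
    have shift: "(\<integral>x. (\<eta> x - \<eta> (x + z)) * \<phi> (x + z) \<partial>lborel) = (\<integral>x. (\<eta> (x - z) - \<eta> x) * \<phi> x \<partial>lborel)"
      using integral_lborel_invariant(1)[of "(+) z" "\<lambda>x. (\<eta> (x - z) - \<eta> x) * \<phi> x"]
      by (simp add: lborel_distr_plus add.commute)
    have "(\<integral>x. (\<eta> x - \<eta> (x + z)) * (\<phi> x - \<phi> (x + z)) \<partial>lborel)
        = (\<integral>x. (\<eta> x - \<eta> (x + z)) * \<phi> x \<partial>lborel) - (\<integral>x. (\<eta> (x - z) - \<eta> x) * \<phi> x \<partial>lborel)"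
      using p by (simp add: shift[symmetric] right_diff_distrib)
    also have "\<dots> = (\<integral>x. (2 * \<eta> x - \<eta> (x + z) - \<eta> (x - z)) * \<phi> x \<partial>lborel)"
      using p by (subst Bochner_Integration.integral_diff[symmetric])
        (auto intro!: Bochner_Integration.integral_cong simp: algebra_simps)
    also have "\<dots> \<le> (\<integral>x. h z * \<phi> x \<partial>lborel)"
    proof (rule integral_mono)
      show "(2 * \<eta> x - \<eta> (x + z) - \<eta> (x - z)) * \<phi> x \<le> h z * \<phi> x" for x
        using diff[of x z] nn[of x] by (cases "\<phi> x = 0") (auto intro: mult_right_mono)
    qed (use p int in auto)
    finally have "(\<integral>x. (\<eta> x - \<eta> (x + z)) * (\<phi> x - \<phi> (x + z)) \<partial>lborel) * frac_kernel s z
        \<le> h z * integral\<^sup>L lborel \<phi> * frac_kernel s z"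
      by (intro mult_right_mono) auto
    then show ?thesis by (simp add: interaction_def mult_ac)
  qed
  have "energy s \<eta> \<phi> = (\<integral>p. (case p of (x, z) \<Rightarrow> ?I x z) \<partial>(lborel \<Otimes>\<^sub>M lborel))"
    using inv(2) by (simp add: lborel_prod case_prod_beta)
  also have "\<dots> = (\<integral>z. \<integral>x. ?I x z \<partial>lborel \<partial>lborel)"
    using lborel_pair.integral_snd[OF I] by simp
  also have "\<dots> \<le> (\<integral>z. h z * frac_kernel s z * integral\<^sup>L lborel \<phi> \<partial>lborel)"
    using lborel_pair.integrable_snd[OF I] h inner by (intro integral_mono) auto
  finally show ?thesis by simp
qed

text \<open>A Poincare inequality for sets of small measure. The ball of radius \<open>\<rho>\<close> around a point of \<open>A\<close> has
  at least half of its volume outside \<open>A\<close>, where \<open>\<phi>\<close> vanishes, and the kernel is at least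
  \<open>\<rho> powr (- N - 2 s)\<close> there. The constant blows up as \<open>\<rho> \<rightarrow> 0\<close>.\<close>

lemma energy_ge_of_small_support:
  fixes \<phi> :: "real^'n::finite \<Rightarrow> real"
  assumes s: "0 < s" and \<phi>: "finite_energy s \<phi>" and int: "integrable lborel (\<lambda>x. (\<phi> x)\<^sup>2)"
    and A [measurable]: "A \<in> sets borel" and supp: "\<And>x. x \<notin> A \<Longrightarrow> \<phi> x = 0"
    and \<rho>: "0 < \<rho>" and small: "emeasure lborel A \<le> ennreal (unit_ball_vol (real CARD('n)) * \<rho> ^ CARD('n) / 2)"
  shows "unit_ball_vol (real CARD('n)) / 2 * \<rho> powr (- 2 * s) * (\<integral>x. (\<phi> x)\<^sup>2 \<partial>lborel) \<le> energy s \<phi> \<phi>"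
proof -
  have [measurable]: "\<phi> \<in> borel_measurable borel" using \<phi> by (simp add: finite_energy_def)
  define V where "V = unit_ball_vol (real CARD('n)) * \<rho> ^ CARD('n)"
  define \<kappa> where "\<kappa> = 1 / \<rho> powr (real CARD('n) + 2 * s)"
  have V: "0 \<le> V" using \<rho> by (simp add: V_def)
  have \<kappa>: "0 \<le> \<kappa>" by (simp add: \<kappa>_def)
  have le: "ennreal ((\<phi> x)\<^sup>2 * \<kappa>) * indicator (ball x \<rho> - A) y \<le> ennreal (interaction s \<phi> \<phi> (x, y))" for x y
  proof (cases "x \<in> A \<and> y \<in> ball x \<rho> - A")
    case False
    then show ?thesis using supp[of x] by (auto simp: indicator_def)
  next
    case True
    then have "x \<noteq> y" "norm (x - y) \<le> \<rho>" by (auto simp: dist_norm)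
    then have "\<kappa> \<le> frac_kernel s (x - y)"
      unfolding \<kappa>_def frac_kernel_def using s \<rho> 
      by (intro divide_left_mono powr_mono2 mult_pos_pos) auto
    then have "(\<phi> x)\<^sup>2 * \<kappa> \<le> interaction s \<phi> \<phi> (x, y)"
      using True supp[of y] by (simp add: interaction_def power2_eq_square mult_left_mono)
    then show ?thesis using True by (simp add: ennreal_leI)
  qed
  have vol: "ennreal (V / 2) \<le> emeasure lborel (ball x \<rho> - A)" for x
  proof -
    have "ennreal V = emeasure lborel (ball x \<rho>)"
      using \<rho> by (simp add: V_def emeasure_ball)
    also have "\<dots> \<le> emeasure lborel (ball x \<rho> - A) + emeasure lborel A"
      using emeasure_subadditive[of "ball x \<rho> - A" lborel A] emeasure_mono[of "ball x \<rho>" "ball x \<rho> - A \<union> A" lborel]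
      by (auto intro: order_trans)
    also have "\<dots> \<le> emeasure lborel (ball x \<rho> - A) + ennreal (V / 2)"
      using small by (intro add_left_mono) (simp add: V_def)
    finally have "ennreal (V / 2) + ennreal (V / 2) \<le> emeasure lborel (ball x \<rho> - A) + ennreal (V / 2)"
      using V by (simp add: ennreal_plus[symmetric] del: ennreal_plus)
    then show ?thesis by (simp add: ennreal_add_left_cancel_le add.commute)
  qed
  have "ennreal (V / 2 * \<kappa> * (\<integral>x. (\<phi> x)\<^sup>2 \<partial>lborel)) = ennreal (V / 2 * \<kappa>) * (\<integral>\<^sup>+ x. ennreal ((\<phi> x)\<^sup>2) \<partial>lborel)"
    using V \<kappa> int by (simp add: nn_integral_eq_integral ennreal_mult[symmetric])
  also have "\<dots> = (\<integral>\<^sup>+ x. ennreal ((\<phi> x)\<^sup>2 * \<kappa>) * ennreal (V / 2) \<partial>lborel)"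
    using V \<kappa> by (subst nn_integral_cmult[symmetric]) (auto intro!: nn_integral_cong simp: ennreal_mult[symmetric] mult_ac)
  also have "\<dots> \<le> (\<integral>\<^sup>+ x. \<integral>\<^sup>+ y. ennreal ((\<phi> x)\<^sup>2 * \<kappa>) * indicator (ball x \<rho> - A) y \<partial>lborel \<partial>lborel)"
    using vol by (intro nn_integral_mono) (simp add: nn_integral_cmult_indicator mult_left_mono)
  also have "\<dots> \<le> (\<integral>\<^sup>+ x. \<integral>\<^sup>+ y. ennreal (interaction s \<phi> \<phi> (x, y)) \<partial>lborel \<partial>lborel)"
    by (intro nn_integral_mono le)
  also have "\<dots> = (\<integral>\<^sup>+ p. ennreal (interaction s \<phi> \<phi> p) \<partial>(lborel \<Otimes>\<^sub>M lborel))"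
    using interaction_measurable[of \<phi> \<phi> s]
    by (intro lborel.nn_integral_fst) (simp add: lborel_prod)
  also have "\<dots> = ennreal (energy s \<phi> \<phi>)"
    using \<phi> interaction_self_nonneg[of s \<phi>] unfolding lborel_prod energy_def
    by (intro nn_integral_eq_integral) (auto simp: finite_energy_def)
  finally have "V / 2 * \<kappa> * (\<integral>x. (\<phi> x)\<^sup>2 \<partial>lborel) \<le> energy s \<phi> \<phi>"
    using interaction_self_nonneg[of s \<phi>] by (subst (asm) ennreal_le_iff) (auto simp: energy_def intro!: Bochner_Integration.integral_nonneg)
  moreover have "V / 2 * \<kappa> = unit_ball_vol (real CARD('n)) / 2 * \<rho> powr (- 2 * s)"
    using \<rho> by (simp add: V_def \<kappa>_def powr_add powr_minus powr_realpow field_simps)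
  ultimately show ?thesis by simp
qed

section \<open>Antisymmetric functions in a half-space\<close>

text \<open>The shape of all test functions below.\<close>

definition half_pos :: "'a::euclidean_space \<Rightarrow> real \<Rightarrow> ('a \<Rightarrow> real) \<Rightarrow> 'a \<Rightarrow> real" where
  "half_pos e \<mu> g x = (if x \<bullet> e < \<mu> then max 0 (g x) else 0)"

lemma half_pos_nonneg: "0 \<le> half_pos e \<mu> g x"
  by (simp add: half_pos_def)

lemma half_pos_continuous:
  assumes g: "continuous_on UNIV g" and 0: "\<And>x. x \<bullet> e = \<mu> \<Longrightarrow> g x = 0"
  shows "continuous_on UNIV (half_pos e \<mu> g)"
proof -
  have "continuous_on ({x. x \<bullet> e \<le> \<mu>} \<union> {x. \<mu> \<le> x \<bullet> e}) (\<lambda>x. if x \<bullet> e < \<mu> then max 0 (g x) else 0)"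
    by (rule continuous_on_cases)
       (auto intro!: closed_Collect_le continuous_intros continuous_on_subset[OF g] simp: 0)
  moreover have "{x. x \<bullet> e \<le> \<mu>} \<union> {x. \<mu> \<le> x \<bullet> e} = UNIV" by auto
  ultimately show ?thesis by (simp add: half_pos_def[abs_def])
qed

lemma antisymmetric_on_hyperplane:
  fixes v :: "'a::euclidean_space \<Rightarrow> real"
  assumes "\<And>x. v (reflect e \<mu> x) = - v x" "x \<bullet> e = \<mu>"
  shows "v x = 0"
  using assms(1)[of x] assms(2) by simp

lemma frac_kernel_reflect_le:
  fixes e :: "real^'n::finite"
  assumes "0 < s" "norm e = 1" "x \<bullet> e \<le> \<mu>" "y \<bullet> e \<le> \<mu>" "x \<noteq> y"
  shows "frac_kernel s (x - reflect e \<mu> y) \<le> frac_kernel s (x - y)"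
proof (rule frac_kernel_antimono)
  have "(norm (x - y))\<^sup>2 \<le> (norm (x - reflect e \<mu> y))\<^sup>2"
    using assms by (simp add: norm_minus_reflect_sq)
  then show "norm (x - y) \<le> norm (x - reflect e \<mu> y)" by (rule power2_le_imp_le) simp
qed (use assms in auto)

lemma frac_kernel_reflect_simps:
  fixes e :: "real^'n::finite"
  assumes e: "norm e = 1"
  shows "frac_kernel s (reflect e \<mu> x - y) = frac_kernel s (x - reflect e \<mu> y)"
    and "frac_kernel s (reflect e \<mu> x - reflect e \<mu> y) = frac_kernel s (x - y)"
  by (simp_all add: e frac_kernel_def norm_minus_reflect_commute[OF e])

lemma half_pos_reflect:
  assumes "norm e = 1" "x \<bullet> e \<le> \<mu>"
  shows "half_pos e \<mu> g (reflect e \<mu> x) = 0"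
  using assms by (simp add: half_pos_def reflect_inner)

text \<open>On the half-space \<open>v = \<eta> + p - \<phi>\<close> with \<open>p * \<phi> = 0\<close>, and beyond it \<open>\<eta>\<close> and \<open>\<phi>\<close> vanish while \<open>v\<close> is
  continued antisymmetrically. Inserting this into the four-image sum makes both sides agree up to
  the term \<open>2 * \<phi> x * \<phi> y * K'\<close>, which is dropped. The last summand is the gain from the positive
  values of \<open>v - \<eta>\<close>: it has a sign because \<open>K' \<le> K\<close>.\<close>

lemma reflect_sum_interaction_le:
  fixes v \<eta> :: "real^'n::finite \<Rightarrow> real"
  assumes s: "0 < s" and e: "norm e = 1"
    and anti: "\<And>x. v (reflect e \<mu> x) = - v x"
    and \<eta>: "\<And>x. \<mu> \<le> x \<bullet> e \<Longrightarrow> \<eta> x = 0"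
    and x: "x \<bullet> e \<le> \<mu>" and y: "y \<bullet> e \<le> \<mu>"
  defines "\<phi> \<equiv> half_pos e \<mu> (\<lambda>x. \<eta> x - v x)" and "p \<equiv> half_pos e \<mu> (\<lambda>x. v x - \<eta> x)"
  defines "K \<equiv> frac_kernel s (x - y)" and "K' \<equiv> frac_kernel s (x - reflect e \<mu> y)"
  shows "reflect_sum (reflect e \<mu>) (interaction s v \<phi>) x y
    \<le> reflect_sum (reflect e \<mu>) (interaction s \<eta> \<phi>) x y - reflect_sum (reflect e \<mu>) (interaction s \<phi> \<phi>) x y
      + (\<eta> x * \<phi> y + \<eta> y * \<phi> x) * K' - (p x * \<phi> y + p y * \<phi> x) * (K - K')"
proof -
  let ?R = "reflect e \<mu>"
  have dec: "v w = \<eta> w + p w - \<phi> w" if "w \<bullet> e \<le> \<mu>" for w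
    using \<eta>[of w] antisymmetric_on_hyperplane[of v e \<mu> w, OF anti] that
    by (auto simp: \<phi>_def p_def half_pos_def max_def)
  have p0: "p w * \<phi> w = 0" for w by (auto simp: \<phi>_def p_def half_pos_def max_def)
  have R0: "\<phi> (?R w) = 0" "\<eta> (?R w) = 0" if "w \<bullet> e \<le> \<mu>" for w
    using that half_pos_reflect[OF e that] \<eta>[of "?R w"] by (auto simp: \<phi>_def reflect_inner[OF e])
  have nn: "0 \<le> \<phi> w" for w by (simp add: \<phi>_def half_pos_nonneg)
  have RS: "reflect_sum ?R (interaction s v \<phi>) x y = (v x - v y) * (\<phi> x - \<phi> y) * K + (v x + v y) * (\<phi> x + \<phi> y) * K'"
    "reflect_sum ?R (interaction s \<eta> \<phi>) x y = (\<eta> x - \<eta> y) * (\<phi> x - \<phi> y) * K + (\<eta> x * \<phi> x + \<eta> y * \<phi> y) * K'"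
    "reflect_sum ?R (interaction s \<phi> \<phi>) x y = (\<phi> x - \<phi> y) * (\<phi> x - \<phi> y) * K + (\<phi> x * \<phi> x + \<phi> y * \<phi> y) * K'"
    using R0[OF x] R0[OF y]
    by (simp_all add: reflect_sum_def interaction_def anti frac_kernel_reflect_simps[OF e] K_def K'_def algebra_simps)
  have alg: "((a + p - f) - (b + q - g)) * (f - g) * K + ((a + p - f) + (b + q - g)) * (f + g) * K'
     = ((a - b) * (f - g) * K + (a * f + b * g) * K') - ((f - g) * (f - g) * K + (f * f + g * g) * K')
       + (a * g + b * f) * K' - (p * g + q * f) * (K - K') - 2 * (f * g * K') + (p * f + q * g) * (K + K')"
    for a b p q f g :: real
    by (simp add: algebra_simps)
  have "0 \<le> \<phi> x * \<phi> y * K'" using nn by (simp add: K'_def)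
  then show ?thesis
    unfolding RS dec[OF x] dec[OF y] alg p0 by simp
qed

text \<open>Restriction to a half-space does not preserve finite energy in general: it produces the terms
  \<open>((\<phi> x)\<^sup>2 + (\<phi> y)\<^sup>2) * K'\<close>, a Hardy-type weight at the hyperplane. For antisymmetric \<open>v\<close> they are
  controlled by the terms \<open>(v x + v y)\<^sup>2 * K'\<close> and \<open>(v x - v y)\<^sup>2 * K\<close> of the energy of \<open>v\<close>, again since
  \<open>K' \<le> K\<close>.\<close>

lemma half_pos_finite_energy:
  fixes v \<eta> :: "real^'n::finite \<Rightarrow> real"
  assumes s: "0 < s" and e: "norm e = 1"
    and v: "finite_energy s v" and \<eta>f: "finite_energy s \<eta>"
    and anti: "\<And>x. v (reflect e \<mu> x) = - v x"
    and \<eta>: "\<And>x. \<mu> \<le> x \<bullet> e \<Longrightarrow> \<eta> x = 0"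
  shows "finite_energy s (half_pos e \<mu> (\<lambda>x. \<eta> x - v x))"
proof -
  define \<phi> where "\<phi> = half_pos e \<mu> (\<lambda>x. \<eta> x - v x)"
  let ?R = "reflect e \<mu>"
  have [measurable]: "v \<in> borel_measurable borel" "\<eta> \<in> borel_measurable borel"
    using v \<eta>f by (auto simp: finite_energy_def)
  have [measurable]: "\<phi> \<in> borel_measurable borel"
    unfolding \<phi>_def half_pos_def[abs_def] by measurable
  have "integrable lborel (interaction s \<phi> \<phi>)"
  proof (rule integrable_bound_reflect_sum[OF e])
    show "interaction s \<phi> \<phi> \<in> borel_measurable borel" by (rule interaction_measurable) auto
    show "0 \<le> interaction s \<phi> \<phi> p" for p by (rule interaction_self_nonneg)
    show "integrable lborel (\<lambda>p. 2 * interaction s \<eta> \<eta> p + 2 * interaction s v v p)"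
      using v \<eta>f by (auto simp: finite_energy_def)
    fix x y assume x: "x \<bullet> e \<le> \<mu>" and y: "y \<bullet> e \<le> \<mu>"
    define K K' where "K = frac_kernel s (x - y)" and "K' = frac_kernel s (x - ?R y)"
    have R0: "\<phi> (?R w) = 0" "\<eta> (?R w) = 0" if "w \<bullet> e \<le> \<mu>" for w
      using that half_pos_reflect[OF e that] \<eta>[of "?R w"] by (auto simp: \<phi>_def reflect_inner[OF e])
    have K: "0 \<le> K" "0 \<le> K'" by (auto simp: K_def K'_def)
    have val: "\<phi> w = max 0 (\<eta> w - v w)" if "w \<bullet> e \<le> \<mu>" for w
      using \<eta>[of w] antisymmetric_on_hyperplane[of v e \<mu> w, OF anti] that
      by (auto simp: \<phi>_def half_pos_def)
    have RS: "reflect_sum ?R (interaction s \<phi> \<phi>) x y = (\<phi> x - \<phi> y)\<^sup>2 * K + ((\<phi> x)\<^sup>2 + (\<phi> y)\<^sup>2) * K'"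
      "reflect_sum ?R (\<lambda>p. 2 * interaction s \<eta> \<eta> p + 2 * interaction s v v p) x y
       = 2 * ((\<eta> x - \<eta> y)\<^sup>2 * K + ((\<eta> x)\<^sup>2 + (\<eta> y)\<^sup>2) * K') + 4 * ((v x - v y)\<^sup>2 * K + (v x + v y)\<^sup>2 * K')"
      using R0[OF x] R0[OF y]
      by (simp_all add: reflect_sum_def interaction_def anti e frac_kernel_reflect_simps[OF e] K_def K'_def power2_eq_square algebra_simps)
    have sq: "(a + b)\<^sup>2 \<le> 2 * a\<^sup>2 + 2 * b\<^sup>2" for a b :: real
      using sum_squares_bound[of a b] by (simp add: power2_sum)
    have "(\<phi> x - \<phi> y)\<^sup>2 \<le> ((\<eta> x - \<eta> y) + (v y - v x))\<^sup>2"
      unfolding val[OF x] val[OF y] abs_le_square_iff[symmetric] by linarith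
    also have "\<dots> \<le> 2 * (\<eta> x - \<eta> y)\<^sup>2 + 2 * (v x - v y)\<^sup>2"
      using sq[of "\<eta> x - \<eta> y" "v y - v x"] by (simp add: power2_commute[of "v y"])
    finally have 1: "(\<phi> x - \<phi> y)\<^sup>2 * K \<le> (2 * (\<eta> x - \<eta> y)\<^sup>2 + 2 * (v x - v y)\<^sup>2) * K"
      using K(1) by (rule mult_right_mono)
    have 2: "(\<phi> w)\<^sup>2 \<le> 2 * (\<eta> w)\<^sup>2 + 2 * (v w)\<^sup>2" if "w \<bullet> e \<le> \<mu>" for w
    proof -
      have "(\<phi> w)\<^sup>2 \<le> (\<eta> w + - v w)\<^sup>2"
        unfolding val[OF that] abs_le_square_iff[symmetric] by linarith
      also have "\<dots> \<le> 2 * (\<eta> w)\<^sup>2 + 2 * (v w)\<^sup>2" using sq[of "\<eta> w" "- v w"] by simp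
      finally show ?thesis .
    qed
    have 3: "((\<phi> x)\<^sup>2 + (\<phi> y)\<^sup>2) * K' \<le> (2 * ((\<eta> x)\<^sup>2 + (\<eta> y)\<^sup>2) + 2 * ((v x)\<^sup>2 + (v y)\<^sup>2)) * K'"
      using 2[OF x] 2[OF y] K by (intro mult_right_mono) auto
    have 4: "(v x - v y)\<^sup>2 * K' \<le> (v x - v y)\<^sup>2 * K"
    proof (cases "x = y")
      case False
      then show ?thesis
        using frac_kernel_reflect_le[OF s e x y] by (auto simp: K_def K'_def intro: mult_left_mono)
    qed simp
    have 5: "2 * ((v x)\<^sup>2 + (v y)\<^sup>2) * K' = (v x - v y)\<^sup>2 * K' + (v x + v y)\<^sup>2 * K'"
      by (simp add: power2_eq_square algebra_simps)
    have 6: "0 \<le> (v x + v y)\<^sup>2 * K'" "0 \<le> (v x - v y)\<^sup>2 * K" using K by auto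
    show "reflect_sum ?R (interaction s \<phi> \<phi>) x y
      \<le> reflect_sum ?R (\<lambda>p. 2 * interaction s \<eta> \<eta> p + 2 * interaction s v v p) x y"
      unfolding RS using 1 3 4 5 6 by (simp add: distrib_right mult.assoc)
  qed
  then show ?thesis by (simp add: finite_energy_def \<phi>_def[symmetric])
qed

text \<open>The case \<open>\<eta> = 0\<close> of \<open>reflect_sum_interaction_le\<close>, where only the sign of the gain matters.\<close>

lemma energy_neg_part_le:
  fixes v :: "real^'n::finite \<Rightarrow> real"
  assumes s: "0 < s" and e: "norm e = 1" and v: "finite_energy s v"
    and anti: "\<And>x. v (reflect e \<mu> x) = - v x"
  defines "\<phi> \<equiv> half_pos e \<mu> (\<lambda>x. - v x)"
  shows "finite_energy s \<phi>" and "energy s v \<phi> \<le> - energy s \<phi> \<phi>"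
proof -
  have "interaction s (\<lambda>x :: real^'n. 0) (\<lambda>x. 0) = (\<lambda>p. 0)" by (auto simp: interaction_def)
  then have z: "finite_energy s (\<lambda>x :: real^'n. 0)" by (simp add: finite_energy_def)
  show \<phi>: "finite_energy s \<phi>"
    using half_pos_finite_energy[OF s e v z anti] by (simp add: \<phi>_def)
  let ?R = "reflect e \<mu>"
  have "integral\<^sup>L lborel (interaction s v \<phi>) \<le> integral\<^sup>L lborel (\<lambda>p. - interaction s \<phi> \<phi> p)"
  proof (rule integral_mono_reflect_sum[OF e integrable_interaction[OF v \<phi>]])
    show "integrable lborel (\<lambda>p. - interaction s \<phi> \<phi> p)" using \<phi> by (simp add: finite_energy_def)
    fix x y assume x: "x \<bullet> e \<le> \<mu>" and y: "y \<bullet> e \<le> \<mu>"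
    define p where "p = half_pos e \<mu> (\<lambda>x. v x - 0)"
    have *: "0 \<le> (p x * \<phi> y + p y * \<phi> x) * (frac_kernel s (x - y) - frac_kernel s (x - ?R y))"
    proof (cases "x = y")
      case True
      have "p x * \<phi> x = 0" by (simp add: p_def \<phi>_def half_pos_def max_def)
      then have "p x * \<phi> y + p y * \<phi> x = 0" using True by auto
      then show ?thesis by simp
    next
      case False
      then show ?thesis
        using frac_kernel_reflect_le[OF s e x y] by (simp add: p_def \<phi>_def half_pos_nonneg)
    qed
    have "reflect_sum ?R (interaction s (\<lambda>x. 0) \<phi>) x y = 0"
      by (simp add: reflect_sum_def interaction_def)
    moreover have "reflect_sum ?R (\<lambda>p. - interaction s \<phi> \<phi> p) x y = - reflect_sum ?R (interaction s \<phi> \<phi>) x y"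
      by (simp add: reflect_sum_def)
    ultimately show "reflect_sum ?R (interaction s v \<phi>) x y \<le> reflect_sum ?R (\<lambda>p. - interaction s \<phi> \<phi> p) x y"
      using reflect_sum_interaction_le[where v = v and \<eta> = "\<lambda>x. 0", OF s e anti _ x y] *
      by (simp add: \<phi>_def p_def)
  qed
  then show "energy s v \<phi> \<le> - energy s \<phi> \<phi>" by (simp add: energy_def)
qed

section \<open>Maximum principles for antisymmetric functions\<close>

lemma continuous_nonneg_integral_nonpos_imp_zero:
  fixes \<phi> :: "'a::euclidean_space \<Rightarrow> real"
  assumes "continuous_on UNIV \<phi>" "\<And>x. 0 \<le> \<phi> x" "integrable lborel \<phi>" "integral\<^sup>L lborel \<phi> \<le> 0"
  shows "\<phi> x = 0"
proof -
  have "integral\<^sup>L lborel \<phi> = 0"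
    using assms by (intro antisym Bochner_Integration.integral_nonneg) auto
  then have "AE x in lborel. \<phi> x = 0"
    using integral_nonneg_eq_0_iff_AE[OF assms(3)] assms(2) by simp
  then have "AE x in lebesgue. x \<in> {x. \<phi> x = 0}"
    by (auto intro: AE_completion)
  moreover have "closed {x. \<phi> x = 0}"
    by (intro closed_Collect_eq assms continuous_on_const)
  ultimately show ?thesis using mem_closed_if_AE_lebesgue by blast
qed

text \<open>The weak form of \<open>(- \<Delta>)\<^sup>s v \<ge> - L * \<bar>v\<bar>\<close> in \<open>D\<close>.\<close>

definition supersolution :: "real \<Rightarrow> real \<Rightarrow> (real^'n::finite) set \<Rightarrow> (real^'n \<Rightarrow> real) \<Rightarrow> bool" where
  "supersolution s L D v \<longleftrightarrow> (\<forall>\<phi> M. finite_energy s \<phi> \<longrightarrow> (\<forall>x. 0 \<le> \<phi> x \<and> \<phi> x \<le> M) \<longrightarrow>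
     (\<forall>x. x \<notin> D \<longrightarrow> \<phi> x = 0) \<longrightarrow> - L * (\<integral>x. \<bar>v x\<bar> * \<phi> x \<partial>lborel) \<le> energy s v \<phi>)"

lemma supersolutionD:
  assumes "supersolution s L D v" "finite_energy s \<phi>" "\<And>x. 0 \<le> \<phi> x" "\<And>x. \<phi> x \<le> M"
    "\<And>x. x \<notin> D \<Longrightarrow> \<phi> x = 0"
  shows "- L * (\<integral>x. \<bar>v x\<bar> * \<phi> x \<partial>lborel) \<le> energy s v \<phi>"
  using assms unfolding supersolution_def by blast

text \<open>The bound on the measure depends on \<open>L\<close> only, not on the function or the hyperplane. The radius \<open>\<rho>\<close>
  is chosen so that \<open>energy_ge_of_small_support\<close> holds with constant \<open>L + 1\<close>; tested against its own
  negative part, a supersolution satisfies the opposite inequality with constant \<open>L\<close>.\<close>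

lemma small_volume_maximum_principle:
  fixes s L :: real
  assumes s: "0 < s" and L: "0 \<le> L"
  obtains \<delta> where "0 < \<delta>"
    "\<And>(e :: real^'n::finite) \<mu> v D M x. norm e = 1 \<Longrightarrow> continuous_on UNIV v \<Longrightarrow> finite_energy s v \<Longrightarrow>
       (\<And>x. v (reflect e \<mu> x) = - v x) \<Longrightarrow> (\<And>x. \<bar>v x\<bar> \<le> M) \<Longrightarrow> supersolution s L D v \<Longrightarrow>
       D \<in> sets borel \<Longrightarrow> bounded D \<Longrightarrow> (\<And>x. x \<bullet> e < \<mu> \<Longrightarrow> x \<notin> D \<Longrightarrow> 0 \<le> v x) \<Longrightarrow>
       emeasure lborel {x \<in> D. v x < 0} \<le> ennreal \<delta> \<Longrightarrow> x \<bullet> e < \<mu> \<Longrightarrow> 0 \<le> v x"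
proof -
  define V where "V = unit_ball_vol (real CARD('n))"
  have V: "0 < V" by (simp add: V_def)
  \<comment> \<open>the solution of \<open>V / 2 * \<rho> powr (- 2 * s) = L + 1\<close>\<close>
  define \<rho> where "\<rho> = (V / (2 * (L + 1))) powr (1 / (2 * s))"
  have \<rho>: "0 < \<rho>" using V L by (simp add: \<rho>_def)
  have \<rho>eq: "V / 2 * \<rho> powr (- 2 * s) = L + 1"
    using V L s by (simp add: \<rho>_def powr_powr powr_minus field_simps)
  show thesis
  proof (rule that[of "V * \<rho> ^ CARD('n) / 2"])
    show "0 < V * \<rho> ^ CARD('n) / 2" using V \<rho> by simp
    fix e :: "real^'n" and \<mu> v D M x
    assume e: "norm e = 1" and vc: "continuous_on UNIV v" and v: "finite_energy s v"
      and anti: "\<And>x. v (reflect e \<mu> x) = - v x" and M: "\<And>x. \<bar>v x\<bar> \<le> M"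
      and super: "supersolution s L D v" and D [measurable]: "D \<in> sets borel" and bD: "bounded D"
      and out: "\<And>x. x \<bullet> e < \<mu> \<Longrightarrow> x \<notin> D \<Longrightarrow> 0 \<le> v x"
      and vol: "emeasure lborel {x \<in> D. v x < 0} \<le> ennreal (V * \<rho> ^ CARD('n) / 2)"
      and x: "x \<bullet> e < \<mu>"
    have vm [measurable]: "v \<in> borel_measurable borel" using v by (rule finite_energy_measurable)
    define A where "A = {x \<in> D. v x < 0}"
    have A: "A \<in> sets borel" unfolding A_def by measurable
    have bA: "bounded A" by (rule bounded_subset[OF bD]) (auto simp: A_def)
    define \<phi> where "\<phi> = half_pos e \<mu> (\<lambda>x. - v x)"
    have \<phi>f: "finite_energy s \<phi>" and le: "energy s v \<phi> \<le> - energy s \<phi> \<phi>"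
      using energy_neg_part_le[OF s e v anti] by (auto simp: \<phi>_def)
    have \<phi>c: "continuous_on UNIV \<phi>" unfolding \<phi>_def
      using antisymmetric_on_hyperplane[of v e \<mu>, OF anti]
      by (intro half_pos_continuous continuous_intros vc) auto
    have supp: "\<phi> y = 0" if "y \<notin> A" for y
      using out[of y] that by (auto simp: A_def \<phi>_def half_pos_def max_def)
    have \<phi>M: "0 \<le> \<phi> y" "\<phi> y \<le> M" for y
      using M[of y] by (auto simp: \<phi>_def half_pos_def)
    have int: "integrable lborel (\<lambda>x. (\<phi> x)\<^sup>2)"
    proof (rule integrable_lborel_compact_support[where M = "M\<^sup>2" and D = A])
      show "(\<lambda>x. (\<phi> x)\<^sup>2) \<in> borel_measurable borel"
        using \<phi>f by (auto simp: finite_energy_def)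
      show "\<bar>(\<phi> y)\<^sup>2\<bar> \<le> M\<^sup>2" for y
        using power_mono[OF \<phi>M(2,1)[of y], of 2] by simp
    qed (use bA supp in auto)
    have "V / 2 * \<rho> powr (- 2 * s) * (\<integral>x. (\<phi> x)\<^sup>2 \<partial>lborel) \<le> energy s \<phi> \<phi>"
      unfolding V_def
      by (rule energy_ge_of_small_support[OF s \<phi>f int A supp \<rho>]) (use vol in \<open>auto simp: V_def A_def\<close>)
    then have "(L + 1) * (\<integral>x. (\<phi> x)\<^sup>2 \<partial>lborel) \<le> energy s \<phi> \<phi>"
      unfolding \<rho>eq .
    moreover have "- L * (\<integral>x. (\<phi> x)\<^sup>2 \<partial>lborel) \<le> energy s v \<phi>"
    proof -
      have "(\<lambda>x. \<bar>v x\<bar> * \<phi> x) = (\<lambda>x. (\<phi> x)\<^sup>2)"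
        by (auto simp: \<phi>_def half_pos_def max_def power2_eq_square)
      then show ?thesis
        using supersolutionD[OF super \<phi>f \<phi>M] supp by (auto simp: A_def)
    qed
    ultimately have "(\<integral>x. (\<phi> x)\<^sup>2 \<partial>lborel) \<le> 0"
      using le by (simp add: algebra_simps)
    then have "(\<phi> x)\<^sup>2 = 0"
      by (intro continuous_nonneg_integral_nonpos_imp_zero[where \<phi> = "\<lambda>x. (\<phi> x)\<^sup>2"] continuous_intros \<phi>c int) auto
    then show "0 \<le> v x" using x by (auto simp: \<phi>_def half_pos_def max_def split: if_splits)
  qed
qed

lemma isCont_frac_kernel: "z \<noteq> 0 \<Longrightarrow> isCont (frac_kernel s) z"
  unfolding frac_kernel_def by (intro continuous_intros) auto

text \<open>The paraboloid \<open>r\<^sup>2 - (norm (x - c))\<^sup>2\<close>, cut off at \<open>0\<close>; in this form it is visibly Lipschitz.\<close>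

definition bump :: "'a::real_normed_vector \<Rightarrow> real \<Rightarrow> 'a \<Rightarrow> real" where
  "bump c r x = r\<^sup>2 - (min r (norm (x - c)))\<^sup>2"

lemma bump_bounds:
  assumes "0 < r"
  shows "0 \<le> bump c r x" "bump c r x \<le> r\<^sup>2"
  using assms by (auto simp: bump_def intro!: power_mono)

lemma bump_outside: "0 < r \<Longrightarrow> x \<notin> ball c r \<Longrightarrow> bump c r x = 0"
  by (simp add: bump_def dist_norm norm_minus_commute min_def)

lemma bump_centre: "0 < r \<Longrightarrow> bump c r c = r\<^sup>2"
  by (simp add: bump_def)

lemma continuous_on_bump: "continuous_on S (bump c r)"
  unfolding bump_def by (intro continuous_intros)

lemma bump_Lipschitz:
  assumes r: "0 < r"
  shows "\<bar>bump c r x - bump c r y\<bar> \<le> 2 * r * norm (x - y)"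
proof -
  define a b where "a = min r (norm (x - c))" and "b = min r (norm (y - c))"
  have ab: "0 \<le> a" "a \<le> r" "0 \<le> b" "b \<le> r" using r by (auto simp: a_def b_def)
  have "\<bar>norm (x - c) - norm (y - c)\<bar> \<le> norm (x - y)"
    using norm_triangle_ineq3[of "x - c" "y - c"] by simp
  then have d: "\<bar>b - a\<bar> \<le> norm (x - y)" by (auto simp: a_def b_def min_def abs_if split: if_splits)
  have "bump c r x - bump c r y = (b + a) * (b - a)"
    by (simp add: bump_def a_def b_def power2_eq_square algebra_simps)
  then have "\<bar>bump c r x - bump c r y\<bar> = (b + a) * \<bar>b - a\<bar>"
    using ab by (simp add: abs_mult)
  also have "\<dots> \<le> (2 * r) * norm (x - y)"
    using ab d r by (intro mult_mono) auto
  finally show ?thesis .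
qed

text \<open>Inside the ball the cut-off is inactive at \<open>x\<close>, and at \<open>x + z\<close> and \<open>x - z\<close> it only increases the
  value; so the left-hand side is at most what it is for the paraboloid, which the parallelogram
  law gives. The kink of the bump at the sphere is harmless because it is convex.\<close>

lemma bump_second_difference:
  fixes c :: "'a::real_inner"
  assumes r: "0 < r" and x: "x \<in> ball c r"
  shows "2 * bump c r x - bump c r (x + z) - bump c r (x - z) \<le> 2 * min (r\<^sup>2) ((norm z)\<^sup>2)"
proof -
  let ?m = "\<lambda>y. (min r (norm (y - c)))\<^sup>2"
  have mx: "?m x = (norm (x - c))\<^sup>2" using x by (simp add: dist_norm norm_minus_commute min_def)
  have m: "?m y \<le> r\<^sup>2" "?m y \<le> (norm (y - c))\<^sup>2" for y
    using r by (auto intro!: power_mono)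
  have par: "(norm (x + z - c))\<^sup>2 + (norm (x - z - c))\<^sup>2 = 2 * (norm (x - c))\<^sup>2 + 2 * (norm z)\<^sup>2"
  proof -
    have "x + z - c = (x - c) + z" "x - z - c = (x - c) - z" by auto
    then show ?thesis
      by (simp only: power2_norm_eq_inner) (simp add: inner_add inner_diff inner_commute)
  qed
  have "?m (x + z) + ?m (x - z) - 2 * ?m x \<le> 2 * (norm z)\<^sup>2"
    using m(2)[of "x + z"] m(2)[of "x - z"] par mx by linarith
  moreover have "?m (x + z) + ?m (x - z) - 2 * ?m x \<le> 2 * r\<^sup>2"
    using m(1)[of "x + z"] m(1)[of "x - z"] zero_le_power2[of "min r (norm (x - c))"] by linarith
  ultimately show ?thesis by (simp add: bump_def min_def)
qed

lemma bump_energy_le: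
  fixes c :: "real^'n::finite"
  assumes s: "0 < s" "s < 1" and r: "0 < r" "r \<le> 1"
    and \<phi>: "finite_energy s \<phi>" "integrable lborel \<phi>" "\<And>x. 0 \<le> \<phi> x" "\<And>x. x \<notin> ball c r \<Longrightarrow> \<phi> x = 0"
  shows "finite_energy s (bump c r)"
    and "energy s (bump c r) \<phi>
      \<le> 2 * (\<integral>z. min 1 ((norm (z :: real^'n))\<^sup>2) * frac_kernel s z \<partial>lborel) * integral\<^sup>L lborel \<phi>"
proof -
  have M: "\<bar>bump c r x\<bar> \<le> r\<^sup>2" for x using bump_bounds[OF r(1), of c x] by simp
  have meas: "bump c r \<in> borel_measurable borel"
    by (intro borel_measurable_continuous_onI continuous_on_bump)
  show fe: "finite_energy s (bump c r)"
    by (rule finite_energy_Lipschitz_compact_support[OF s meas bump_Lipschitz[OF r(1)] M bump_outside[OF r(1)]])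
  have "r\<^sup>2 \<le> 1" using r by (simp add: power_le_one)
  then have d: "2 * bump c r x - bump c r (x + z) - bump c r (x - z) \<le> 2 * min 1 ((norm z)\<^sup>2)" if "\<phi> x \<noteq> 0" for x z
    using bump_second_difference[OF r(1), of x c z] \<phi>(4)[of x] that by (force simp: min_def split: if_splits)
  have h: "integrable lborel (\<lambda>z :: real^'n. 2 * min 1 ((norm z)\<^sup>2) * frac_kernel s z)"
    using frac_kernel_truncated_integrable[OF s, where 'n = 'n] by (simp add: mult.assoc)
  show "energy s (bump c r) \<phi>
      \<le> 2 * (\<integral>z. min 1 ((norm (z :: real^'n))\<^sup>2) * frac_kernel s z \<partial>lborel) * integral\<^sup>L lborel \<phi>"
    using energy_le_of_second_difference[OF fe \<phi>(1) M \<phi>(2,3) h d] by (simp add: mult.assoc)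
qed

text \<open>The constants for the barrier argument, by continuity of \<open>v\<close> and of the kernel away from the
  origin: at \<open>(c, z)\<close> the kernel difference is positive since both points lie strictly on the same
  side of the hyperplane, and \<open>c\<close> differs from its mirror image.\<close>

lemma antisymmetric_barrier_radius:
  fixes e :: "real^'n::finite" and v :: "real^'n \<Rightarrow> real"
  assumes s: "0 < s" and e: "norm e = 1" and v: "continuous_on UNIV v"
    and D: "open D" "\<And>x. x \<in> D \<Longrightarrow> x \<bullet> e < \<mu>" "c \<in> D"
    and z: "z \<bullet> e < \<mu>" "0 < v z" "z \<noteq> c"
  obtains r \<kappa> C where "0 < r" "r \<le> 1" "0 < \<kappa>" "0 \<le> C" "ball c r \<subseteq> D" "ball c r \<inter> ball z r = {}"
    "\<And>y. y \<in> ball z r \<Longrightarrow> y \<bullet> e < \<mu> \<and> v z / 2 < v y"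
    "\<And>x y. x \<in> ball c r \<Longrightarrow> y \<in> ball c r \<Longrightarrow> frac_kernel s (x - reflect e \<mu> y) \<le> C"
    "\<And>x y. x \<in> ball c r \<Longrightarrow> y \<in> ball z r \<Longrightarrow> \<kappa> \<le> frac_kernel s (x - y) - frac_kernel s (x - reflect e \<mu> y)"
proof -
  let ?R = "reflect e \<mu>"
  have ce: "c \<bullet> e < \<mu>" using D by auto
  have ne: "c - z \<noteq> 0" "c - ?R z \<noteq> 0" "c - ?R c \<noteq> 0"
  proof -
    have "?R w \<bullet> e > \<mu>" if "w \<bullet> e < \<mu>" for w using that reflect_inner[OF e, of \<mu> w] by linarith
    then have "?R z \<bullet> e > \<mu>" "?R c \<bullet> e > \<mu>" using z ce by auto
    then show "c - z \<noteq> 0" "c - ?R z \<noteq> 0" "c - ?R c \<noteq> 0" using z(3) ce by auto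
  qed
  have Rc: "isCont ?R w" for w
    using continuous_on_reflect[of UNIV "\<lambda>x. x" "\<lambda>x. \<mu>" e] by (simp add: continuous_on_eq_continuous_at continuous_on_const continuous_on_id)
  define \<kappa> where "\<kappa> = (frac_kernel s (c - z) - frac_kernel s (c - ?R z)) / 2"
  define C where "C = frac_kernel s (c - ?R c) + 1"
  have "(norm (c - z))\<^sup>2 < (norm (c - ?R z))\<^sup>2"
    using ce z e by (simp add: norm_minus_reflect_sq)
  then have "norm (c - z) < norm (c - ?R z)" by (rule power2_less_imp_less) simp
  then have \<kappa>: "0 < \<kappa>"
    using frac_kernel_strict_antimono[OF s ne(1)] by (simp add: \<kappa>_def)
  have T: "(fst \<longlongrightarrow> a) (nhds a \<times>\<^sub>F nhds b)" "(snd \<longlongrightarrow> b) (nhds a \<times>\<^sub>F nhds b)" for a b :: "real^'n"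
    by (rule filterlim_fst, rule filterlim_snd)
  have TR: "((\<lambda>p. ?R (snd p)) \<longlongrightarrow> ?R b) (nhds a \<times>\<^sub>F nhds b)" for a b :: "real^'n"
    by (rule isCont_tendsto_compose[OF Rc T(2)])
  have K1: "((\<lambda>p. frac_kernel s (fst p - snd p)) \<longlongrightarrow> frac_kernel s (c - z)) (nhds c \<times>\<^sub>F nhds z)"
    by (rule isCont_tendsto_compose[OF isCont_frac_kernel[OF ne(1)] tendsto_diff[OF T]])
  have K2: "((\<lambda>p. frac_kernel s (fst p - ?R (snd p))) \<longlongrightarrow> frac_kernel s (c - ?R z)) (nhds c \<times>\<^sub>F nhds z)"
    by (rule isCont_tendsto_compose[OF isCont_frac_kernel[OF ne(2)] tendsto_diff[OF T(1) TR]])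
  have K3: "((\<lambda>p. frac_kernel s (fst p - ?R (snd p))) \<longlongrightarrow> frac_kernel s (c - ?R c)) (nhds c \<times>\<^sub>F nhds c)"
    by (rule isCont_tendsto_compose[OF isCont_frac_kernel[OF ne(3)] tendsto_diff[OF T(1) TR]])
  have "eventually (\<lambda>p. \<kappa> < frac_kernel s (fst p - snd p) - frac_kernel s (fst p - ?R (snd p))) (nhds c \<times>\<^sub>F nhds z)"
    using \<kappa> by (intro order_tendstoD[OF tendsto_diff[OF K1 K2]]) (simp add: \<kappa>_def field_simps)
  then obtain P Q where PQ: "eventually P (nhds c)" "eventually Q (nhds z)"
    "\<And>x y. P x \<Longrightarrow> Q y \<Longrightarrow> \<kappa> < frac_kernel s (x - y) - frac_kernel s (x - ?R y)"
    unfolding eventually_prod_filter by auto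
  have "eventually (\<lambda>p. frac_kernel s (fst p - ?R (snd p)) < C) (nhds c \<times>\<^sub>F nhds c)"
    by (intro order_tendstoD[OF K3]) (simp add: C_def)
  then obtain P1 P2 where P12: "eventually P1 (nhds c)" "eventually P2 (nhds c)"
    "\<And>x y. P1 x \<Longrightarrow> P2 y \<Longrightarrow> frac_kernel s (x - ?R y) < C"
    unfolding eventually_prod_filter by auto
  have Dn: "eventually (\<lambda>x. x \<in> D) (nhds c)" using D by (auto intro: eventually_nhds_in_open)
  have vn: "eventually (\<lambda>y. v z / 2 < v y) (nhds z)"
    using v z(2) by (intro order_tendstoD(1)[of v "v z"])
      (auto simp: continuous_on_eq_continuous_at isCont_def tendsto_at_iff_tendsto_nhds)
  have hn: "eventually (\<lambda>y. y \<bullet> e < \<mu>) (nhds z)"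
    using z(1) eventually_nhds_in_open[of "{y. y \<bullet> e < \<mu>}" z] open_halfspace_lt[of e \<mu>]
    by (simp add: inner_commute)
  obtain d1 where d1: "0 < d1" "\<And>x. dist x c < d1 \<Longrightarrow> P x \<and> P1 x \<and> P2 x \<and> x \<in> D"
    using eventually_conj[OF PQ(1) eventually_conj[OF P12(1) eventually_conj[OF P12(2) Dn]]]
    unfolding eventually_nhds_metric by auto
  obtain d2 where d2: "0 < d2" "\<And>x. dist x z < d2 \<Longrightarrow> Q x \<and> v z / 2 < v x \<and> x \<bullet> e < \<mu>"
    using eventually_conj[OF PQ(2) eventually_conj[OF vn hn]]
    unfolding eventually_nhds_metric by auto
  define r where "r = min (min 1 (dist c z / 2)) (min d1 d2)"
  have r: "0 < r" "r \<le> 1" "r \<le> dist c z / 2" "r \<le> d1" "r \<le> d2"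
    using z(3) d1(1) d2(1) by (auto simp: r_def)
  have disj: "ball c r \<inter> ball z r = {}" using r(3) by (intro disjoint_ballI) auto
  show ?thesis
  proof (rule that[OF r(1,2) \<kappa>, of C])
    show "0 \<le> C" by (simp add: C_def add_nonneg_nonneg)
    show "ball c r \<subseteq> D" using d1(2) r(4) by (auto simp: dist_commute)
    show "ball c r \<inter> ball z r = {}" by (rule disj)
    show "y \<bullet> e < \<mu> \<and> v z / 2 < v y" if "y \<in> ball z r" for y
      using d2(2)[of y] that r(5) by (auto simp: dist_commute)
    show "frac_kernel s (x - ?R y) \<le> C" if "x \<in> ball c r" "y \<in> ball c r" for x y
      using P12(3)[of x y] d1(2)[of x] d1(2)[of y] that r(4) by (auto simp: dist_commute less_imp_le)
    show "\<kappa> \<le> frac_kernel s (x - y) - frac_kernel s (x - ?R y)" if "x \<in> ball c r" "y \<in> ball z r" for x y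
      using PQ(3)[of x y] d1(2)[of x] d2(2)[of y] that r(4,5) by (auto simp: dist_commute less_imp_le)
  qed
qed

text \<open>The integrated form of \<open>reflect_sum_interaction_le\<close> for a barrier \<open>\<eta>\<close> supported near \<open>c\<close>. The
  mixed terms \<open>\<eta> x * \<phi> y * K'\<close> cost a multiple of \<open>\<epsilon>\<close>, the values \<open>v \<ge> \<delta>\<close> near \<open>z\<close> gain a multiple of
  \<open>\<delta>\<close>.\<close>

lemma antisymmetric_barrier_energy_le:
  fixes v \<eta> :: "real^'n::finite \<Rightarrow> real"
  assumes s: "0 < s" and e: "norm e = 1"
    and v: "finite_energy s v" and \<eta>f: "finite_energy s \<eta>"
    and anti: "\<And>x. v (reflect e \<mu> x) = - v x" and nn: "\<And>x. x \<bullet> e < \<mu> \<Longrightarrow> 0 \<le> v x"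
    and r: "0 < r" and half: "\<And>x. x \<in> ball c r \<Longrightarrow> x \<bullet> e < \<mu>" 
    and disj: "ball c r \<inter> ball z r = {}"
    and \<eta>: "\<And>x. 0 \<le> \<eta> x" "\<And>x. \<eta> x \<le> \<epsilon>" "\<And>x. x \<notin> ball c r \<Longrightarrow> \<eta> x = 0"
    and vz: "\<And>y. y \<in> ball z r \<Longrightarrow> y \<bullet> e < \<mu> \<and> \<delta> \<le> v y" and \<delta>: "0 \<le> \<delta>" and \<kappa>: "0 \<le> \<kappa>" and C: "0 \<le> C"
    and C_bd: "\<And>x y. x \<in> ball c r \<Longrightarrow> y \<in> ball c r \<Longrightarrow> frac_kernel s (x - reflect e \<mu> y) \<le> C"
    and \<kappa>_bd: "\<And>x y. x \<in> ball c r \<Longrightarrow> y \<in> ball z r \<Longrightarrow> \<kappa> \<le> frac_kernel s (x - y) - frac_kernel s (x - reflect e \<mu> y)"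
  defines "\<phi> \<equiv> half_pos e \<mu> (\<lambda>x. \<eta> x - v x)" and "V \<equiv> unit_ball_vol (real CARD('n)) * r ^ CARD('n)"
  shows "energy s v \<phi> \<le> energy s \<eta> \<phi> + 2 * C * \<epsilon> * V * integral\<^sup>L lborel \<phi> - 2 * \<kappa> * \<delta> * V * integral\<^sup>L lborel \<phi>"
proof -
  let ?R = "reflect e \<mu>"
  have \<eta>0: "\<eta> x = 0" if "\<mu> \<le> x \<bullet> e" for x using half[of x] \<eta>(3)[of x] that by force
  have \<phi>f: "finite_energy s \<phi>" unfolding \<phi>_def by (rule half_pos_finite_energy[OF s e v \<eta>f anti \<eta>0])
  have [measurable]: "\<phi> \<in> borel_measurable borel" using \<phi>f by (simp add: finite_energy_def)
  have \<phi>nn: "0 \<le> \<phi> x" for x by (simp add: \<phi>_def half_pos_nonneg)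
  have \<phi>supp: "\<phi> x = 0" if "x \<notin> ball c r" for x
    using nn[of x] \<eta>(3)[OF that] by (auto simp: \<phi>_def half_pos_def)
  have \<phi>le: "\<phi> x \<le> \<epsilon>" for x
    using nn[of x] \<eta>(1,2)[of x] by (auto simp: \<phi>_def half_pos_def)
  have \<phi>int: "integrable lborel \<phi>"
    by (rule integrable_lborel_compact_support[where M = \<epsilon> and D = "ball c r"]) (use \<phi>nn \<phi>le \<phi>supp in auto)
  define b where "b = (\<lambda>y. indicator (ball c r) (?R y) :: real)"
  define d where "d = (\<lambda>y. indicator (ball z r) y :: real)"
  have ball_int: "integrable lborel (indicator (ball w r) :: _ \<Rightarrow> real)" "integral\<^sup>L lborel (indicator (ball w r) :: _ \<Rightarrow> real) = V"
    for w :: "real^'n"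
    using emeasure_bounded_finite[of "ball w r"] r by (auto simp: V_def content_ball)
  have bi: "integrable lborel b" "integral\<^sup>L lborel b = V"
    using integral_lborel_invariant[OF measurable_reflect lborel_distr_reflect[OF e], of "indicator (ball c r)" \<mu>] ball_int
    by (auto simp: b_def)
  have di: "integrable lborel d" "integral\<^sup>L lborel d = V"
    using ball_int by (auto simp: d_def)
  \<comment> \<open>The indicator \<open>b\<close> of the mirror image of the ball makes the loss appear, in the four-image sum
    over a pair from the half-space, exactly at the pairs of points of the ball itself.\<close>
  define G where "G = (\<lambda>p. interaction s \<eta> \<phi> p + C * \<epsilon> * ((case p of (x, y) \<Rightarrow> \<phi> x * b y) + (case p of (x, y) \<Rightarrow> b x * \<phi> y))
     - \<kappa> * \<delta> * ((case p of (x, y) \<Rightarrow> \<phi> x * d y) + (case p of (x, y) \<Rightarrow> d x * \<phi> y)))"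
  note I = integrable_lborel_product[OF \<phi>int bi(1)] integrable_lborel_product[OF bi(1) \<phi>int]
    integrable_lborel_product[OF \<phi>int di(1)] integrable_lborel_product[OF di(1) \<phi>int]
    integrable_interaction[OF \<eta>f \<phi>f]
  have Gint: "integrable lborel G"
    unfolding G_def by (intro Bochner_Integration.integrable_add Bochner_Integration.integrable_diff integrable_mult_right I)
  have "integral\<^sup>L lborel G = energy s \<eta> \<phi> + C * \<epsilon> * (2 * V * integral\<^sup>L lborel \<phi>) - \<kappa> * \<delta> * (2 * V * integral\<^sup>L lborel \<phi>)"
    unfolding G_def energy_def using I
    by (simp add: integral_lborel_product \<phi>int bi di)
  moreover have "integral\<^sup>L lborel (interaction s v \<phi>) \<le> integral\<^sup>L lborel G"
  proof (rule integral_mono_reflect_sum[OF e integrable_interaction[OF v \<phi>f] Gint])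
    fix x y assume x: "x \<bullet> e \<le> \<mu>" and y: "y \<bullet> e \<le> \<mu>"
    define p where "p = half_pos e \<mu> (\<lambda>x. v x - \<eta> x)"
    define K K' where "K = frac_kernel s (x - y)" and "K' = frac_kernel s (x - ?R y)"
    define B where "B = (\<lambda>w. indicator (ball c r) w :: real)"
    have R0: "\<phi> (?R w) = 0" "b w = 0" "b (?R w) = B w" "d (?R w) = 0" if "w \<bullet> e \<le> \<mu>" for w
    proof -
      have "\<mu> \<le> ?R w \<bullet> e" using that by (simp add: reflect_inner[OF e])
      then have "?R w \<notin> ball c r" "?R w \<notin> ball z r" using half[of "?R w"] vz[of "?R w"] by fastforce+
      then show "\<phi> (?R w) = 0" "b w = 0" "b (?R w) = B w" "d (?R w) = 0"
        using \<phi>supp e by (auto simp: b_def d_def B_def)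
    qed
    have RSG: "reflect_sum ?R G x y = reflect_sum ?R (interaction s \<eta> \<phi>) x y
       + C * \<epsilon> * (\<phi> x * B y + B x * \<phi> y) - \<kappa> * \<delta> * (\<phi> x * d y + d x * \<phi> y)"
      using R0[OF x] R0[OF y] by (simp add: reflect_sum_def G_def algebra_simps)
    have gain: "\<eta> u * \<phi> w * K' \<le> C * \<epsilon> * (B u * \<phi> w)" if "(u, w) = (x, y) \<or> (u, w) = (y, x)" for u w
    proof (cases "u \<in> ball c r \<and> w \<in> ball c r")
      case True
      then have "K' \<le> C"
        using C_bd[of x y] that by (auto simp: K'_def)
      then have "\<eta> u * \<phi> w * K' \<le> \<epsilon> * \<phi> w * C"
        using \<eta>(1,2)[of u] \<phi>nn[of w] by (intro mult_mono mult_right_mono) (auto simp: K'_def intro: mult_nonneg_nonneg order_trans)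
      then show ?thesis using True by (simp add: B_def mult_ac)
    next
      case False
      then have zero: "\<eta> u * \<phi> w * K' = 0" using \<eta>(3)[of u] \<phi>supp[of w] by auto
      have "0 \<le> \<epsilon>" using \<eta>(1,2) order_trans by blast
      then have "0 \<le> C * \<epsilon> * (B u * \<phi> w)" using C \<phi>nn[of w] by (simp add: B_def)
      then show ?thesis by (simp only: zero)
    qed
    have loss: "\<kappa> * \<delta> * (\<phi> u * d w) \<le> p w * \<phi> u * (K - K')" if "(u, w) = (x, y) \<or> (u, w) = (y, x)" for u w
    proof (cases "u \<in> ball c r \<and> w \<in> ball z r")
      case True
      have KR: "frac_kernel s (u - w) = K" "frac_kernel s (u - ?R w) = K'"
        using that frac_kernel_commute[of s y x] frac_kernel_commute[of s y "?R x"] frac_kernel_reflect_simps(1)[OF e, of s \<mu> x y]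
        by (auto simp: K_def K'_def)
      have "w \<notin> ball c r" using True disj by auto
      then have "p w = v w" using \<eta>(3)[of w] vz[of w] True nn[of w] by (auto simp: p_def half_pos_def)
      then have "\<delta> \<le> p w" using vz[of w] True by auto
      moreover have "\<kappa> \<le> K - K'" using \<kappa>_bd[of u w] True KR by simp
      ultimately have "\<kappa> * (\<delta> * \<phi> u) \<le> (K - K') * (p w * \<phi> u)"
        using \<kappa> \<delta> \<phi>nn[of u] by (intro mult_mono mult_right_mono) (auto intro: mult_nonneg_nonneg)
      then show ?thesis using True by (simp add: d_def mult_ac)
    next
      case False
      have "0 \<le> p w * \<phi> u * (K - K')"
      proof (cases "x = y")
        case True
        then have "u = w" using that by auto
        then have "p w * \<phi> u = 0" by (auto simp: p_def \<phi>_def half_pos_def max_def)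
        then show ?thesis by (simp only: mult_zero_left order_refl)
      next
        case False
        then show ?thesis using frac_kernel_reflect_le[OF s e x y] \<phi>nn[of u]
          by (simp add: K_def K'_def p_def half_pos_nonneg)
      qed
      moreover have zero: "\<phi> u * d w = 0" using False \<phi>supp[of u] by (auto simp: d_def)
      ultimately show ?thesis by (simp only: zero mult_zero_right)
    qed
    have "0 \<le> reflect_sum ?R (interaction s \<phi> \<phi>) x y"
      by (simp add: reflect_sum_def interaction_self_nonneg)
    then show "reflect_sum ?R (interaction s v \<phi>) x y \<le> reflect_sum ?R G x y"
      using reflect_sum_interaction_le[where v = v and \<eta> = \<eta>, OF s e anti \<eta>0 x y, folded \<phi>_def p_def K_def K'_def]
        gain[of x y] gain[of y x] loss[of x y] loss[of y x]
      unfolding RSG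
      by (simp add: distrib_left distrib_right mult.commute[of "B y" "\<phi> x"] mult.commute[of "\<phi> y" "d x"])
  qed
  ultimately show ?thesis by (simp add: energy_def mult_ac)
qed

text \<open>A positive value anywhere in the half-space, even far from \<open>D\<close>, lifts \<open>v\<close> off \<open>0\<close> at every point of
  \<open>D\<close>: the kernel difference between \<open>c\<close> and \<open>z\<close> is bounded below by a positive \<open>\<kappa>\<close>, and the barrier is
  chosen so small that this gain outweighs its own energy.\<close>

lemma antisymmetric_strong_maximum_principle:
  fixes v :: "real^'n::finite \<Rightarrow> real"
  assumes s: "0 < s" "s < 1" and e: "norm e = 1"
    and v: "continuous_on UNIV v" "finite_energy s v"
    and anti: "\<And>x. v (reflect e \<mu> x) = - v x" and nn: "\<And>x. x \<bullet> e < \<mu> \<Longrightarrow> 0 \<le> v x"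
    and D: "open D" "\<And>x. x \<in> D \<Longrightarrow> x \<bullet> e < \<mu>" and c: "c \<in> D"
    and z: "z \<bullet> e < \<mu>" "0 < v z" and L: "0 \<le> L"
    and super: "supersolution s L D v"
  shows "0 < v c"
proof (cases "z = c")
  case True
  then show ?thesis using z by simp
next
  case False
  obtain r \<kappa> C where r: "0 < r" "r \<le> 1" and \<kappa>: "0 < \<kappa>" and C: "0 \<le> C" and BD: "ball c r \<subseteq> D"
    and disj: "ball c r \<inter> ball z r = {}"
    and vz: "\<And>y. y \<in> ball z r \<Longrightarrow> y \<bullet> e < \<mu> \<and> v z / 2 < v y"
    and C_bd: "\<And>x y. x \<in> ball c r \<Longrightarrow> y \<in> ball c r \<Longrightarrow> frac_kernel s (x - reflect e \<mu> y) \<le> C"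
    and \<kappa>_bd: "\<And>x y. x \<in> ball c r \<Longrightarrow> y \<in> ball z r \<Longrightarrow> \<kappa> \<le> frac_kernel s (x - y) - frac_kernel s (x - reflect e \<mu> y)"
    using antisymmetric_barrier_radius[OF s(1) e v(1) D c z False] by blast
  define V where "V = unit_ball_vol (real CARD('n)) * r ^ CARD('n)"
  define J where "J = 2 * (\<integral>z. min 1 ((norm (z :: real^'n))\<^sup>2) * frac_kernel s z \<partial>lborel)"
  define T where "T = J + 2 * C * V + L"
  define \<delta> where "\<delta> = v z / 2"
  have V: "0 < V" using r by (simp add: V_def)
  have J: "0 \<le> J" by (auto simp: J_def intro!: Bochner_Integration.integral_nonneg)
  have T: "0 \<le> T" using J C V L by (simp add: T_def)
  have \<delta>: "0 < \<delta>" using z by (simp add: \<delta>_def)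
  \<comment> \<open>small enough that the total loss \<open>\<epsilon> * T\<close> stays below the gain \<open>2 * \<kappa> * \<delta> * V\<close>\<close>
  define \<epsilon> where "\<epsilon> = \<kappa> * \<delta> * V / (T + 1)"
  have \<epsilon>: "0 < \<epsilon>" using \<kappa> \<delta> V T by (simp add: \<epsilon>_def)
  have \<epsilon>T: "\<epsilon> * T < 2 * \<kappa> * \<delta> * V"
  proof -
    have "\<epsilon> * T \<le> \<epsilon> * (T + 1)" using \<epsilon> by simp
    also have "\<dots> = \<kappa> * \<delta> * V" using T by (simp add: \<epsilon>_def)
    also have "\<dots> < 2 * (\<kappa> * \<delta> * V)" using \<kappa> \<delta> V by simp
    finally show ?thesis by (simp add: mult.assoc)
  qed
  define \<eta> where "\<eta> = (\<lambda>x. \<epsilon> * bump c r x)"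
  have r2: "r\<^sup>2 \<le> 1" using r by (simp add: power_le_one)
  have \<eta>: "0 \<le> \<eta> x" "\<eta> x \<le> \<epsilon>" for x
    using bump_bounds[OF r(1), of c x] \<epsilon> r2 by (auto simp: \<eta>_def intro!: mult_left_le)
  have \<eta>0: "\<eta> x = 0" if "x \<notin> ball c r" for x using bump_outside[OF r(1) that] by (simp add: \<eta>_def)
  have half: "x \<bullet> e < \<mu>" if "x \<in> ball c r" for x using that BD D(2) by auto
  have \<eta>h: "\<eta> x = 0" if "\<mu> \<le> x \<bullet> e" for x using half[of x] \<eta>0[of x] that by force
  have "finite_energy s (bump c r)"
    using bump_energy_le(1)[OF s r, of "\<lambda>x. 0" c] by (simp add: finite_energy_def interaction_def case_prod_unfold)
  then have \<eta>f: "finite_energy s \<eta>" unfolding \<eta>_def by (rule finite_energy_cmult)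
  define \<phi> where "\<phi> = half_pos e \<mu> (\<lambda>x. \<eta> x - v x)"
  have \<phi>f: "finite_energy s \<phi>"
    unfolding \<phi>_def by (rule half_pos_finite_energy[OF s(1) e v(2) \<eta>f anti \<eta>h])
  have \<phi>c: "continuous_on UNIV \<phi>"
    unfolding \<phi>_def
  proof (rule half_pos_continuous)
    show "continuous_on UNIV (\<lambda>x. \<eta> x - v x)"
      unfolding \<eta>_def by (intro continuous_intros continuous_on_bump v)
    show "\<eta> x - v x = 0" if "x \<bullet> e = \<mu>" for x
      using antisymmetric_on_hyperplane[of v e \<mu> x, OF anti that] \<eta>h[of x] that by simp
  qed
  have \<phi>nn: "0 \<le> \<phi> x" for x by (simp add: \<phi>_def half_pos_nonneg)
  have \<phi>supp: "\<phi> x = 0" if "x \<notin> ball c r" for x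
    using nn[of x] \<eta>0[OF that] by (auto simp: \<phi>_def half_pos_def)
  have \<phi>le: "\<phi> x \<le> \<epsilon>" for x
    using nn[of x] \<eta>[of x] \<epsilon> by (auto simp: \<phi>_def half_pos_def)
  have [measurable]: "\<phi> \<in> borel_measurable borel" "v \<in> borel_measurable borel"
    using \<phi>f v(2) by (auto simp: finite_energy_def)
  have \<phi>int: "integrable lborel \<phi>"
    by (rule integrable_lborel_compact_support[where M = \<epsilon> and D = "ball c r"]) (use \<phi>nn \<phi>le \<phi>supp in auto)
  have v\<phi>: "\<bar>v x\<bar> * \<phi> x \<le> \<epsilon> * \<phi> x" for x
  proof (cases "\<phi> x = 0")
    case False
    then have "x \<bullet> e < \<mu>" "v x < \<eta> x" by (auto simp: \<phi>_def half_pos_def max_def split: if_splits)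
    then show ?thesis using nn[of x] \<eta>(2)[of x] \<phi>nn[of x] by (auto intro: mult_right_mono)
  qed simp
  have v\<phi>int: "integrable lborel (\<lambda>x. \<bar>v x\<bar> * \<phi> x)"
    by (rule Bochner_Integration.integrable_bound[of _ "\<lambda>x. \<epsilon> * \<phi> x"])
       (use \<phi>int v\<phi> \<phi>nn \<epsilon> in \<open>auto intro!: AE_I2 simp: abs_mult abs_of_nonneg\<close>)
  let ?I = "integral\<^sup>L lborel \<phi>"
  have "(\<integral>x. \<bar>v x\<bar> * \<phi> x \<partial>lborel) \<le> (\<integral>x. \<epsilon> * \<phi> x \<partial>lborel)"
    using v\<phi>int \<phi>int v\<phi> by (intro integral_mono) auto
  then have "L * (\<integral>x. \<bar>v x\<bar> * \<phi> x \<partial>lborel) \<le> L * (\<epsilon> * ?I)"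
    using L by (intro mult_left_mono) auto
  moreover have "\<phi> x = 0" if "x \<notin> D" for x using \<phi>supp[of x] BD that by blast
  then have "- L * (\<integral>x. \<bar>v x\<bar> * \<phi> x \<partial>lborel) \<le> energy s v \<phi>"
    by (rule supersolutionD[OF super \<phi>f \<phi>nn \<phi>le])
  moreover have "energy s v \<phi> \<le> energy s \<eta> \<phi> + 2 * C * \<epsilon> * V * ?I - 2 * \<kappa> * \<delta> * V * ?I"
    unfolding \<phi>_def V_def
    by (rule antisymmetric_barrier_energy_le[OF s(1) e v(2) \<eta>f anti nn r(1) half disj \<eta> \<eta>0 _ _ _ C C_bd \<kappa>_bd])
       (use vz \<delta> \<kappa> in \<open>auto simp: \<delta>_def less_imp_le\<close>)
  moreover have "energy s \<eta> \<phi> \<le> \<epsilon> * (J * ?I)"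
    using bump_energy_le(2)[OF s r \<phi>f \<phi>int \<phi>nn \<phi>supp] \<epsilon>
    unfolding \<eta>_def energy_cmult_left J_def by (intro mult_left_mono) auto
  ultimately have "2 * \<kappa> * \<delta> * V * ?I \<le> \<epsilon> * T * ?I"
    unfolding T_def by (simp add: algebra_simps)
  then have "(2 * \<kappa> * \<delta> * V - \<epsilon> * T) * ?I \<le> 0" by (simp add: algebra_simps)
  then have "?I \<le> 0" using \<epsilon>T by (simp add: mult_le_0_iff)
  then have "\<phi> c = 0"
    by (rule continuous_nonneg_integral_nonpos_imp_zero[OF \<phi>c \<phi>nn \<phi>int])
  moreover have "c \<bullet> e < \<mu>" using c D by auto
  ultimately have "\<eta> c \<le> v c" by (auto simp: \<phi>_def half_pos_def max_def split: if_splits)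
  moreover have "0 < \<eta> c" using \<epsilon> r by (simp add: \<eta>_def bump_centre)
  ultimately show ?thesis by simp
qed

section \<open>Moving the plane\<close>

lemma AE_not_on_hyperplane:
  fixes e :: "'a::euclidean_space"
  assumes "e \<noteq> 0"
  shows "AE x in lborel. x \<bullet> e \<noteq> \<mu>"
proof -
  have "negligible {x. e \<bullet> x = \<mu>}" using assms by (intro negligible_hyperplane) simp
  then have "{x. e \<bullet> x = \<mu>} \<in> null_sets lebesgue" by (simp add: negligible_iff_null_sets)
  moreover have "{x. e \<bullet> x = \<mu>} \<in> sets borel" by (intro borel_closed closed_hyperplane)
  ultimately have "{x. e \<bullet> x = \<mu>} \<in> null_sets lborel" by (simp add: null_sets_completion_iff)
  then have "AE x in lborel. x \<notin> {x. e \<bullet> x = \<mu>}" by (rule AE_not_in)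
  then show ?thesis by (simp add: inner_commute)
qed

lemma integrable_lebesgue_mult_bounded:
  fixes F \<phi> :: "'a::euclidean_space \<Rightarrow> real"
  assumes F: "integrable lebesgue F" and \<phi>: "\<phi> \<in> borel_measurable borel" "\<And>x. \<bar>\<phi> x\<bar> \<le> M"
  shows "integrable lebesgue (\<lambda>x. F x * \<phi> x)"
proof (rule Bochner_Integration.integrable_bound)
  show "integrable lebesgue (\<lambda>x. M * F x)" using F by simp
  have [measurable]: "\<phi> \<in> borel_measurable lebesgue" "F \<in> borel_measurable lebesgue"
    using \<phi>(1) F by (auto intro: measurable_completion)
  show "(\<lambda>x. F x * \<phi> x) \<in> borel_measurable lebesgue" by measurable
  have M: "0 \<le> M" using \<phi>(2)[of undefined] by linarith
  show "AE x in lebesgue. norm (F x * \<phi> x) \<le> norm (M * F x)"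
    using \<phi>(2) M by (auto simp: abs_mult mult.commute[of M] intro!: AE_I2 mult_left_mono)
qed

text \<open>A continuous positive solution together with one direction \<open>e\<close> in which the planes can be moved up to
  the symmetry plane at level \<open>m\<close>; \<open>a\<close> is the normalising constant of the bilinear form. The
  assumptions are invariant under replacing \<open>u\<close> by its mirror image at level \<open>m\<close>, which is what
  yields symmetry in the end.\<close>

locale moving_planes =
  fixes s :: real and a :: real and \<Omega> :: "(real^'n::finite) set"
    and f :: "real^'n \<Rightarrow> real \<Rightarrow> real" and u :: "real^'n \<Rightarrow> real"
    and e :: "real^'n" and m :: real
  assumes s: "0 < s" "s < 1" and a: "0 < a" and e: "norm e = 1"
    and open_\<Omega>: "open \<Omega>" and bounded_\<Omega>: "bounded \<Omega>"
    and u_cont: "continuous_on UNIV u" and u_energy: "finite_energy s u"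
    and u_pos: "\<And>x. x \<in> \<Omega> \<Longrightarrow> 0 < u x" and u_out: "\<And>x. x \<notin> \<Omega> \<Longrightarrow> u x = 0"
    and source_int: "integrable lebesgue (\<lambda>x. indicator \<Omega> x * f x (u x))"
    and weak: "\<And>\<phi> M. finite_energy s \<phi> \<Longrightarrow> (\<And>x. \<bar>\<phi> x\<bar> \<le> M) \<Longrightarrow> (\<And>x. x \<notin> \<Omega> \<Longrightarrow> \<phi> x = 0) \<Longrightarrow>
        a * energy s u \<phi> = (\<integral>x. indicator \<Omega> x * f x (u x) * \<phi> x \<partial>lebesgue)"
    and lip: "loc_Lipschitz_snd \<Omega> f"
    and mono: "reflection_monotone \<Omega> f e m"
    and cap: "\<And>\<mu> x. \<mu> < m \<Longrightarrow> x \<in> \<Omega> \<Longrightarrow> x \<bullet> e < \<mu> \<Longrightarrow> reflect e \<mu> x \<in> \<Omega>"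
    and sym: "\<And>x. x \<in> \<Omega> \<Longrightarrow> reflect e m x \<in> \<Omega>"
begin

definition w :: "real \<Rightarrow> real^'n \<Rightarrow> real" where
  "w \<mu> x = u (reflect e \<mu> x) - u x"

lemma e_ne_0: "e \<noteq> 0" using e by auto

lemma u_nonneg: "0 \<le> u x"
  using u_pos[of x] u_out[of x] by (cases "x \<in> \<Omega>") auto

lemma u_bounded: obtains M where "0 < M" "\<And>x. u x \<le> M"
proof -
  have "compact (closure \<Omega>)" using bounded_\<Omega> by simp
  then have "bounded (u ` closure \<Omega>)"
    by (intro compact_imp_bounded compact_continuous_image continuous_on_subset[OF u_cont]) auto
  then obtain B where B: "\<And>x. x \<in> closure \<Omega> \<Longrightarrow> \<bar>u x\<bar> \<le> B" by (auto simp: bounded_iff)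
  show thesis
  proof (rule that[of "max 1 B"])
    show "u x \<le> max 1 B" for x
      using B[of x] u_out[of x] closure_subset[of \<Omega>] by (cases "x \<in> \<Omega>") force+
  qed simp
qed

lemma w_cont: "continuous_on UNIV (w \<mu>)"
  unfolding w_def
  by (intro continuous_intros u_cont continuous_on_compose2[OF u_cont]) auto

lemma w_cont_level: "isCont (\<lambda>\<mu>. w \<mu> x) \<mu>"
proof -
  have "continuous_on UNIV (\<lambda>\<mu>. w \<mu> x)"
    unfolding w_def
    by (intro continuous_intros continuous_on_compose2[OF u_cont]) auto
  then show ?thesis by (simp add: continuous_on_eq_continuous_at)
qed

lemma w_antisym: "w \<mu> (reflect e \<mu> x) = - w \<mu> x"
  using e by (simp add: w_def)

lemma w_energy: "finite_energy s (w \<mu>)"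
  unfolding w_def
  using finite_energy_diff[OF finite_energy_reflect[OF e] u_energy] u_energy finite_energy_measurable
  by blast

lemma w_abs_le: "(\<And>x. u x \<le> M) \<Longrightarrow> \<bar>w \<mu> x\<bar> \<le> M"
  using u_nonneg[of x] u_nonneg[of "reflect e \<mu> x"] by (simp add: w_def abs_le_iff) (smt (verit))

definition mirror_above :: "real \<Rightarrow> bool" where
  "mirror_above \<mu> \<longleftrightarrow> (\<forall>x. x \<bullet> e < \<mu> \<longrightarrow> 0 \<le> w \<mu> x)"

text \<open>Subtract the equation for \<open>u\<close>, tested with \<open>\<phi>\<close>, from the one tested with \<open>\<phi> \<circ> R\<close>; the latter is
  admissible because \<open>R\<close> maps the cap into \<open>\<Omega>\<close>. By the monotonicity of \<open>f\<close> under reflection, the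
  difference of the sources is at least \<open>f x (u (R x)) - f x (u x)\<close>, and the Lipschitz condition bounds
  this from below.\<close>

lemma w_supersolution:
  obtains L where "0 \<le> L"
    "\<And>\<mu>. \<mu> < m \<Longrightarrow> supersolution s L {x \<in> \<Omega>. x \<bullet> e < \<mu>} (w \<mu>)"
proof -
  define F where "F x = indicator \<Omega> x * f x (u x)" for x
  have F_int: "integrable lebesgue F" using source_int by (simp add: F_def[abs_def])
  have F_eq: "F x = f x (u x)" if "x \<in> \<Omega>" for x using that by (simp add: F_def)
  note weak = weak[folded F_def]
  obtain M0 where M0: "0 < M0" "\<And>x. u x \<le> M0" using u_bounded by blast
  obtain L0 where L0: "\<And>x t1 t2. x \<in> \<Omega> \<Longrightarrow> t1 \<in> {0..M0} \<Longrightarrow> t2 \<in> {0..M0} \<Longrightarrow> \<bar>f x t1 - f x t2\<bar> \<le> L0 * \<bar>t1 - t2\<bar>"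
    using lip M0(1) unfolding loc_Lipschitz_snd_def by meson
  define L where "L = max 0 L0"
  have L: "\<bar>f x t1 - f x t2\<bar> \<le> L * \<bar>t1 - t2\<bar>" if "x \<in> \<Omega>" "t1 \<in> {0..M0}" "t2 \<in> {0..M0}" for x t1 t2
    using L0[OF that] mult_right_mono[of L0 L "\<bar>t1 - t2\<bar>"] by (simp add: L_def)
  show thesis
  proof (rule that[of "L / a"])
    show "0 \<le> L / a" using a by (simp add: L_def)
    fix \<mu> assume \<mu>: "\<mu> < m"
    show "supersolution s (L / a) {x \<in> \<Omega>. x \<bullet> e < \<mu>} (w \<mu>)"
      unfolding supersolution_def
    proof (intro allI impI)
      fix \<phi> M
      assume \<phi>: "finite_energy s \<phi>" and bounds: "\<forall>x. 0 \<le> \<phi> x \<and> \<phi> x \<le> M"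
        and supp: "\<forall>x. x \<notin> {x \<in> \<Omega>. x \<bullet> e < \<mu>} \<longrightarrow> \<phi> x = 0"
      have nn: "0 \<le> \<phi> x" and M: "\<phi> x \<le> M" for x using bounds by auto
      let ?R = "reflect e \<mu>"
      have \<phi>m [measurable]: "\<phi> \<in> borel_measurable borel" using \<phi> by (rule finite_energy_measurable)
      have um: "u \<in> borel_measurable borel" using u_energy by (rule finite_energy_measurable)
      have wm [measurable]: "w \<mu> \<in> borel_measurable borel" using w_energy by (rule finite_energy_measurable)
      have \<phi>abs: "\<bar>\<phi> x\<bar> \<le> M" for x using nn M by simp
      have \<phi>R: "finite_energy s (\<lambda>x. \<phi> (?R x))" by (rule finite_energy_reflect[OF e \<phi>m \<phi>m \<phi>])
      have "\<phi> (?R x) = 0" if "x \<notin> \<Omega>" for x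
        using supp[rule_format, of "?R x"] cap[OF \<mu>, of "?R x"] that e by auto
      then have 1: "a * energy s u (\<lambda>x. \<phi> (?R x)) = (\<integral>x. F x * \<phi> (?R x) \<partial>lebesgue)"
        by (intro weak[OF \<phi>R \<phi>abs]) auto
      have 2: "a * energy s u \<phi> = (\<integral>x. F x * \<phi> x \<partial>lebesgue)"
        using supp by (intro weak[OF \<phi> \<phi>abs]) auto
      have "energy s (\<lambda>x. u (?R x)) (\<lambda>x. \<phi> (?R (?R x))) = energy s u (\<lambda>x. \<phi> (?R x))"
        by (rule energy_reflect[OF e um]) (rule finite_energy_measurable[OF \<phi>R])
      then have 3: "energy s (w \<mu>) \<phi> = energy s u (\<lambda>x. \<phi> (?R x)) - energy s u \<phi>"
        unfolding w_def using energy_diff_left[OF finite_energy_reflect[OF e um um u_energy] u_energy \<phi>] e by simp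
      have G: "integrable lebesgue (\<lambda>x. F x * \<phi> (?R x))" "integrable lebesgue (\<lambda>x. F x * \<phi> x)"
        using integrable_lebesgue_mult_bounded[OF F_int _ \<phi>abs] finite_energy_measurable[OF \<phi>R]
          integrable_lebesgue_mult_bounded[OF F_int finite_energy_measurable[OF \<phi>R], of M] \<phi>abs \<phi>m by auto
      have GR: "integrable lebesgue (\<lambda>x. F (?R x) * \<phi> x)"
        "(\<integral>x. F (?R x) * \<phi> x \<partial>lebesgue) = (\<integral>x. F x * \<phi> (?R x) \<partial>lebesgue)"
        using lebesgue_reflect[OF e G(1), of \<mu>] e by auto
      have aE: "a * energy s (w \<mu>) \<phi> = (\<integral>x. (F (?R x) - F x) * \<phi> x \<partial>lebesgue)"
        using G GR 1 2 3 by (simp add: left_diff_distrib right_diff_distrib)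
      have w\<phi>: "integrable lborel (\<lambda>x. \<bar>w \<mu> x\<bar> * \<phi> x)"
      proof (rule integrable_lborel_compact_support[where M = "M0 * M" and D = \<Omega>])
        show "\<bar>\<bar>w \<mu> x\<bar> * \<phi> x\<bar> \<le> M0 * M" for x
          using w_abs_le[OF M0(2), of \<mu> x] nn[of x] M[of x] M0(1) by (auto simp: abs_mult intro!: mult_mono)
      qed (use bounded_\<Omega> supp in auto)
      have pointwise: "- L * (\<bar>w \<mu> x\<bar> * \<phi> x) \<le> (F (?R x) - F x) * \<phi> x" for x
      proof (cases "x \<in> \<Omega> \<and> x \<bullet> e < \<mu>")
        case False
        then show ?thesis using supp by simp
      next
        case True
        have Rx: "?R x \<in> \<Omega>" using cap[OF \<mu>] True by simp
        have "f x (u (?R x)) \<le> f (?R x) (u (?R x))"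
          using mono \<mu> True u_nonneg[of "?R x"] unfolding reflection_monotone_def by blast
        moreover have "\<bar>f x (u (?R x)) - f x (u x)\<bar> \<le> L * \<bar>w \<mu> x\<bar>"
          unfolding w_def using L[of x "u (?R x)" "u x"] True u_nonneg M0(2) by auto
        ultimately have "- (L * \<bar>w \<mu> x\<bar>) \<le> F (?R x) - F x"
          using F_eq[OF Rx] F_eq[of x] True by auto
        then have "- (L * \<bar>w \<mu> x\<bar>) * \<phi> x \<le> (F (?R x) - F x) * \<phi> x"
          by (rule mult_right_mono) (rule nn)
        then show ?thesis by (simp add: mult.assoc)
      qed
      have "- L * (\<integral>x. \<bar>w \<mu> x\<bar> * \<phi> x \<partial>lborel) = (\<integral>x. - L * (\<bar>w \<mu> x\<bar> * \<phi> x) \<partial>lebesgue)"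
        using integral_completion[of "\<lambda>x. \<bar>w \<mu> x\<bar> * \<phi> x" lborel] by simp
      also have "\<dots> \<le> (\<integral>x. (F (?R x) - F x) * \<phi> x \<partial>lebesgue)"
      proof (rule integral_mono[OF _ _ pointwise])
        have "integrable lebesgue (\<lambda>x. \<bar>w \<mu> x\<bar> * \<phi> x)" using w\<phi> by (simp add: integrable_completion)
        then show "integrable lebesgue (\<lambda>x. - L * (\<bar>w \<mu> x\<bar> * \<phi> x))" by (rule integrable_mult_right)
        show "integrable lebesgue (\<lambda>x. (F (?R x) - F x) * \<phi> x)"
          using G GR by (simp add: left_diff_distrib)
      qed
      finally show "- (L / a) * (\<integral>x. \<bar>w \<mu> x\<bar> * \<phi> x \<partial>lborel) \<le> energy s (w \<mu>) \<phi>"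
        using aE a by (simp add: field_simps)
    qed
  qed
qed

text \<open>The strong maximum principle needs a point \<open>z\<close> with \<open>w \<mu> z > 0\<close>. As \<open>\<mu> < m\<close>, the mirror image of \<open>\<Omega>\<close>
  at level \<open>\<mu>\<close> sticks out of \<open>\<Omega>\<close> on the lower side: a point \<open>y\<close> of \<open>\<Omega>\<close> close to its upper end is
  mapped to a \<open>z\<close> below all of \<open>\<Omega>\<close>, so that \<open>w \<mu> z = u y > 0\<close>.\<close>

lemma mirror_above_strict:
  assumes \<mu>: "\<mu> < m" and mirror_above: "mirror_above \<mu>" and x: "x \<in> \<Omega>" "x \<bullet> e < \<mu>"
  shows "0 < w \<mu> x"
proof -
  obtain B where B: "\<And>y. y \<in> \<Omega> \<Longrightarrow> norm y \<le> B"
    using bounded_\<Omega> by (auto simp: bounded_iff)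
  have bdd: "bdd_below ((\<lambda>y. y \<bullet> e) ` \<Omega>)"
  proof (rule bdd_belowI2)
    fix y assume "y \<in> \<Omega>"
    then show "- B \<le> y \<bullet> e"
      using Cauchy_Schwarz_ineq2[of y e] B[of y] e by simp
  qed
  define I where "I = Inf ((\<lambda>y. y \<bullet> e) ` \<Omega>)"
  have I: "I \<le> y \<bullet> e" if "y \<in> \<Omega>" for y unfolding I_def using bdd that by (intro cInf_lower) auto
  have "Inf ((\<lambda>y. y \<bullet> e) ` \<Omega>) < I + 2 * (m - \<mu>)" using \<mu> by (simp add: I_def)
  then obtain x1 where x1: "x1 \<in> \<Omega>" "x1 \<bullet> e < I + 2 * (m - \<mu>)"
    using cInf_lessD[of "(\<lambda>y. y \<bullet> e) ` \<Omega>"] x(1) by blast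
  define y where "y = reflect e m x1"
  define z where "z = reflect e \<mu> y"
  have y: "y \<in> \<Omega>" using sym[OF x1(1)] by (simp add: y_def)
  have "z \<bullet> e < I" using x1(2) by (simp add: z_def y_def reflect_inner[OF e])
  then have z: "z \<notin> \<Omega>" "z \<bullet> e < \<mu>" using I[of z] I[OF x(1)] x(2) by auto
  have wz: "0 < w \<mu> z" using u_pos[OF y] u_out[OF z(1)] e by (simp add: w_def z_def)
  obtain L where L: "0 \<le> L" "\<And>\<mu>. \<mu> < m \<Longrightarrow> supersolution s L {x \<in> \<Omega>. x \<bullet> e < \<mu>} (w \<mu>)"
    using w_supersolution by blast
  have nn: "0 \<le> w \<mu> x" if "x \<bullet> e < \<mu>" for x using mirror_above that by (simp add: mirror_above_def)
  let ?D = "{x \<in> \<Omega>. x \<bullet> e < \<mu>}"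
  have D: "open ?D"
    using open_\<Omega> open_halfspace_lt[of e \<mu>] by (simp add: Collect_conj_eq open_Int inner_commute)
  show ?thesis
    by (rule antisymmetric_strong_maximum_principle[OF s e w_cont w_energy w_antisym nn D _ _ z(2) wz L(1) L(2)[OF \<mu>]])
       (use x in auto)
qed

lemma mirror_above_of_small_volume:
  obtains \<delta> where "0 < \<delta>"
    "\<And>\<mu>. \<mu> < m \<Longrightarrow> emeasure lborel {x \<in> \<Omega>. x \<bullet> e < \<mu> \<and> w \<mu> x < 0} \<le> ennreal \<delta> \<Longrightarrow> mirror_above \<mu>"
proof -
  obtain M where M: "0 < M" "\<And>x. u x \<le> M" using u_bounded by blast
  obtain L where L: "0 \<le> L" "\<And>\<mu>. \<mu> < m \<Longrightarrow> supersolution s L {x \<in> \<Omega>. x \<bullet> e < \<mu>} (w \<mu>)"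
    using w_supersolution by blast
  obtain \<delta> where \<delta>: "0 < \<delta>" and small: "\<And>(e :: real^'n) \<mu> v D M x. norm e = 1 \<Longrightarrow> continuous_on UNIV v \<Longrightarrow>
       finite_energy s v \<Longrightarrow> (\<And>x. v (reflect e \<mu> x) = - v x) \<Longrightarrow> (\<And>x. \<bar>v x\<bar> \<le> M) \<Longrightarrow> supersolution s L D v \<Longrightarrow>
       D \<in> sets borel \<Longrightarrow> bounded D \<Longrightarrow> (\<And>x. x \<bullet> e < \<mu> \<Longrightarrow> x \<notin> D \<Longrightarrow> 0 \<le> v x) \<Longrightarrow>
       emeasure lborel {x \<in> D. v x < 0} \<le> ennreal \<delta> \<Longrightarrow> x \<bullet> e < \<mu> \<Longrightarrow> 0 \<le> v x"
    by (rule small_volume_maximum_principle[OF s(1) L(1), where 'n = 'n]) blast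
  show thesis
  proof (rule that[OF \<delta>])
    fix \<mu> assume \<mu>: "\<mu> < m" and vol: "emeasure lborel {x \<in> \<Omega>. x \<bullet> e < \<mu> \<and> w \<mu> x < 0} \<le> ennreal \<delta>"
    let ?D = "{x \<in> \<Omega>. x \<bullet> e < \<mu>}"
    have [measurable]: "\<Omega> \<in> sets borel" using open_\<Omega> by simp
    have D: "?D \<in> sets borel" by measurable
    have bD: "bounded ?D" by (rule bounded_subset[OF bounded_\<Omega>]) auto
    have out: "0 \<le> w \<mu> x" if "x \<bullet> e < \<mu>" "x \<notin> ?D" for x
      using that u_out[of x] u_nonneg[of "reflect e \<mu> x"] by (auto simp: w_def)
    have "emeasure lborel {x \<in> ?D. w \<mu> x < 0} \<le> ennreal \<delta>"
      using vol by (simp add: conj_assoc)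
    then show "mirror_above \<mu>"
      unfolding mirror_above_def
      using small[OF e w_cont w_energy w_antisym w_abs_le[OF M(2)] L(2)[OF \<mu>] D bD out] by blast
  qed
qed

text \<open>Off the hyperplane \<open>x \<bullet> e = \<mu>\<close>, every point eventually leaves the sets where \<open>w (\<nu> n) < 0\<close>: by
  \<open>mirror_above_strict\<close> if it lies below, and because the level drops under it if it lies above. Dominated
  convergence makes the measure of these sets tend to \<open>0\<close>.\<close>

lemma mirror_above_right_open:
  assumes \<mu>: "mirror_above \<mu>" and lim: "\<nu> \<longlonglongrightarrow> \<mu>" and \<nu>: "\<And>n :: nat. \<mu> \<le> \<nu> n" "\<And>n. \<nu> n < m"
  shows "\<exists>n. mirror_above (\<nu> n)"
proof -
  obtain \<delta> where \<delta>: "0 < \<delta>"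
    "\<And>\<mu>. \<mu> < m \<Longrightarrow> emeasure lborel {x \<in> \<Omega>. x \<bullet> e < \<mu> \<and> w \<mu> x < 0} \<le> ennreal \<delta> \<Longrightarrow> mirror_above \<mu>"
    using mirror_above_of_small_volume by blast
  define A where "A n = {x \<in> \<Omega>. x \<bullet> e < \<nu> n \<and> w (\<nu> n) x < 0}" for n
  have [measurable]: "w \<mu> \<in> borel_measurable borel" for \<mu> using w_energy by (rule finite_energy_measurable)
  have [measurable]: "\<Omega> \<in> sets borel" using open_\<Omega> by simp
  have A [measurable]: "A n \<in> sets borel" for n unfolding A_def by measurable
  have fin\<Omega>: "emeasure lborel \<Omega> < \<infinity>" by (rule emeasure_bounded_finite[OF bounded_\<Omega>])
  have finA: "emeasure lborel (A n) < \<infinity>" for n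
    using emeasure_mono[of "A n" \<Omega> lborel] fin\<Omega> by (auto simp: A_def intro: le_less_trans)
  have \<mu>m: "\<mu> < m" using \<nu>(1)[of 0] \<nu>(2)[of 0] by linarith
  have "AE x in lborel. (\<lambda>n. indicat_real (A n) x) \<longlonglongrightarrow> 0"
  proof (rule AE_mp[OF AE_not_on_hyperplane[OF e_ne_0, of \<mu>]], intro AE_I2 impI)
    fix x assume x: "x \<bullet> e \<noteq> \<mu>"
    have "eventually (\<lambda>n. x \<notin> A n) sequentially"
    proof (cases "x \<in> \<Omega> \<and> x \<bullet> e < \<mu>")
      case True
      have "(\<lambda>n. w (\<nu> n) x) \<longlonglongrightarrow> w \<mu> x"
        by (rule isCont_tendsto_compose[OF w_cont_level lim])
      then have "eventually (\<lambda>n. 0 < w (\<nu> n) x) sequentially"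
        by (rule order_tendstoD) (use mirror_above_strict[OF \<mu>m \<mu>] True in auto)
      then show ?thesis by eventually_elim (auto simp: A_def)
    next
      case False
      show ?thesis
      proof (cases "x \<in> \<Omega>")
        case True
        then have "\<mu> < x \<bullet> e" using False x by auto
        then have "eventually (\<lambda>n. \<nu> n < x \<bullet> e) sequentially" by (rule order_tendstoD[OF lim])
        then show ?thesis by eventually_elim (auto simp: A_def)
      qed (auto simp: A_def)
    qed
    then have "eventually (\<lambda>n. indicat_real (A n) x = 0) sequentially"
      by eventually_elim simp
    then show "(\<lambda>n. indicat_real (A n) x) \<longlonglongrightarrow> 0" by (rule tendsto_eventually)
  qed
  then have "(\<lambda>n. \<integral>x. indicat_real (A n) x \<partial>lborel) \<longlonglongrightarrow> (\<integral>x. 0 \<partial>(lborel :: (real^'n) measure))"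
  proof (rule integral_dominated_convergence[where w = "indicat_real \<Omega>", rotated 3])
    show "integrable lborel (indicat_real \<Omega>)" using fin\<Omega> by (intro integrable_real_indicator) auto
    show "AE x in lborel. norm (indicat_real (A n) x) \<le> indicat_real \<Omega> x" for n
      by (auto simp: A_def indicator_def)
  qed auto
  then have "(\<lambda>n. measure lborel (A n)) \<longlonglongrightarrow> 0" using finA by simp
  then have "eventually (\<lambda>n. measure lborel (A n) < \<delta>) sequentially"
    by (rule order_tendstoD) (rule \<delta>)
  then obtain n where n: "measure lborel (A n) < \<delta>"
    using eventually_happens by fastforce
  then have "emeasure lborel (A n) \<le> ennreal \<delta>"
    using finA[of n] by (simp add: emeasure_eq_ennreal_measure ennreal_leI)
  then show ?thesis using \<delta>(2)[OF \<nu>(2), of n] by (auto simp: A_def)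
qed

lemma mirror_above_left_closed:
  assumes "\<And>\<nu>. \<nu> < \<mu> \<Longrightarrow> mirror_above \<nu>"
  shows "mirror_above \<mu>"
  unfolding mirror_above_def
proof (intro allI impI)
  fix x assume x: "x \<bullet> e < \<mu>"
  have "((\<lambda>\<nu>. w \<nu> x) \<longlongrightarrow> w \<mu> x) (at_left \<mu>)"
    using w_cont_level[where x = x and \<mu> = \<mu>] by (simp add: isCont_def filterlim_at_split)
  moreover have "eventually (\<lambda>\<nu>. 0 \<le> w \<nu> x) (at_left \<mu>)"
    using x assms unfolding eventually_at_left[OF x] mirror_above_def by (intro exI[of _ "x \<bullet> e"]) auto
  ultimately show "0 \<le> w \<mu> x"
    by (rule tendsto_lowerbound) simp
qed

lemma mirror_above_all:
  assumes "\<mu> \<le> m"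
  shows "mirror_above \<mu>"
proof (rule ccontr)
  assume "\<not> mirror_above \<mu>"
  define B where "B = {\<mu>. \<mu> \<le> m \<and> \<not> mirror_above \<mu>}"
  have B_ne: "B \<noteq> {}" using assms \<open>\<not> mirror_above \<mu>\<close> by (auto simp: B_def)
  obtain C where C: "\<And>y. y \<in> \<Omega> \<Longrightarrow> norm y \<le> C"
    using bounded_\<Omega> by (auto simp: bounded_iff)
  have low: "mirror_above \<nu>" if "\<nu> \<le> - C" for \<nu>
    unfolding mirror_above_def
  proof (intro allI impI)
    fix x assume "x \<bullet> e < \<nu>"
    then have "x \<notin> \<Omega>" using C[of x] Cauchy_Schwarz_ineq2[of x e] e that by auto
    then show "0 \<le> w \<nu> x" using u_out u_nonneg by (simp add: w_def)
  qed
  have bdd: "bdd_below B"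
  proof (rule bdd_belowI)
    fix \<nu> assume "\<nu> \<in> B"
    then show "- C \<le> \<nu>" using low[of \<nu>] by (cases "\<nu> \<le> - C") (auto simp: B_def)
  qed
  define b where "b = Inf B"
  have bB: "b \<le> \<nu>" if "\<nu> \<in> B" for \<nu> unfolding b_def using that bdd by (rule cInf_lower)
  have bm: "b \<le> m" using B_ne bB by (force simp: B_def)
  have "mirror_above \<nu>" if "\<nu> < b" for \<nu> using bB[of \<nu>] that bm by (force simp: B_def)
  then have mirror_above_b: "mirror_above b" by (rule mirror_above_left_closed)
  have "b < m"
  proof (rule ccontr)
    assume "\<not> b < m"
    then have "\<nu> = b" if "\<nu> \<in> B" for \<nu> using bB[OF that] bm that by (auto simp: B_def)
    then show False using B_ne mirror_above_b by (auto simp: B_def)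
  qed
  have "\<exists>\<nu>\<in>B. \<nu> < min m (b + 1 / real (Suc n))" for n
    using cInf_lessD[OF B_ne, of "min m (b + 1 / real (Suc n))"] \<open>b < m\<close> by (auto simp: b_def)
  then obtain \<nu> where \<nu>: "\<And>n. \<nu> n \<in> B" "\<And>n. \<nu> n < min m (b + 1 / real (Suc n))" by metis
  have "\<nu> \<longlonglongrightarrow> b"
  proof (rule tendsto_sandwich[of "\<lambda>_. b" _ _ "\<lambda>n. b + 1 / real (Suc n)"])
    show "(\<lambda>n. b + 1 / real (Suc n)) \<longlonglongrightarrow> b"
      using tendsto_add[OF tendsto_const LIMSEQ_Suc[OF lim_1_over_n], of b] by simp
  qed (use bB \<nu> in \<open>auto simp: less_imp_le\<close>)
  then have "\<exists>n. mirror_above (\<nu> n)"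
    using bB \<nu> by (intro mirror_above_right_open[OF mirror_above_b]) auto
  then show False using \<nu>(1) by (auto simp: B_def)
qed

lemma reflect_less:
  assumes "\<mu> < m" "x \<in> \<Omega>" "x \<bullet> e < \<mu>"
  shows "u x < u (reflect e \<mu> x)"
  using mirror_above_strict[OF assms(1) mirror_above_all assms(2,3)] assms(1) by (simp add: w_def)

lemma reflect_le: "x \<bullet> e < m \<Longrightarrow> u x \<le> u (reflect e m x)"
  using mirror_above_all[of m] by (simp add: mirror_above_def w_def)

text \<open>The symmetry of \<open>f\<close> at level \<open>m\<close> is stated on one side of the plane; on the other side it follows
  by applying it to the mirror image, and on the plane there is nothing to show.\<close>

lemma reflected_moving_planes:
  "moving_planes s a \<Omega> f (\<lambda>x. u (reflect e m x)) e m"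
proof
  let ?R = "reflect e m"
  have um: "u \<in> borel_measurable borel" using u_energy by (rule finite_energy_measurable)
  have R\<Omega>: "?R x \<in> \<Omega> \<longleftrightarrow> x \<in> \<Omega>" for x using sym[of x] sym[of "?R x"] e by auto
  show "continuous_on UNIV (\<lambda>x. u (?R x))"
    by (intro continuous_on_compose2[OF u_cont] continuous_intros) auto
  show "finite_energy s (\<lambda>x. u (?R x))" by (rule finite_energy_reflect[OF e um um u_energy])
  show "0 < u (?R x)" if "x \<in> \<Omega>" for x using u_pos R\<Omega> that by auto
  show "u (?R x) = 0" if "x \<notin> \<Omega>" for x using u_out R\<Omega> that by auto
  define F where "F x = indicator \<Omega> x * f x (u x)" for x
  have F_int: "integrable lebesgue F" using source_int by (simp add: F_def[abs_def])
  have FR: "indicator \<Omega> x * f x (u (?R x)) = F (?R x)" for x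
  proof (cases "x \<in> \<Omega>")
    case True
    consider "x \<bullet> e < m" | "x \<bullet> e = m" | "?R x \<bullet> e < m" by (fastforce simp: reflect_inner[OF e])
    then have "f x (u (?R x)) = f (?R x) (u (?R x))"
    proof cases
      case 1
      then show ?thesis using mono True u_nonneg[of "?R x"] by (simp add: reflection_monotone_def)
    next
      case 3
      then have "f (?R x) (u (?R x)) = f (?R (?R x)) (u (?R x))"
        using mono True R\<Omega> u_nonneg[of "?R x"] by (simp add: reflection_monotone_def)
      then show ?thesis using e by simp
    qed simp
    then show ?thesis using True R\<Omega> by (simp add: F_def)
  qed (simp add: F_def R\<Omega>)
  show "integrable lebesgue (\<lambda>x. indicator \<Omega> x * f x (u (?R x)))"
    unfolding FR by (rule lebesgue_reflect(1)[OF e F_int])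
  fix \<phi> M assume \<phi>: "finite_energy s \<phi>" "\<And>x. \<bar>\<phi> x\<bar> \<le> M" "\<And>x. x \<notin> \<Omega> \<Longrightarrow> \<phi> x = 0"
  have \<phi>m: "\<phi> \<in> borel_measurable borel" using \<phi>(1) by (rule finite_energy_measurable)
  have \<phi>R: "finite_energy s (\<lambda>x. \<phi> (?R x))" by (rule finite_energy_reflect[OF e \<phi>m \<phi>m \<phi>(1)])
  have \<phi>Rm: "(\<lambda>x. \<phi> (?R x)) \<in> borel_measurable borel" using \<phi>R by (rule finite_energy_measurable)
  have "energy s (\<lambda>x. u (?R x)) (\<lambda>x. \<phi> (?R (?R x))) = energy s u (\<lambda>x. \<phi> (?R x))"
    by (rule energy_reflect[OF e um \<phi>Rm])
  then have "a * energy s (\<lambda>x. u (?R x)) \<phi> = a * energy s u (\<lambda>x. \<phi> (?R x))" using e by simp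
  also have "\<dots> = (\<integral>x. F x * \<phi> (?R x) \<partial>lebesgue)"
    using \<phi>(2,3) R\<Omega> unfolding F_def by (intro weak[OF \<phi>R, of M]) auto
  also have "\<dots> = (\<integral>x. F (?R x) * \<phi> x \<partial>lebesgue)"
    using lebesgue_reflect(2)[OF e integrable_lebesgue_mult_bounded[OF F_int \<phi>Rm, of M], of m] \<phi>(2) e by simp
  finally show "a * energy s (\<lambda>x. u (?R x)) \<phi> = (\<integral>x. indicator \<Omega> x * f x (u (?R x)) * \<phi> x \<partial>lebesgue)"
    unfolding FR .
qed (use s a e open_\<Omega> bounded_\<Omega> lip mono cap sym in auto)

lemma reflect_eq: "u (reflect e m x) = u x"
proof -
  interpret R: moving_planes s a \<Omega> f "\<lambda>x. u (reflect e m x)" e m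
    by (rule reflected_moving_planes)
  have left: "u (reflect e m x) = u x" if "x \<bullet> e < m" for x
    using reflect_le[OF that] R.reflect_le[OF that] e by simp
  consider "x \<bullet> e < m" | "x \<bullet> e = m" | "x \<bullet> e > m" by linarith
  then show ?thesis
  proof cases
    case 3
    then have "reflect e m x \<bullet> e < m" by (simp add: reflect_inner[OF e])
    from left[OF this] show ?thesis using e by simp
  qed (use left in auto)
qed

end

section \<open>From weak solutions to symmetry and monotonicity\<close>

text \<open>Since \<open>u\<close> vanishes outside the open set \<open>\<Omega>\<close>, in particular on its frontier, continuity on the
  closure extends to the whole space. All functions involved are then Borel, and the domain of
  integration of the bilinear form may be enlarged to all pairs, because the integrand vanishes
  when both points lie outside \<open>\<Omega>\<close>.\<close>

lemma moving_planes_of_weak_solution: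
  fixes k :: "'n::finite" and \<Omega> :: "(real^'n) set"
  assumes s: "0 < s" "s < 1" and \<Omega>: "open \<Omega>" "bounded \<Omega>" and e: "norm e = 1"
    and cont: "continuous_on (closure \<Omega>) u" and weak: "weak_solution k s \<Omega> f u"
    and lip: "loc_Lipschitz_snd \<Omega> f" and mono: "reflection_monotone \<Omega> f e m"
    and cap: "\<And>\<mu> x. \<mu> < m \<Longrightarrow> x \<in> \<Omega> \<Longrightarrow> x \<bullet> e < \<mu> \<Longrightarrow> reflect e \<mu> x \<in> \<Omega>"
    and sym: "\<And>x. x \<in> \<Omega> \<Longrightarrow> reflect e m x \<in> \<Omega>"
  shows "moving_planes s (frac_const k s / 2) \<Omega> f u e m"
proof
  have u: "u \<in> Hs0 s \<Omega>" "\<And>x. x \<in> \<Omega> \<Longrightarrow> 0 < u x" and fint: "set_integrable lebesgue \<Omega> (\<lambda>x. f x (u x))"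
    and wk: "\<And>\<phi>. \<phi> \<in> Hs0 s \<Omega> \<inter> Collect ess_bounded \<Longrightarrow>
        frac_const k s / 2 *
          (LINT z : - ((- \<Omega>) \<times> (- \<Omega>)) | lebesgue.
             (u (fst z) - u (snd z)) * (\<phi> (fst z) - \<phi> (snd z))
               / norm (fst z - snd z) powr (real CARD('n) + 2 * s))
        = (LINT x : \<Omega> | lebesgue. f x (u x) * \<phi> x)"
    using weak unfolding weak_solution_def by auto
  show out: "u x = 0" if "x \<notin> \<Omega>" for x using u(1) that by (simp add: Hs0_def)
  have "continuous_on (closure \<Omega> \<union> - \<Omega>) u"
  proof (rule continuous_on_closed_Un)
    have "continuous_on (- \<Omega>) u \<longleftrightarrow> continuous_on (- \<Omega>) (\<lambda>_. 0 :: real)"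
      by (rule continuous_on_cong) (auto simp: out)
    then show "continuous_on (- \<Omega>) u" by simp
  qed (use \<Omega> cont in \<open>auto simp: closed_Compl\<close>)
  moreover have "closure \<Omega> \<union> - \<Omega> = UNIV" using closure_subset[of \<Omega>] by auto
  ultimately show uc: "continuous_on UNIV u" by simp
  then have um: "u \<in> borel_measurable borel" by (rule borel_measurable_continuous_onI)
  show "finite_energy s u" using u(1) Hs_iff_finite_energy[OF um] by (simp add: Hs0_def)
  show "0 < u x" if "x \<in> \<Omega>" for x using u(2) that by simp
  show "integrable lebesgue (\<lambda>x. indicator \<Omega> x * f x (u x))"
    using fint by (simp add: set_integrable_def)
  show "0 < frac_const k s / 2" using frac_const_pos[OF s] by simp
  fix \<phi> M assume \<phi>: "finite_energy s \<phi>" "\<And>x. \<bar>\<phi> x\<bar> \<le> M" "\<And>x. x \<notin> \<Omega> \<Longrightarrow> \<phi> x = 0"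
  have \<phi>m [measurable]: "\<phi> \<in> borel_measurable borel" using \<phi>(1) by (rule finite_energy_measurable)
  have "integrable lborel (\<lambda>x. (\<phi> x)\<^sup>2)"
  proof (rule integrable_lborel_compact_support[where M = "M\<^sup>2" and D = \<Omega>])
    show "\<bar>(\<phi> x)\<^sup>2\<bar> \<le> M\<^sup>2" for x using power_mono[OF \<phi>(2)[of x], of 2] by simp
  qed (use \<phi>(3) \<Omega>(2) in auto)
  then have "\<phi> \<in> Hs0 s \<Omega>" using Hs_iff_finite_energy[OF \<phi>m] \<phi>(1,3) by (simp add: Hs0_def)
  moreover have "ess_bounded \<phi>"
    unfolding ess_bounded_def using \<phi>(2) by (auto intro!: exI[of _ M] measurable_completion)
  ultimately have "frac_const k s / 2 *
          (LINT z : - ((- \<Omega>) \<times> (- \<Omega>)) | lebesgue.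
             (u (fst z) - u (snd z)) * (\<phi> (fst z) - \<phi> (snd z))
               / norm (fst z - snd z) powr (real CARD('n) + 2 * s))
        = (LINT x : \<Omega> | lebesgue. f x (u x) * \<phi> x)"
    by (intro wk) simp
  also have "(LINT z : - ((- \<Omega>) \<times> (- \<Omega>)) | lebesgue.
             (u (fst z) - u (snd z)) * (\<phi> (fst z) - \<phi> (snd z))
               / norm (fst z - snd z) powr (real CARD('n) + 2 * s)) = integral\<^sup>L lebesgue (interaction s u \<phi>)"
    unfolding set_lebesgue_integral_def
  proof (rule Bochner_Integration.integral_cong[OF refl])
    fix z :: "(real^'n) \<times> (real^'n)"
    show "indicat_real (- ((- \<Omega>) \<times> (- \<Omega>))) z *\<^sub>R ((u (fst z) - u (snd z)) * (\<phi> (fst z) - \<phi> (snd z))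
               / norm (fst z - snd z) powr (real CARD('n) + 2 * s)) = interaction s u \<phi> z"
      using out \<phi>(3) by (cases z) (auto simp: interaction_def frac_kernel_def indicator_def)
  qed
  also have "\<dots> = energy s u \<phi>"
    unfolding energy_def using interaction_measurable[OF um \<phi>m, of s] by (intro integral_completion) simp
  finally show "frac_const k s / 2 * energy s u \<phi> = (\<integral>x. indicator \<Omega> x * f x (u x) * \<phi> x \<partial>lebesgue)"
    by (simp add: set_lebesgue_integral_def mult.assoc)
qed (use s e \<Omega> lip mono cap sym in auto)

text \<open>At a level \<open>\<mu> < m\<close> the mirror image lies on the segment from \<open>x\<close> to its mirror image at level \<open>m\<close>.\<close>

lemma reflect_mem_of_convex_in_coordinate:
  fixes k :: "'n::finite"
  assumes conv: "convex_in_coordinate k \<Omega>" and sym: "reflect (axis k 1) m ` \<Omega> = \<Omega>"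
    and \<mu>: "\<mu> < m" and x: "x \<in> \<Omega>" "x \<bullet> axis k 1 < \<mu>"
  shows "reflect (axis k 1) \<mu> x \<in> \<Omega>"
proof -
  let ?e = "axis k 1 :: real^'n"
  define y where "y = reflect ?e m x"
  have y: "y \<in> \<Omega>" using sym x(1) by (auto simp: y_def)
  have "\<forall>j. j \<noteq> k \<longrightarrow> x $ j = y $ j" by (simp add: y_def reflect_axis)
  then have seg: "closed_segment x y \<subseteq> \<Omega>" using conv x(1) y by (simp add: convex_in_coordinate_def)
  define t where "t = (\<mu> - x \<bullet> ?e) / (m - x \<bullet> ?e)"
  have pos: "0 < m - x \<bullet> ?e" using \<mu> x by simp
  have t: "0 \<le> t" "t \<le> 1" using \<mu> x pos by (auto simp: t_def)
  have "t * (m - x \<bullet> ?e) = \<mu> - x \<bullet> ?e" using pos by (simp add: t_def)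
  then have "t * (2 * (m - x \<bullet> ?e)) = 2 * (\<mu> - x \<bullet> ?e)" by (metis mult.left_commute)
  then have "reflect ?e \<mu> x = x + t *\<^sub>R (y - x)" by (simp add: y_def reflect_def)
  then have "reflect ?e \<mu> x = (1 - t) *\<^sub>R x + t *\<^sub>R y" by (simp add: algebra_simps)
  then have "reflect ?e \<mu> x \<in> closed_segment x y" using t by (auto simp: closed_segment_def)
  then show ?thesis using seg by auto
qed

lemma reflect_mem_ball:
  fixes c :: "'a::euclidean_space"
  assumes e: "norm e = 1" and \<mu>: "x \<bullet> e < \<mu>" "\<mu> \<le> c \<bullet> e" and x: "x \<in> ball c R"
  shows "reflect e \<mu> x \<in> ball c R"
proof -
  have "(norm (c - reflect e \<mu> x))\<^sup>2 \<le> (norm (c - x))\<^sup>2"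
    using \<mu> by (simp add: norm_minus_reflect_sq[OF e] mult_nonpos_nonneg)
  then have "norm (c - reflect e \<mu> x) \<le> norm (c - x)" by (rule power2_le_imp_le) simp
  then show ?thesis using x by (simp add: dist_norm)
qed

lemma reflect_through_centre_mem_ball:
  fixes c :: "'a::euclidean_space"
  assumes e: "norm e = 1" and x: "x \<in> ball c R"
  shows "reflect e (c \<bullet> e) x \<in> ball c R"
proof -
  have "(norm (c - reflect e (c \<bullet> e) x))\<^sup>2 = (norm (c - x))\<^sup>2"
    by (simp add: norm_minus_reflect_sq[OF e])
  then show ?thesis using x by (simp add: dist_norm)
qed

text \<open>Two points at the same distance from \<open>c\<close> are mirror images in their perpendicular bisector, which
  passes through \<open>c\<close>.\<close>

lemma radial_of_reflection_invariant:
  fixes u :: "'a::euclidean_space \<Rightarrow> 'b"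
  assumes inv: "\<And>e x. norm e = 1 \<Longrightarrow> u (reflect e (c \<bullet> e) x) = u x" and d: "dist c x = dist c y"
  shows "u x = u y"
proof (cases "x = y")
  case False
  define e where "e = (x - y) /\<^sub>R norm (x - y)"
  have e: "norm e = 1" using False by (simp add: e_def)
  have "(norm (c - x))\<^sup>2 = (norm (c - y))\<^sup>2" using d by (simp add: dist_norm)
  then have "2 * ((c - x) \<bullet> (x - y)) = - ((x - y) \<bullet> (x - y))"
    by (simp add: power2_norm_eq_inner inner_diff_left inner_diff_right inner_commute algebra_simps)
  moreover have "(c - x) \<bullet> e * norm (x - y) = (c - x) \<bullet> (x - y)"
    using False by (simp add: e_def)
  ultimately have "2 * ((c - x) \<bullet> e) * norm (x - y) = - (norm (x - y))\<^sup>2"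
    by (simp only: mult.assoc power2_norm_eq_inner)
  then have "(2 * ((c - x) \<bullet> e) + norm (x - y)) * norm (x - y) = 0"
    by (simp add: distrib_right power2_eq_square)
  then have "2 * ((c - x) \<bullet> e) + norm (x - y) = 0"
    using False by simp
  then have "2 * ((c - x) \<bullet> e) = - norm (x - y)" by linarith
  then have "reflect e (c \<bullet> e) x = x - norm (x - y) *\<^sub>R e"
    by (simp add: reflect_def inner_diff_left)
  also have "\<dots> = y" using False by (simp add: e_def)
  finally show ?thesis using inv[OF e, of x] by simp
qed simp

theorem theorem1p2:
  fixes s :: real and k :: "'n::finite"
    and \<Omega> :: "(real^'n) set"
    and f :: "real^'n \<Rightarrow> real \<Rightarrow> real"
    and u :: "real^'n \<Rightarrow> real"
  assumes "0 < s" and "s < 1" and "real CARD('n) > 2 * s"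
    and "bounded_smooth_domain \<Omega>" and "0 \<in> \<Omega>"
    and "continuous_on (closure \<Omega>) u"
    and "weak_solution k s \<Omega> f u"
    and "convex_in_coordinate k \<Omega>"
    and "reflect (axis k 1) 0 ` \<Omega> = \<Omega>"
    and "reflection_monotone \<Omega> f (axis k 1) 0"
    and "Caratheodory \<Omega> f \<and> loc_Lipschitz_snd \<Omega> f \<and> nondecreasing_snd \<Omega> f
       \<or> Caratheodory \<Omega> f \<and> loc_Lipschitz_snd \<Omega> f \<and> Hoelder_away_from_origin \<Omega> f"
  shows "(\<forall>x. u (reflect (axis k 1) 0 x) = u x)
    \<and> (\<forall>x\<in>\<Omega>. \<forall>y\<in>\<Omega>. (\<forall>j. j \<noteq> k \<longrightarrow> x $ j = y $ j) \<and> x $ k < y $ k \<and> y $ k < 0 \<longrightarrow> u x < u y)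
    \<and> (\<forall>c R. \<Omega> = ball c R \<and> (\<forall>e. norm e = 1 \<longrightarrow> reflection_monotone \<Omega> f e (c \<bullet> e)) \<longrightarrow>
         (\<exists>g. (\<forall>x. u x = g (dist c x)) \<and> strict_antimono_on {0..<R} g))"
proof (intro conjI allI ballI impI)
  have \<Omega>: "open \<Omega>" "bounded \<Omega>" using assms(4) by (auto simp: bounded_smooth_domain_def)
  have lip: "loc_Lipschitz_snd \<Omega> f" using assms(11) by auto
  let ?e = "axis k 1 :: real^'n"
  have e: "norm ?e = 1" by simp
  have xk: "x \<bullet> ?e = x $ k" for x :: "real^'n" by (simp add: inner_axis)
  interpret K: moving_planes s "frac_const k s / 2" \<Omega> f u ?e 0
    by (rule moving_planes_of_weak_solution[OF assms(1,2) \<Omega> e assms(6,7) lip assms(10)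
          reflect_mem_of_convex_in_coordinate[OF assms(8,9)]])
       (use assms(9) in auto)
  show "u (reflect ?e 0 x) = u x" for x by (rule K.reflect_eq)
  show "u x < u y" if x: "x \<in> \<Omega>" and xy: "(\<forall>j. j \<noteq> k \<longrightarrow> x $ j = y $ j) \<and> x $ k < y $ k \<and> y $ k < 0" for x y
  proof -
    define \<mu> where "\<mu> = (x $ k + y $ k) / 2"
    have "reflect ?e \<mu> x = y" using xy by (auto simp: reflect_axis vec_eq_iff \<mu>_def field_simps)
    moreover have "u x < u (reflect ?e \<mu> x)"
      using xy x by (intro K.reflect_less) (auto simp: xk \<mu>_def)
    ultimately show ?thesis by simp
  qed
  fix c R assume ball: "\<Omega> = ball c R \<and> (\<forall>e. norm e = 1 \<longrightarrow> reflection_monotone \<Omega> f e (c \<bullet> e))"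
  have mp: "moving_planes s (frac_const k s / 2) \<Omega> f u e (c \<bullet> e)"
    if e: "norm e = 1" for e
  proof (rule moving_planes_of_weak_solution[OF assms(1,2) \<Omega> e assms(6,7) lip])
    show "reflection_monotone \<Omega> f e (c \<bullet> e)" using ball e by blast
    show "reflect e \<mu> x \<in> \<Omega>" if "\<mu> < c \<bullet> e" "x \<in> \<Omega>" "x \<bullet> e < \<mu>" for \<mu> x
      using reflect_mem_ball[OF e that(3), of c R] that ball by (simp del: mem_ball)
    show "reflect e (c \<bullet> e) x \<in> \<Omega>" if "x \<in> \<Omega>" for x
      using reflect_through_centre_mem_ball[OF e, of x c R] that ball by (simp del: mem_ball)
  qed
  define g where "g = (\<lambda>r. u (c - r *\<^sub>R ?e))"
  have "u x = g (dist c x)" for x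
    unfolding g_def
    by (rule radial_of_reflection_invariant[of u c, OF moving_planes.reflect_eq[OF mp]])
       (auto simp: dist_norm)
  moreover have "strict_antimono_on {0..<R} g"
  proof (rule monotone_onI)
    fix p q assume pq: "p \<in> {0..<R}" "q \<in> {0..<R}" "p < q"
    define x where "x = c - q *\<^sub>R ?e"
    define \<mu> where "\<mu> = c \<bullet> ?e - (p + q) / 2"
    have xe: "x \<bullet> ?e = c \<bullet> ?e - q" by (simp add: x_def inner_diff_left inner_axis_axis)
    have "u x < u (reflect ?e \<mu> x)"
    proof (rule moving_planes.reflect_less[OF mp[OF e]])
      show "x \<in> \<Omega>" using ball pq by (auto simp: x_def dist_norm)
    qed (use pq xe in \<open>auto simp: \<mu>_def\<close>)
    moreover have "reflect ?e \<mu> x = c - p *\<^sub>R ?e"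
    proof -
      have "2 * (\<mu> - x \<bullet> ?e) = q - p" by (simp add: xe \<mu>_def field_simps)
      then show ?thesis by (simp add: reflect_def x_def scaleR_left_diff_distrib)
    qed
    ultimately show "g q < g p" by (simp add: g_def x_def)
  qed
  ultimately show "\<exists>g. (\<forall>x. u x = g (dist c x)) \<and> strict_antimono_on {0..<R} g" by blast
qed

end
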